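(* Every minimal Lagrangian torus $\varphi:T^2\to\mathbb{CP}^2$ has a doubly periodic primitive lift $\psi_2:\tilde T^2\to FL_2$, where $\tilde T^2\to T^2$ is a covering torus with covering group either $1$ or $\mathbb{Z}_3$. Consequently $\varphi$ determines a minimal Legendrian $f:\tilde T^2\to S^5$ and an immersed special Lagrangian cone $\kappa:C(\tilde T^2)\to\mathbb{C}^3$.
   Context: A minimal Lagrangian torus is a minimal immersion $\varphi:T^2\to\mathbb{CP}^2$ of an oriented torus (with induced conformal structure) with $\varphi^*\omega=0$, $\omega$ the Fubini-Study form. A minimal Legendrian $f$ is a minimal immersion tangent to the standard contact distribution of $S^5\subset\mathbb{C}^3$; here $f$ lifts $\varphi$ (composed with the covering) through the Hopf fibration $S^5\to\mathbb{CP}^2$, and is determined up to a constant unimodular factor. An oriented 3-submanifold of $\mathbb{C}^3$ is special Lagrangian if its oriented tangent planes lie in the $SU_3$-orbit of $\mathrm{Sp}_{\mathbb{R}}\{e_1,e_2,e_3\}$; an immersed special Lagrangian cone $\kappa:C(\tilde T^2)\to\mathbb{C}^3$ is the cone (union of rays from the origin) over an immersion $\tilde T^2\to S^5$ (namely $f$, after multiplication by a suitable unimodular constant), special Lagrangian away from the origin. $FL_2=\{(w,W)\in S^5\times Gr_{\mathbb{C}}(2,\mathbb{C}^3):w\in W\}\cong SU_3/K_2$, with base point $(e_1,\mathrm{Sp}_{\mathbb{C}}\{e_1,e_2\})$ and $K_2=\{\mathrm{diag}(1,a,a^{-1})\in SU_3\}$. It is the 6-symmetric space for $\sigma=\mu\nu$,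 $\nu(g)=SgS^{-1}$, $S=\mathrm{diag}(1,\epsilon,\epsilon^2)$, $\epsilon=e^{2\pi i/3}$, $\mu(g)=T(g^{-1})^tT^{-1}$, $T$ the permutation matrix fixing $e_1$ and swapping $e_2,e_3$. The $(-\epsilon)$-eigenspace of $\sigma$ is $$\mathfrak{g}_1=\left\{\begin{pmatrix}0&0&\alpha\\ \alpha&0&0\\0&\beta&0\end{pmatrix}:\alpha,\beta\in\mathbb{C}\right\},$$ and $[\mathfrak{g}_1]\subset T^{\mathbb{C}}FL_2$ has fibre at $gK_2$ the image of $\mathfrak{g}_1$ under the complex linear extension of $X\mapsto\frac{d}{dt}\big|_{t=0}ge^{tX}K_2$. An immersion $\psi$ of a Riemann surface into $FL_2$ is primitive if $d\psi(\partial/\partial z)$ takes values in $[\mathfrak{g}_1]$. A primitive lift of $\varphi$ is a primitive map $\psi_2=(f,\ell_0\oplus\ell_1)$ where $f$ is a horizontal (i.e. Legendrian) lift of $\varphi$ to $S^5$, $\ell_0=\mathrm{Sp}_{\mathbb{C}}\{f\}$ and $\ell_1=\mathrm{Sp}_{\mathbb{C}}\{f_z\}$, $z$ a local complex coordinate. Doubly periodic means that, as a map on the universal cover $\mathbb{R}^2$ of $T^2$, it factors through a torus. *)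

theory Defs
  imports "HOL-Analysis.Analysis" "HOL-Algebra.Elementary_Groups"
begin

section \<open>Smooth maps, immersions, minimal immersions\<close>

abbreviation dirderiv :: "('a::real_normed_vector \<Rightarrow> 'b::real_normed_vector) \<Rightarrow> 'a \<Rightarrow> 'a \<Rightarrow> 'b" where
  "dirderiv F p v \<equiv> frechet_derivative F (at p) v"

primrec Ck_on :: "nat \<Rightarrow> 'a::real_normed_vector set \<Rightarrow> ('a \<Rightarrow> 'b::real_normed_vector) \<Rightarrow> bool" where
  "Ck_on 0 U F \<longleftrightarrow> continuous_on U F"
| "Ck_on (Suc k) U F \<longleftrightarrow>
     (\<forall>p\<in>U. F differentiable (at p)) \<and> (\<forall>v. Ck_on k U (\<lambda>p. dirderiv F p v))"

text \<open>Meant for open subsets of finite-dimensional spaces.\<close>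

definition smooth_on :: "'a::real_normed_vector set \<Rightarrow> ('a \<Rightarrow> 'b::real_normed_vector) \<Rightarrow> bool" where
  "smooth_on U F \<longleftrightarrow> (\<forall>k. Ck_on k U F)"

definition immersion_on :: "'a::real_normed_vector set \<Rightarrow> ('a \<Rightarrow> 'b::real_normed_vector) \<Rightarrow> bool" where
  "immersion_on U F \<longleftrightarrow> smooth_on U F \<and> (\<forall>p\<in>U. inj (\<lambda>v. dirderiv F p v))"

text \<open>Tangent space of an embedded submanifold of a Euclidean space.\<close>

definition tangent_space :: "'b::real_normed_vector set \<Rightarrow> 'b \<Rightarrow> 'b set" where
  "tangent_space M x =
     {\<xi>. \<exists>\<gamma>. (\<forall>t::real. \<gamma> t \<in> M) \<and> \<gamma> 0 = x \<and> (\<gamma> has_vector_derivative \<xi>) (at 0)}"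

text \<open>Minimal immersions of surfaces (in arbitrary coordinates on the plane) into an embedded
  submanifold \<open>M\<close> of a Euclidean space, \<open>M\<close> carrying the induced metric. The Levi-Civita connection
  of \<open>M\<close> is the tangential part of the ambient derivative. Hence, for \<open>\<xi>\<close> tangent to \<open>M\<close> and
  normal to the surface, the \<open>\<xi>\<close>-component of the second fundamental form is
  \<open>(v, w) \<mapsto> \<xi> \<bullet> D\<^sub>v D\<^sub>w F\<close>, and its trace over an orthonormal basis of the induced metric
  is the \<open>\<xi>\<close>-component of (twice) the mean curvature vector.\<close>

definition minimal_immersion :: "'b::real_inner set \<Rightarrow> (real^2 \<Rightarrow> 'b) \<Rightarrow> bool" where
  "minimal_immersion M F \<longleftrightarrow>
     immersion_on UNIV F \<and> range F \<subseteq> M \<and>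
     (\<forall>p. \<forall>\<xi>\<in>tangent_space M (F p). (\<forall>u. \<xi> \<bullet> dirderiv F p u = 0) \<longrightarrow>
       (\<forall>v w. norm (dirderiv F p v) = 1 \<and> norm (dirderiv F p w) = 1 \<and>
              dirderiv F p v \<bullet> dirderiv F p w = 0 \<longrightarrow>
          \<xi> \<bullet> (dirderiv (\<lambda>q. dirderiv F q v) p v + dirderiv (\<lambda>q. dirderiv F q w) p w) = 0))"

text \<open>The induced conformal structure of an immersed plane with its standard orientation: the pairs
  \<open>(v, w)\<close> at \<open>p\<close> that arise as \<open>(\<partial>/\<partial>x, \<partial>/\<partial>y)\<close>
  for a local complex coordinate \<open>z = x + \<i>y\<close>. For such a pair,
  \<open>\<partial>/\<partial>z = (v - \<i>w)/2\<close>.\<close>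

definition conformal_frame :: "(real^2 \<Rightarrow> 'b::real_inner) \<Rightarrow> real^2 \<Rightarrow> real^2 \<Rightarrow> real^2 \<Rightarrow> bool" where
  "conformal_frame F p v w \<longleftrightarrow>
     norm (dirderiv F p v) = norm (dirderiv F p w) \<and>
     dirderiv F p v \<bullet> dirderiv F p w = 0 \<and>
     v$1 * w$2 - v$2 * w$1 > 0"

section \<open>Tori and their coverings\<close>

text \<open>The torus \<open>\<real>\<^sup>2/\<Lambda>\<close> is represented by its lattice, and maps on it by
  \<open>\<Lambda>\<close>-periodic maps on the plane.\<close>

definition plane_lattice :: "(real^2) set \<Rightarrow> bool" where
  "plane_lattice \<Lambda> \<longleftrightarrow> (\<exists>a b. a \<noteq> b \<and> independent {a, b} \<and>
     \<Lambda> = {of_int m *\<^sub>R a + of_int n *\<^sub>R b | m n :: int. True})"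

definition periodic :: "(real^2) set \<Rightarrow> (real^2 \<Rightarrow> 'b) \<Rightarrow> bool" where
  "periodic \<Lambda> F \<longleftrightarrow> (\<forall>p. \<forall>l\<in>\<Lambda>. F (p + l) = F p)"

text \<open>The group of the covering \<open>\<real>\<^sup>2/\<Lambda>' \<rightarrow> \<real>\<^sup>2/\<Lambda>\<close>,
  for lattices \<open>\<Lambda>' \<subseteq> \<Lambda>\<close>.\<close>

definition covering_group :: "(real^2) set \<Rightarrow> (real^2) set \<Rightarrow> (real^2) set monoid" where
  "covering_group \<Lambda>' \<Lambda> = \<lparr>carrier = \<Lambda>, monoid.mult = (+), one = 0\<rparr> Mod \<Lambda>'"

section \<open>Complex linear algebra\<close>

definition hprod :: "complex^3 \<Rightarrow> complex^3 \<Rightarrow> complex" where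
  "hprod u v = (\<Sum>i\<in>UNIV. u$i * cnj (v$i))"

definition ctranspose :: "complex^3^3 \<Rightarrow> complex^3^3" where
  "ctranspose A = (\<chi> i j. cnj (A$j$i))"

definition SU3 :: "(complex^3^3) set" where
  "SU3 = {g. ctranspose g ** g = mat 1 \<and> det g = 1}"

definition su3 :: "(complex^3^3) set" where
  "su3 = {A. ctranspose A = - A \<and> trace A = 0}"

definition mat_exp :: "complex^3^3 \<Rightarrow> complex^3^3" where
  "mat_exp A = (\<Sum>n. (((**) A) ^^ n) (mat 1) /\<^sub>R fact n)"

definition Grassmannian :: "nat \<Rightarrow> (complex^3) set set" where
  "Grassmannian k = {W. vec.subspace W \<and> vec.dim W = k}"

text \<open>Orthogonal projector onto a complex subspace; it embeds the Grassmannians as submanifolds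
  into the Euclidean space of complex matrices.\<close>

definition orth_proj :: "(complex^3) set \<Rightarrow> complex^3^3" where
  "orth_proj W = (THE Q. \<forall>v. Q *v v \<in> W \<and> (\<forall>w\<in>W. hprod (v - Q *v v) w = 0))"

section \<open>Minimal Lagrangian tori in the projective plane\<close>

text \<open>For a unit vector \<open>u\<close>, the tangent vectors of \<open>orth_proj ` Grassmannian 1\<close> at
  \<open>P = orth_proj (vec.span {u})\<close> are \<open>A = h u\<^sup>* + u h\<^sup>*\<close> with \<open>hprod h u = 0\<close>.
  As \<open>A \<bullet> A = 2 (h \<bullet> h)\<close>, the induced metric is twice the Fubini-Study metric
  (the one that makes the Hopf fibration of the unit sphere a Riemannian submersion), which has the
  same minimal immersions and the same induced conformal structures. The complex structure maps
  \<open>A\<close> to \<open>(\<i>h) u\<^sup>* + u (\<i>h)\<^sup>* = \<i>(A P - P A)\<close>.\<close>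

definition fubini_study_form :: "complex^3^3 \<Rightarrow> complex^3^3 \<Rightarrow> complex^3^3 \<Rightarrow> real" where
  "fubini_study_form P A B = ((mat \<i> ** (A ** P - P ** A)) \<bullet> B) / 2"

definition minimal_lagrangian_torus :: "(real^2) set \<Rightarrow> (real^2 \<Rightarrow> (complex^3) set) \<Rightarrow> bool" where
  "minimal_lagrangian_torus \<Lambda> \<phi> \<longleftrightarrow>
     plane_lattice \<Lambda> \<and> periodic \<Lambda> \<phi> \<and> range \<phi> \<subseteq> Grassmannian 1 \<and>
     minimal_immersion (orth_proj ` Grassmannian 1) (orth_proj \<circ> \<phi>) \<and>
     (\<forall>p v w. fubini_study_form (orth_proj (\<phi> p))
        (dirderiv (orth_proj \<circ> \<phi>) p v) (dirderiv (orth_proj \<circ> \<phi>) p w) = 0)"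

section \<open>Legendrian lifts\<close>

definition contact_distribution :: "complex^3 \<Rightarrow> (complex^3) set" where
  "contact_distribution w = {h. hprod h w = 0}"

definition minimal_legendrian :: "(real^2 \<Rightarrow> complex^3) \<Rightarrow> bool" where
  "minimal_legendrian f \<longleftrightarrow>
     minimal_immersion (sphere 0 1) f \<and> (\<forall>p v. dirderiv f p v \<in> contact_distribution (f p))"

definition horizontal_lift :: "(real^2 \<Rightarrow> (complex^3) set) \<Rightarrow> (real^2 \<Rightarrow> complex^3) \<Rightarrow> bool" where
  "horizontal_lift \<phi> f \<longleftrightarrow>
     smooth_on UNIV f \<and>
     (\<forall>p. norm (f p) = 1 \<and> vec.span {f p} = \<phi> p \<and>
          (\<forall>v. dirderiv f p v \<in> contact_distribution (f p)))"

section \<open>Primitive lifts to the flag manifold\<close>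

definition FL2 :: "((complex^3) \<times> (complex^3) set) set" where
  "FL2 = {(w, W). w \<in> sphere 0 1 \<and> W \<in> Grassmannian 2 \<and> w \<in> W}"

definition FL2_embed :: "(complex^3) \<times> (complex^3) set \<Rightarrow> (complex^3) \<times> (complex^3^3)" where
  "FL2_embed = (\<lambda>(w, W). (w, orth_proj W))"

definition FL2_act :: "complex^3^3 \<Rightarrow> (complex^3) \<times> (complex^3) set \<Rightarrow> (complex^3) \<times> (complex^3) set" where
  "FL2_act g = (\<lambda>(w, W). (g *v w, (*v) g ` W))"

definition FL2_base :: "(complex^3) \<times> (complex^3) set" where
  "FL2_base = (axis 1 1, vec.span {axis 1 1, axis 2 1})"

definition g1 :: "(complex^3^3) set" where
  "g1 = {vector [vector [0, 0, \<alpha>], vector [\<alpha>, 0, 0], vector [0, \<beta>, 0]] | \<alpha> \<beta>. True}"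

text \<open>The subbundle of the complexified tangent bundle of \<open>FL2\<close> induced by \<open>g1\<close>. A pair
  \<open>(\<xi>, \<eta>)\<close> of tangent vectors stands for \<open>\<xi> + \<i>\<eta>\<close>; correspondingly, an element
  of \<open>g1\<close> is split as \<open>A + \<i>B\<close> with \<open>A\<close> and \<open>B\<close> in the real form \<open>su3\<close>.\<close>

definition g1_bundle ::
    "(complex^3) \<times> (complex^3) set \<Rightarrow> (((complex^3) \<times> (complex^3^3)) \<times> ((complex^3) \<times> (complex^3^3))) set" where
  "g1_bundle q = {(\<xi>, \<eta>). \<exists>g\<in>SU3. \<exists>A\<in>su3. \<exists>B\<in>su3.
     FL2_act g FL2_base = q \<and> A + mat \<i> ** B \<in> g1 \<and>
     ((\<lambda>t. FL2_embed (FL2_act (g ** mat_exp (t *\<^sub>R A)) FL2_base)) has_vector_derivative \<xi>) (at 0) \<and>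
     ((\<lambda>t. FL2_embed (FL2_act (g ** mat_exp (t *\<^sub>R B)) FL2_base)) has_vector_derivative \<eta>) (at 0)}"

text \<open>The first argument only serves to fix the conformal structure on the plane.\<close>

definition primitive ::
    "(real^2 \<Rightarrow> 'b::real_inner) \<Rightarrow> (real^2 \<Rightarrow> (complex^3) \<times> (complex^3) set) \<Rightarrow> bool" where
  "primitive F \<psi> \<longleftrightarrow>
     range \<psi> \<subseteq> FL2 \<and> immersion_on UNIV (FL2_embed \<circ> \<psi>) \<and>
     (\<forall>p v w. conformal_frame F p v w \<longrightarrow>
        ((1/2) *\<^sub>R dirderiv (FL2_embed \<circ> \<psi>) p v, - (1/2) *\<^sub>R dirderiv (FL2_embed \<circ> \<psi>) p w)
          \<in> g1_bundle (\<psi> p))"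

definition primitive_lift ::
    "(real^2 \<Rightarrow> (complex^3) set) \<Rightarrow> (real^2 \<Rightarrow> (complex^3) \<times> (complex^3) set) \<Rightarrow> bool" where
  "primitive_lift \<phi> \<psi> \<longleftrightarrow>
     primitive (orth_proj \<circ> \<phi>) \<psi> \<and> horizontal_lift \<phi> (fst \<circ> \<psi>) \<and>
     (\<forall>p v w. conformal_frame (orth_proj \<circ> \<phi>) p v w \<longrightarrow>
        (let f = fst \<circ> \<psi>;
             f\<^sub>z = (1/2) *s (dirderiv f p v - \<i> *s dirderiv f p w)
         in snd (\<psi> p) = {a + b | a b. a \<in> vec.span {f p} \<and> b \<in> vec.span {f\<^sub>z}}))"

section \<open>Special Lagrangian cones\<close>

text \<open>The oriented tangent plane at \<open>\<kappa> q\<close> is the image under \<open>g\<close> of the standardly oriented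
  real span of \<open>e\<^sub>1, e\<^sub>2, e\<^sub>3\<close>: the differential of \<open>\<kappa>\<close> is \<open>g\<close> composed with an
  orientation-preserving isomorphism \<open>A\<close> onto that span.\<close>

definition special_lagrangian_on :: "(real^3) set \<Rightarrow> (real^3 \<Rightarrow> complex^3) \<Rightarrow> bool" where
  "special_lagrangian_on U \<kappa> \<longleftrightarrow>
     immersion_on U \<kappa> \<and>
     (\<forall>q\<in>U. \<exists>g\<in>SU3. \<exists>A::real^3^3. det A > 0 \<and>
        (\<forall>v. dirderiv \<kappa> q v = g *v (\<chi> i. complex_of_real ((A *v v)$i))))"

text \<open>The cone over \<open>f\<close> in the coordinates \<open>(r, x, y)\<close>; \<open>r > 0\<close> is the complement of
  the vertex.\<close>

definition cone_map :: "(real^2 \<Rightarrow> complex^3) \<Rightarrow> real^3 \<Rightarrow> complex^3" where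
  "cone_map f q = (q$1) *\<^sub>R f (vector [q$2, q$3])"

definition special_lagrangian_cone :: "(real^2 \<Rightarrow> complex^3) \<Rightarrow> bool" where
  "special_lagrangian_cone f \<longleftrightarrow>
     range f \<subseteq> sphere 0 1 \<and> immersion_on UNIV f \<and>
     special_lagrangian_on {q. q$1 > 0} (cone_map f)"

end

theory Submission
  imports Defs
begin

text \<open>
Let \<open>P\<close> be the field of orthogonal projectors of a minimal Lagrangian torus \<open>\<phi>\<close> on the universal
cover \<open>\<real>\<^sup>2\<close>. For a unit vector \<open>u\<close> of the line \<open>\<phi>(q)\<close>, the tangent vector \<open>dP(x)\<close> is encoded by
\<open>h(x) = dP(x) u\<close>, which is Hermitian orthogonal to \<open>u\<close>; the Lagrangian condition says that the
Hermitian products of these vectors are real. Hence \<open>det(u, h(e\<^sub>1), h(e\<^sub>2))\<close> has the area of the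
frame as its modulus. It is homogeneous of degree three in \<open>u\<close>, so exactly three unit vectors of the
line give it the phase \<open>\<i>\<close>, and they differ by cube roots of unity. They form a threefold covering
of the plane (\<open>covering_lift_space\<close>), which has a section \<open>f\<close> because the plane is simply connected.

The section is automatically horizontal (\<open>conn_zero\<close>). Write \<open>\<i> \<theta>\<close> for the component of \<open>df\<close>
along \<open>f\<close> and \<open>C(x, y, z) = Im \<langle>D\<^sub>xD\<^sub>yP f, h(z)\<rangle>\<close>. Mixed derivatives commute, and the derivative of the
Lagrangian condition gives the remaining symmetry, so \<open>C\<close> is totally symmetric
(\<open>cubic_symmetric\<close>); minimality makes it trace free (\<open>cubic_trace\<close>). The logarithmic
derivative of the determinant, whose phase is constant, has imaginary part \<open>3\<theta> + tr C = 3\<theta>\<close>, so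
\<open>\<theta> = 0\<close>. Then \<open>df = dP f\<close>, which makes \<open>f\<close> smooth, and the properties of \<open>C\<close> show that \<open>f\<close> is
minimal Legendrian.

For a local complex coordinate \<open>z\<close>, the vectors \<open>f\<close>, \<open>f\<^sub>z\<close> and the derivative of \<open>f\<close> by the conjugate of
\<open>z\<close> are mutually orthogonal. After normalization they are the columns \<open>(f, n, -m)\<close> of a unitary
matrix, and the phase \<open>\<i>\<close> is the one for which \<open>(f, n, m)\<close> has determinant \<open>1\<close>. In this frame,
membership of \<open>\<partial>\<psi>/\<partial>z\<close> in the bundle of \<open>g1\<close> reduces to a single condition on the second
fundamental form, the vanishing of the component of \<open>C\<close> at \<open>z\<close> and twice its conjugate, and this is
its trace (\<open>dN_component\<close>, \<open>flag_derivative_in_g1_bundle\<close>). The cone over \<open>\<i> f\<close> is special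
Lagrangian, because multiplication by \<open>\<i>\<close> multiplies the determinant by \<open>\<i>\<^sup>3 = -\<i>\<close>.

Translation by a period of \<open>\<phi>\<close> permutes the three lifts, which gives a character of the lattice with
values in the cube roots of unity. The flag lift is periodic for its kernel, and by the isomorphism
theorem the covering group is isomorphic to the image of the character, hence to \<open>1\<close> or \<open>\<int>\<^sub>3\<close>
(\<open>covering_group_ker\<close>). Finally, two horizontal lifts differ by a function with values in the unit
circle whose derivative vanishes (\<open>horizontal_lift_unique\<close>).
\<close>

section \<open>Calculus of smooth maps\<close>

lemma dirderiv_eqI:
  assumes "(F has_derivative F') (at p)"
  shows "dirderiv F p v = F' v"
  using frechet_derivative_at[OF assms] by simp

lemma has_derivative_dirderiv:
  assumes "F differentiable (at p)"
  shows "(F has_derivative dirderiv F p) (at p)"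
  using assms frechet_derivative_works by blast

lemma Ck_on_continuous: "Ck_on k U F \<Longrightarrow> continuous_on U F"
  by (cases k) (auto intro!: continuous_at_imp_continuous_on differentiable_imp_continuous_within)

lemma Ck_on_SucD: "Ck_on (Suc k) U F \<Longrightarrow> Ck_on k U F"
proof (induction k arbitrary: F)
  case 0
  then show ?case
    by (auto intro!: continuous_at_imp_continuous_on differentiable_imp_continuous_within)
qed auto

lemma Ck_on_cong:
  assumes "open U" "\<And>p. p \<in> U \<Longrightarrow> F p = G p"
  shows "Ck_on k U F \<longleftrightarrow> Ck_on k U G"
  using assms(2)
proof (induction k arbitrary: F G)
  case 0
  then show ?case by (simp cong: continuous_on_cong)
next
  case (Suc k)
  have diff: "F differentiable (at p) \<longleftrightarrow> G differentiable (at p)" if "p \<in> U" for p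
    using Suc.prems assms(1) that
    by (metis differentiable_def has_derivative_transform_within_open)
  show ?case
  proof (cases "\<forall>p\<in>U. F differentiable (at p)")
    case True
    have "dirderiv F p v = dirderiv G p v" if "p \<in> U" for p v
      using frechet_derivative_transform_within_open[of F p U G] True that assms(1) Suc.prems
      by auto
    then have "Ck_on k U (\<lambda>p. dirderiv F p v) \<longleftrightarrow> Ck_on k U (\<lambda>p. dirderiv G p v)" for v
      by (intro Suc.IH) auto
    then show ?thesis using diff by auto
  qed (use diff in auto)
qed

text \<open>It suffices to know the derivatives at the points of \<open>U\<close>, whatever \<open>frechet_derivative\<close>
  returns elsewhere.\<close>

lemma Ck_on_SucI:
  assumes "open U"
    and "\<And>p. p \<in> U \<Longrightarrow> (F has_derivative F' p) (at p)"
    and "\<And>v. Ck_on k U (\<lambda>p. F' p v)"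
  shows "Ck_on (Suc k) U F"
proof -
  have "Ck_on k U (\<lambda>p. dirderiv F p v)" for v
    using assms(3)[of v] Ck_on_cong[OF assms(1), of "\<lambda>p. dirderiv F p v" "\<lambda>p. F' p v"]
      dirderiv_eqI[OF assms(2)] by auto
  then show ?thesis using assms(2) by (auto simp: differentiable_def)
qed

lemma Ck_on_has_derivative:
  assumes "Ck_on (Suc k) U F" "p \<in> U"
  shows "(F has_derivative dirderiv F p) (at p)"
  using assms by (auto intro: has_derivative_dirderiv)

lemma Ck_on_const: "open U \<Longrightarrow> Ck_on k U (\<lambda>p. c)"
proof (induction k arbitrary: c)
  case (Suc k)
  then show ?case by (intro Ck_on_SucI[where F' = "\<lambda>p v. 0"]) auto
qed auto

lemma Ck_on_add:
  assumes "open U" "Ck_on k U F" "Ck_on k U G"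
  shows "Ck_on k U (\<lambda>p. F p + G p)"
  using assms(2,3)
proof (induction k arbitrary: F G)
  case (Suc k)
  show ?case
    by (rule Ck_on_SucI[OF assms(1)], rule has_derivative_add)
      (use Suc in \<open>auto intro: has_derivative_dirderiv\<close>)
qed (auto intro: continuous_intros)

lemma Ck_on_bounded_linear:
  assumes "open U" "bounded_linear L" "Ck_on k U F"
  shows "Ck_on k U (\<lambda>p. L (F p))"
  using assms(3)
proof (induction k arbitrary: F)
  case 0
  then show ?case using bounded_linear.continuous_on[OF assms(2)] by auto
next
  case (Suc k)
  show ?case
    by (rule Ck_on_SucI[OF assms(1)], rule bounded_linear.has_derivative[OF assms(2)])
      (use Suc in \<open>auto intro: has_derivative_dirderiv\<close>)
qed

lemma Ck_on_bounded_bilinear: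
  assumes "open U" "bounded_bilinear B" "Ck_on k U F" "Ck_on k U G"
  shows "Ck_on k U (\<lambda>p. B (F p) (G p))"
  using assms(3,4)
proof (induction k arbitrary: F G)
  case 0
  then show ?case using bounded_bilinear.continuous_on[OF assms(2)] by auto
next
  case (Suc k)
  show ?case
  proof (rule Ck_on_SucI[OF assms(1)], rule bounded_bilinear.FDERIV[OF assms(2)])
    fix v
    show "Ck_on k U (\<lambda>p. B (F p) (dirderiv G p v) + B (dirderiv F p v) (G p))"
      by (intro Ck_on_add[OF assms(1)] Suc.IH Ck_on_SucD[OF Suc.prems(1)] Ck_on_SucD[OF Suc.prems(2)])
        (use Suc.prems in auto)
  qed (use Suc.prems in \<open>auto intro: has_derivative_dirderiv\<close>)
qed

lemma Ck_on_compose_linear: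
  assumes "open U" "bounded_linear L" "L ` U \<subseteq> V" "Ck_on k V F"
  shows "Ck_on k U (\<lambda>q. F (L q))"
  using assms(4)
proof (induction k arbitrary: F)
  case 0
  have "continuous_on U L" using assms(2) linear_continuous_on by auto
  then show ?case using 0 assms(3) by (auto intro: continuous_on_compose2)
next
  case (Suc k)
  show ?case
  proof (rule Ck_on_SucI[OF assms(1)])
    fix q assume "q \<in> U"
    then have "F differentiable (at (L q))" using Suc.prems assms(3) by auto
    then show "((\<lambda>q. F (L q)) has_derivative (\<lambda>v. dirderiv F (L q) (L v))) (at q)"
      by (intro has_derivative_compose[OF bounded_linear_imp_has_derivative[OF assms(2)]]
          has_derivative_dirderiv)
  next
    fix v
    show "Ck_on k U (\<lambda>q. dirderiv F (L q) (L v))"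
      by (rule Suc.IH[of "\<lambda>p. dirderiv F p (L v)"]) (use Suc.prems in auto)
  qed
qed

text \<open>The derivative of \<open>g\<^sup>a\<close> contains \<open>g\<^sup>a\<^sup>-\<^sup>1\<close>, so the induction is on all exponents at
  once. The exponents needed below are those of the inverse square root.\<close>

lemma Ck_on_powr:
  fixes g :: "'a::real_normed_vector \<Rightarrow> real"
  assumes "open U" "\<And>p. p \<in> U \<Longrightarrow> g p > 0" "Ck_on k U g"
  shows "Ck_on k U (\<lambda>p. g p powr a)"
  using assms(3)
proof (induction k arbitrary: a)
  case 0
  then show ?case using assms(2) by (force intro!: continuous_intros)
next
  case (Suc k)
  have g: "(g has_derivative dirderiv g p) (at p)" if "p \<in> U" for p
    using Suc.prems that by (auto intro: has_derivative_dirderiv)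
  show ?case
  proof (rule Ck_on_SucI[OF assms(1)])
    fix p assume "p \<in> U"
    then show "((\<lambda>p. g p powr a) has_derivative
        (\<lambda>v. dirderiv g p v * (a * g p powr (a - 1)))) (at p)"
      using assms(2)[of p]
      by (intro has_derivative_eq_rhs[OF has_derivative_powr[OF g has_derivative_const]])
        (auto simp: fun_eq_iff powr_diff field_simps)
  next
    fix v
    have "Ck_on k U (\<lambda>p. a * g p powr (a - 1))"
      using Suc.IH[of "a - 1"] Ck_on_SucD[OF Suc.prems]
      by (intro Ck_on_bounded_linear[OF assms(1) bounded_linear_mult_right]) auto
    moreover have "Ck_on k U (\<lambda>p. dirderiv g p v)"
      using Suc.prems by auto
    ultimately show "Ck_on k U (\<lambda>p. dirderiv g p v * (a * g p powr (a - 1)))"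
      by (intro Ck_on_bounded_bilinear[OF assms(1) bounded_bilinear_mult,
            of k "\<lambda>p. dirderiv g p v" "\<lambda>p. a * g p powr (a - 1)"])
  qed
qed

lemma smooth_on_const: "open U \<Longrightarrow> smooth_on U (\<lambda>p. c)"
  by (simp add: smooth_on_def Ck_on_const)

lemma smooth_on_ident: "open U \<Longrightarrow> smooth_on U (\<lambda>q. q)"
  unfolding smooth_on_def
proof
  fix k assume "open U"
  then show "Ck_on k U (\<lambda>q. q)"
    by (cases k) (auto intro!: continuous_intros Ck_on_const)
qed

lemma smooth_on_add: "open U \<Longrightarrow> smooth_on U F \<Longrightarrow> smooth_on U G \<Longrightarrow> smooth_on U (\<lambda>p. F p + G p)"
  by (simp add: smooth_on_def Ck_on_add)

lemma smooth_on_bounded_linear: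
  "open U \<Longrightarrow> bounded_linear L \<Longrightarrow> smooth_on U F \<Longrightarrow> smooth_on U (\<lambda>p. L (F p))"
  by (simp add: smooth_on_def Ck_on_bounded_linear)

lemma smooth_on_bounded_bilinear:
  "open U \<Longrightarrow> bounded_bilinear B \<Longrightarrow> smooth_on U F \<Longrightarrow> smooth_on U G \<Longrightarrow>
    smooth_on U (\<lambda>p. B (F p) (G p))"
  by (simp add: smooth_on_def Ck_on_bounded_bilinear)

lemma smooth_on_compose_linear:
  "open U \<Longrightarrow> bounded_linear L \<Longrightarrow> L ` U \<subseteq> V \<Longrightarrow> smooth_on V F \<Longrightarrow> smooth_on U (\<lambda>q. F (L q))"
  by (auto simp: smooth_on_def intro: Ck_on_compose_linear)

lemma smooth_on_powr:
  fixes g :: "'a::real_normed_vector \<Rightarrow> real"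
  shows "open U \<Longrightarrow> (\<And>p. p \<in> U \<Longrightarrow> g p > 0) \<Longrightarrow> smooth_on U g \<Longrightarrow> smooth_on U (\<lambda>p. g p powr a)"
  by (simp add: smooth_on_def Ck_on_powr)

lemma smooth_on_diff:
  assumes "open U" "smooth_on U F" "smooth_on U G"
  shows "smooth_on U (\<lambda>p. F p - G p)"
  using smooth_on_add[OF assms(1,2)
      smooth_on_bounded_linear[OF assms(1) bounded_linear_minus[OF bounded_linear_ident] assms(3)]]
  by simp

lemma smooth_on_Pair:
  assumes "open U" "smooth_on U F" "smooth_on U G"
  shows "smooth_on U (\<lambda>p. (F p, G p))"
proof -
  have "bounded_linear (\<lambda>x. (x, 0::'c))" "bounded_linear (\<lambda>y. (0::'b, y))"
    by (auto intro: bounded_linear_Pair bounded_linear_ident bounded_linear_zero)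
  from smooth_on_add[OF assms(1) smooth_on_bounded_linear[OF assms(1) this(1) assms(2)]
      smooth_on_bounded_linear[OF assms(1) this(2) assms(3)]]
  show ?thesis by simp
qed

lemma smooth_on_dirderiv: "smooth_on U F \<Longrightarrow> smooth_on U (\<lambda>p. dirderiv F p v)"
  unfolding smooth_on_def using Ck_on.simps(2) by blast

lemma smooth_on_has_derivative:
  assumes "smooth_on U F" "p \<in> U"
  shows "(F has_derivative dirderiv F p) (at p)"
  using assms Ck_on_has_derivative unfolding smooth_on_def by blast

lemma smooth_on_continuous: "smooth_on U F \<Longrightarrow> continuous_on U F"
  unfolding smooth_on_def using Ck_on_continuous by blast

lemma smooth_on_linear_dirderiv:
  assumes "smooth_on U F" "p \<in> U"
  shows "linear (dirderiv F p)"
  using smooth_on_has_derivative[OF assms] has_derivative_linear by blast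

lemma has_derivative_along_line:
  assumes "(F has_derivative F') (at (p + t *\<^sub>R v))"
  shows "((\<lambda>t. F (p + t *\<^sub>R v)) has_vector_derivative F' v) (at t)"
proof -
  have "((\<lambda>t. p + t *\<^sub>R v) has_derivative (\<lambda>s. s *\<^sub>R v)) (at t)"
    by (auto intro!: derivative_eq_intros)
  from has_derivative_compose[OF this assms] show ?thesis
    using linear_cmul[OF has_derivative_linear[OF assms]]
    by (simp add: has_vector_derivative_def)
qed

text \<open>Both mixed derivatives are limits of the same second difference quotient; the mean value
  theorem, applied once in each direction, turns it into a value of the mixed derivative nearby.\<close>

lemma second_difference_mean_value:
  fixes F :: "'a::real_normed_vector \<Rightarrow> real"
  assumes "smooth_on UNIV F" "h > 0"
  shows "\<exists>s t. 0 < s \<and> s < h \<and> 0 < t \<and> t < h \<and>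
    F (p + h *\<^sub>R v + h *\<^sub>R w) - F (p + h *\<^sub>R v) - F (p + h *\<^sub>R w) + F p =
    h * h * dirderiv (\<lambda>q. dirderiv F q v) (p + s *\<^sub>R v + t *\<^sub>R w) w"
proof -
  have F: "(F has_derivative dirderiv F q) (at q)" for q
    using assms(1) smooth_on_has_derivative by blast
  have dF: "((\<lambda>q. dirderiv F q v) has_derivative dirderiv (\<lambda>q. dirderiv F q v) q) (at q)" for q
    using smooth_on_dirderiv[OF assms(1)] smooth_on_has_derivative by blast
  define g where "g = (\<lambda>t. F ((p + h *\<^sub>R w) + t *\<^sub>R v) - F (p + t *\<^sub>R v))"
  have "(g has_real_derivative
      dirderiv F ((p + h *\<^sub>R w) + t *\<^sub>R v) v - dirderiv F (p + t *\<^sub>R v) v) (at t)" for t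
    unfolding g_def has_real_derivative_iff_has_vector_derivative
    by (intro has_vector_derivative_diff has_derivative_along_line F)
  from MVT2[OF assms(2), of g, OF this] obtain s where s: "0 < s" "s < h"
    "g h - g 0 = h * (dirderiv F ((p + h *\<^sub>R w) + s *\<^sub>R v) v - dirderiv F (p + s *\<^sub>R v) v)"
    by auto
  define k where "k = (\<lambda>t. dirderiv F ((p + s *\<^sub>R v) + t *\<^sub>R w) v)"
  have "(k has_real_derivative
      dirderiv (\<lambda>q. dirderiv F q v) ((p + s *\<^sub>R v) + t *\<^sub>R w) w) (at t)" for t
    unfolding k_def has_real_derivative_iff_has_vector_derivative
    by (intro has_derivative_along_line[where F = "\<lambda>q. dirderiv F q v"] dF)
  from MVT2[OF assms(2), of k, OF this] obtain t where t: "0 < t" "t < h"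
    "k h - k 0 = h * dirderiv (\<lambda>q. dirderiv F q v) ((p + s *\<^sub>R v) + t *\<^sub>R w) w"
    by auto
  have "g h - g 0 = h * (k h - k 0)"
    using s(3) by (simp add: k_def ac_simps)
  then show ?thesis
    using s(1,2) t unfolding g_def by (intro exI[of _ s] exI[of _ t]) (auto simp: ac_simps)
qed

lemma second_dirderiv_commute_real:
  fixes F :: "'a::real_normed_vector \<Rightarrow> real"
  assumes "smooth_on UNIV F"
  shows "dirderiv (\<lambda>q. dirderiv F q v) p w = dirderiv (\<lambda>q. dirderiv F q w) p v"
proof (rule ccontr)
  define A where "A = (\<lambda>v w p. dirderiv (\<lambda>q. dirderiv F q v) p w)"
  assume "\<not> ?thesis"
  then have e: "\<bar>A v w p - A w v p\<bar> / 2 > 0" (is "?e > 0") by (simp add: A_def)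
  have cont: "continuous_on UNIV (A v w)" for v w
    unfolding A_def by (intro smooth_on_continuous smooth_on_dirderiv assms)
  have near: "\<exists>d>0. \<forall>s t. 0 < s \<and> s < d \<and> 0 < t \<and> t < d \<longrightarrow>
      \<bar>A v w (p + s *\<^sub>R v + t *\<^sub>R w) - A v w p\<bar> < ?e" for v w
  proof -
    obtain d where d: "d > 0" "\<And>q. dist q p < d \<Longrightarrow> dist (A v w q) (A v w p) < ?e"
      using cont[of v w] e unfolding continuous_on_iff by blast
    let ?k = "norm v + norm w + 1"
    have k: "?k > 0" by (smt (verit) norm_ge_zero)
    have "dist (p + s *\<^sub>R v + t *\<^sub>R w) p < d" if "0 < s" "s < d / ?k" "0 < t" "t < d / ?k" for s t
    proof -
      have "norm (s *\<^sub>R v + t *\<^sub>R w) \<le> s * norm v + t * norm w"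
        using that by (intro order_trans[OF norm_triangle_ineq]) auto
      also have "\<dots> \<le> (d / ?k) * norm v + (d / ?k) * norm w"
        using that by (intro add_mono mult_right_mono) auto
      also have "\<dots> < (d / ?k) * ?k"
        using d(1) k by (simp add: distrib_left)
      also have "\<dots> = d" using k by simp
      finally show ?thesis by (simp add: dist_norm algebra_simps)
    qed
    then show ?thesis
      using d k by (intro exI[of _ "d / ?k"]) (auto simp: dist_real_def)
  qed
  obtain d1 where d1: "d1 > 0" "\<And>s t. 0 < s \<and> s < d1 \<and> 0 < t \<and> t < d1 \<Longrightarrow>
      \<bar>A v w (p + s *\<^sub>R v + t *\<^sub>R w) - A v w p\<bar> < ?e" using near by blast
  obtain d2 where d2: "d2 > 0" "\<And>s t. 0 < s \<and> s < d2 \<and> 0 < t \<and> t < d2 \<Longrightarrow>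
      \<bar>A w v (p + s *\<^sub>R w + t *\<^sub>R v) - A w v p\<bar> < ?e" using near by blast
  define h where "h = min d1 d2"
  have h: "h > 0" using d1 d2 by (simp add: h_def)
  obtain s t where st: "0 < s" "s < h" "0 < t" "t < h"
    "F (p + h *\<^sub>R v + h *\<^sub>R w) - F (p + h *\<^sub>R v) - F (p + h *\<^sub>R w) + F p =
      h * h * A v w (p + s *\<^sub>R v + t *\<^sub>R w)"
    using second_difference_mean_value[OF assms h, of p v w] unfolding A_def by blast
  obtain s' t' where st': "0 < s'" "s' < h" "0 < t'" "t' < h"
    "F (p + h *\<^sub>R w + h *\<^sub>R v) - F (p + h *\<^sub>R w) - F (p + h *\<^sub>R v) + F p =
      h * h * A w v (p + s' *\<^sub>R w + t' *\<^sub>R v)"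
    using second_difference_mean_value[OF assms h, of p w v] unfolding A_def by blast
  have "A v w (p + s *\<^sub>R v + t *\<^sub>R w) = A w v (p + s' *\<^sub>R w + t' *\<^sub>R v)"
  proof -
    have "h * h * A v w (p + s *\<^sub>R v + t *\<^sub>R w) = h * h * A w v (p + s' *\<^sub>R w + t' *\<^sub>R v)"
      using st(5) st'(5) by (simp add: algebra_simps)
    then show ?thesis using h by simp
  qed
  moreover have "\<bar>A v w (p + s *\<^sub>R v + t *\<^sub>R w) - A v w p\<bar> < ?e"
    using st by (intro d1) (auto simp: h_def)
  moreover have "\<bar>A w v (p + s' *\<^sub>R w + t' *\<^sub>R v) - A w v p\<bar> < ?e"
    using st' by (intro d2) (auto simp: h_def)
  ultimately show False
    using abs_triangle_ineq[of "A v w (p + s *\<^sub>R v + t *\<^sub>R w) - A v w p"] e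
    by (smt (verit, best) field_sum_of_halves)
qed

lemma second_dirderiv_commute:
  fixes F :: "'a::real_normed_vector \<Rightarrow> 'b::euclidean_space"
  assumes "smooth_on UNIV F"
  shows "dirderiv (\<lambda>q. dirderiv F q v) p w = dirderiv (\<lambda>q. dirderiv F q w) p v"
proof (rule euclidean_eqI)
  fix b :: 'b
  let ?F = "\<lambda>q. F q \<bullet> b"
  have smooth: "smooth_on UNIV ?F"
    by (rule smooth_on_bounded_linear[OF open_UNIV bounded_linear_inner_left assms])
  have first: "dirderiv ?F q v = dirderiv F q v \<bullet> b" for q v
    by (rule dirderiv_eqI)
      (rule bounded_linear.has_derivative[OF bounded_linear_inner_left
          smooth_on_has_derivative[OF assms UNIV_I]])
  have second: "dirderiv (\<lambda>q. dirderiv F q v \<bullet> b) p w = dirderiv (\<lambda>q. dirderiv F q v) p w \<bullet> b" for v w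
    by (rule dirderiv_eqI)
      (rule bounded_linear.has_derivative[OF bounded_linear_inner_left
          smooth_on_has_derivative[OF smooth_on_dirderiv[OF assms] UNIV_I]])
  show "dirderiv (\<lambda>q. dirderiv F q v) p w \<bullet> b = dirderiv (\<lambda>q. dirderiv F q w) p v \<bullet> b"
    using second_dirderiv_commute_real[OF smooth, of v p w] by (simp add: first second)
qed

section \<open>Hermitian linear algebra in three complex dimensions\<close>

lemma hprod_3: "hprod u v = u$1 * cnj (v$1) + u$2 * cnj (v$2) + u$3 * cnj (v$3)"
  by (simp add: hprod_def sum_3)

lemma hprod_add_left: "hprod (u + v) w = hprod u w + hprod v w"
  and hprod_add_right: "hprod w (u + v) = hprod w u + hprod w v"
  and hprod_diff_left: "hprod (u - v) w = hprod u w - hprod v w"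
  and hprod_diff_right: "hprod w (u - v) = hprod w u - hprod w v"
  and hprod_minus_left: "hprod (- u) w = - hprod u w"
  and hprod_minus_right: "hprod w (- u) = - hprod w u"
  and hprod_scale_left: "hprod (c *s u) w = c * hprod u w"
  and hprod_scale_right: "hprod w (c *s u) = cnj c * hprod w u"
  and hprod_scaleR_left: "hprod (r *\<^sub>R u) w = of_real r * hprod u w"
  and hprod_scaleR_right: "hprod w (r *\<^sub>R u) = of_real r * hprod w u"
  and hprod_zero_left: "hprod 0 w = 0"
  and hprod_zero_right: "hprod w 0 = 0"
  unfolding hprod_3 by (simp_all add: algebra_simps scaleR_conv_of_real[where 'a = complex])

lemmas hprod_simps = hprod_add_left hprod_add_right hprod_diff_left hprod_diff_right
  hprod_minus_left hprod_minus_right hprod_scale_left hprod_scale_right hprod_scaleR_left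
  hprod_scaleR_right hprod_zero_left hprod_zero_right

lemma cnj_hprod: "cnj (hprod u v) = hprod v u"
  by (simp add: hprod_3 mult.commute)

lemma Re_hprod: "Re (hprod u v) = u \<bullet> v"
  by (simp add: hprod_3 inner_vec_def sum_3 inner_complex_def)

lemma hprod_self: "hprod u u = of_real ((norm u)\<^sup>2)"
proof -
  have "Im (hprod u u) = 0" using cnj_hprod[of u u] by (metis cnj.simps(2) equal_neg_zero)
  then show ?thesis by (simp add: complex_eq_iff Re_hprod dot_square_norm)
qed

lemma hprod_self_eq_0_iff: "hprod u u = 0 \<longleftrightarrow> u = 0"
  by (simp add: hprod_self)

lemma Im_hprod_swap: "Im (hprod u v) = - Im (hprod v u)"
  by (metis cnj.simps(2) cnj_hprod)

lemma Re_hprod_swap: "Re (hprod u v) = Re (hprod v u)"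
  by (metis cnj.simps(1) cnj_hprod)

lemma hprod_eq_0_swap: "hprod u v = 0 \<longleftrightarrow> hprod v u = 0"
  by (metis cnj_hprod complex_cnj_zero_iff)

lemma scaleR_eq_scale: "r *\<^sub>R (u::complex^'n) = of_real r *s u"
  by (simp add: vec_eq_iff scaleR_conv_of_real[where 'a = complex])

lemma norm_scale: "norm (c *s u) = cmod c * norm (u::complex^3)"
proof -
  have "of_real ((norm (c *s u))\<^sup>2) = complex_of_real ((cmod c * norm u)\<^sup>2)"
    unfolding hprod_self[symmetric] hprod_simps
    using complex_norm_square[of c]
    by (simp add: hprod_self power_mult_distrib mult.assoc[symmetric] mult.commute)
  then have "(norm (c *s u))\<^sup>2 = (cmod c * norm u)\<^sup>2" by (simp only: of_real_eq_iff)
  then show ?thesis by (simp add: power2_eq_iff_nonneg)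
qed

subsection \<open>Matrices of rank one\<close>

text \<open>The matrix \<open>u v\<^sup>*\<close>.\<close>

definition outer :: "complex^3 \<Rightarrow> complex^3 \<Rightarrow> complex^3^3" where
  "outer u v = (\<chi> i j. u$i * cnj (v$j))"

lemma outer_mult_vec: "outer u v *v w = hprod w v *s u"
  by (simp add: outer_def matrix_vector_mult_def hprod_3 vec_eq_iff sum_3 algebra_simps)

lemma ctranspose_outer: "ctranspose (outer u v) = outer v u"
  by (simp add: outer_def ctranspose_def vec_eq_iff)

lemma ctranspose_mult: "ctranspose (A ** B) = ctranspose B ** ctranspose A"
  by (simp add: ctranspose_def matrix_matrix_mult_def vec_eq_iff mult.commute)

lemma hprod_mult_vec_left: "hprod (A *v x) y = hprod x (ctranspose A *v y)"
  by (simp add: hprod_3 matrix_vector_mult_def ctranspose_def sum_3 algebra_simps)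

lemma inner_outer: "outer a b \<bullet> B = Re (hprod a (B *v b))"
  by (simp add: inner_vec_def sum_3 outer_def hprod_3 matrix_vector_mult_def inner_complex_def algebra_simps)

lemma matrix_eqI: "(\<And>x. A *v x = B *v x) \<Longrightarrow> A = (B::complex^3^3)"
  by (simp add: matrix_eq)

lemma matrix_mult_outer: "A ** outer u v = outer (A *v u) v"
  by (rule matrix_eqI) (simp add: outer_mult_vec matrix_vector_mul_assoc[symmetric] vector_scalar_commute)

lemma outer_matrix_mult: "outer u v ** A = outer u (ctranspose A *v v)"
  by (rule matrix_eqI)
    (simp add: outer_mult_vec matrix_vector_mul_assoc[symmetric] hprod_mult_vec_left)

lemma mat_scale: "mat c *v x = c *s (x::complex^3)"
  by (simp add: vec_eq_iff matrix_vector_mult_def mat_def forall_3 sum_3)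

lemma bounded_bilinear_hprod: "bounded_bilinear hprod"
proof -
  have "bilinear hprod"
    by (auto simp: bilinear_def intro!: linearI simp: hprod_simps scaleR_conv_of_real[where 'a = complex])
  then show ?thesis by (simp add: bilinear_conv_bounded_bilinear)
qed

lemma bounded_bilinear_outer: "bounded_bilinear outer"
proof -
  have "bilinear outer"
    by (auto simp: bilinear_def outer_def vec_eq_iff algebra_simps intro!: linearI)
  then show ?thesis by (simp add: bilinear_conv_bounded_bilinear)
qed

lemma bounded_bilinear_cmatrix_vec: "bounded_bilinear (\<lambda>(A::complex^3^3) x. A *v x)"
proof -
  have "bilinear (\<lambda>(A::complex^3^3) x. A *v x)"
    by (auto simp: bilinear_def matrix_vector_mult_def vec_eq_iff sum_3 algebra_simps intro!: linearI)
  then show ?thesis by (simp add: bilinear_conv_bounded_bilinear)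
qed

lemma bounded_bilinear_cmatrix_mult: "bounded_bilinear (\<lambda>(A::complex^3^3) (B::complex^3^3). A ** B)"
proof -
  have "bilinear (\<lambda>(A::complex^3^3) (B::complex^3^3). A ** B)"
    by (auto simp: bilinear_def matrix_matrix_mult_def vec_eq_iff sum_3 algebra_simps intro!: linearI)
  then show ?thesis by (simp add: bilinear_conv_bounded_bilinear)
qed

lemma bounded_linear_ctranspose: "bounded_linear ctranspose"
  by (auto simp: linear_conv_bounded_linear[symmetric] ctranspose_def vec_eq_iff intro!: linearI)

lemma bounded_bilinear_scale: "bounded_bilinear (\<lambda>c (x::complex^3). c *s x)"
proof -
  have "bilinear (\<lambda>c (x::complex^3). c *s x)"
    by (auto simp: bilinear_def vec_eq_iff algebra_simps intro!: linearI)
  then show ?thesis by (simp add: bilinear_conv_bounded_bilinear)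
qed

text \<open>The tangent vectors of the manifold of projectors of rank one: differentiating
  \<open>N\<^sup>2 = N\<close> gives the third assumption.\<close>

lemma rank_one_projector_variation:
  assumes m: "hprod m m = 1" and K: "ctranspose K = K"
    and NK: "K = outer m m ** K + K ** outer m m"
  shows "hprod (K *v m) m = 0" "K = outer (K *v m) m + outer m (K *v m)"
proof -
  show K_eq: "K = outer (K *v m) m + outer m (K *v m)"
    using NK by (simp add: matrix_mult_outer outer_matrix_mult K add.commute)
  have "hprod (K *v m) m = hprod (hprod m m *s (K *v m) + hprod m (K *v m) *s m) m"
    by (subst K_eq) (simp add: matrix_vector_mult_add_rdistrib outer_mult_vec)
  also have "\<dots> = hprod (K *v m) m + hprod m (K *v m)"
    by (simp add: hprod_simps m)
  finally have "hprod m (K *v m) = 0" by simp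
  then show "hprod (K *v m) m = 0" using hprod_eq_0_swap by blast
qed

subsection \<open>Unitary frames\<close>

definition columns3 :: "complex^3 \<Rightarrow> complex^3 \<Rightarrow> complex^3 \<Rightarrow> complex^3^3" where
  "columns3 u v w = (\<chi> i j. if j = 1 then u$i else if j = 2 then v$i else w$i)"

lemma columns3_mult_vec: "columns3 u v w *v x = x$1 *s u + x$2 *s v + x$3 *s w"
  by (simp add: columns3_def matrix_vector_mult_def vec_eq_iff sum_3 algebra_simps)

lemma det_columns3:
  "det (columns3 u v w) = u$1 * (v$2 * w$3 - v$3 * w$2) + u$2 * (v$3 * w$1 - v$1 * w$3)
     + u$3 * (v$1 * w$2 - v$2 * w$1)"
  by (simp add: columns3_def det_3 algebra_simps)

lemma det_columns3_scale:
  "det (columns3 (a *s u) (b *s v) (c *s w)) = a * b * c * det (columns3 u v w)"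
  by (simp add: det_columns3 algebra_simps)

lemma gram_columns3:
  "ctranspose (columns3 u v w) ** columns3 u v w =
    vector [vector [hprod u u, hprod v u, hprod w u],
            vector [hprod u v, hprod v v, hprod w v],
            vector [hprod u w, hprod v w, hprod w w]]"
  by (simp add: vec_eq_iff forall_3 matrix_matrix_mult_def ctranspose_def columns3_def hprod_3 sum_3
      vector_3 mult.commute)

lemma det_ctranspose: "det (ctranspose A) = cnj (det A)"
  by (simp add: det_3 ctranspose_def algebra_simps)

text \<open>The Gram determinant, with the unit vector \<open>u\<close> split off.\<close>

lemma norm_det_columns3:
  assumes "hprod u u = 1" "hprod v u = 0" "hprod w u = 0"
  shows "of_real ((cmod (det (columns3 u v w)))\<^sup>2) = hprod v v * hprod w w - hprod v w * hprod w v"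
proof -
  have "hprod u v = 0" "hprod u w = 0" using assms hprod_eq_0_swap by auto
  then have "det (ctranspose (columns3 u v w) ** columns3 u v w)
      = hprod v v * hprod w w - hprod v w * hprod w v"
    unfolding gram_columns3 using assms by (simp add: det_3 vector_3 algebra_simps)
  moreover have "det (ctranspose (columns3 u v w) ** columns3 u v w) = of_real ((cmod (det (columns3 u v w)))\<^sup>2)"
    unfolding det_mul det_ctranspose using complex_norm_square by (simp add: mult.commute)
  ultimately show ?thesis by simp
qed

definition unitary_frame :: "complex^3 \<Rightarrow> complex^3 \<Rightarrow> complex^3 \<Rightarrow> bool" where
  "unitary_frame u v w \<longleftrightarrow> hprod u u = 1 \<and> hprod v v = 1 \<and> hprod w w = 1 \<and>
     hprod u v = 0 \<and> hprod u w = 0 \<and> hprod v w = 0"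

lemma unitary_frame_swapped:
  assumes "unitary_frame u v w"
  shows "hprod v u = 0" "hprod w u = 0" "hprod w v = 0"
  using assms hprod_eq_0_swap unfolding unitary_frame_def by auto

lemma unitary_frame_unitary:
  assumes "unitary_frame u v w"
  shows "ctranspose (columns3 u v w) ** columns3 u v w = mat 1"
  using assms unitary_frame_swapped[OF assms] unfolding gram_columns3 unitary_frame_def
  by (simp add: vec_eq_iff forall_3 mat_def vector_3)

lemma unitary_frame_expansion:
  assumes "unitary_frame u v w"
  shows "x = hprod x u *s u + hprod x v *s v + hprod x w *s w"
proof -
  have "columns3 u v w ** ctranspose (columns3 u v w) = mat 1"
    using unitary_frame_unitary[OF assms] matrix_left_right_inverse by blast
  then have "x = columns3 u v w *v (ctranspose (columns3 u v w) *v x)"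
    by (simp add: matrix_vector_mul_assoc)
  also have "ctranspose (columns3 u v w) *v x = vector [hprod x u, hprod x v, hprod x w]"
    by (simp add: vec_eq_iff forall_3 matrix_vector_mult_def ctranspose_def columns3_def hprod_3 sum_3
        vector_3 mult.commute)
  finally show ?thesis by (simp add: columns3_mult_vec vector_3)
qed

lemma unitary_frame_identity:
  assumes "unitary_frame u v w"
  shows "outer u u + outer v v + outer w w = mat 1"
  by (rule matrix_eqI)
    (use unitary_frame_expansion[OF assms] in \<open>simp add: matrix_vector_mult_add_rdistrib outer_mult_vec\<close>)

text \<open>Only the component along the replaced column survives. Together with the product rule, this
  expresses the logarithmic derivative of a determinant by the diagonal components.\<close>

lemma det_columns3_replace:
  assumes "unitary_frame u v w"
  shows "det (columns3 x v w) = hprod x u * det (columns3 u v w)"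
    and "det (columns3 u x w) = hprod x v * det (columns3 u v w)"
    and "det (columns3 u v x) = hprod x w * det (columns3 u v w)"
proof -
  define a b c where "a = hprod x u" "b = hprod x v" "c = hprod x w"
  have x: "x = a *s u + b *s v + c *s w"
    using unitary_frame_expansion[OF assms, of x] by (simp add: a_b_c_def)
  show "det (columns3 x v w) = hprod x u * det (columns3 u v w)"
    "det (columns3 u x w) = hprod x v * det (columns3 u v w)"
    "det (columns3 u v x) = hprod x w * det (columns3 u v w)"
    unfolding a_b_c_def[symmetric]
    by (subst x, simp add: det_columns3 algebra_simps)+
qed

lemma has_derivative_det_columns3:
  assumes "(a has_derivative a') (at p)" "(b has_derivative b') (at p)" "(c has_derivative c') (at p)"
  shows "((\<lambda>q. det (columns3 (a q) (b q) (c q))) has_derivative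
    (\<lambda>x. det (columns3 (a' x) (b p) (c p)) + det (columns3 (a p) (b' x) (c p))
       + det (columns3 (a p) (b p) (c' x)))) (at p)"
proof -
  note comp = bounded_linear.has_derivative[OF bounded_linear_vec_nth]
  show ?thesis
    unfolding det_columns3
    by (rule has_derivative_eq_rhs,
        (rule has_derivative_add has_derivative_diff has_derivative_mult comp[OF assms(1)]
          comp[OF assms(2)] comp[OF assms(3)])+) (auto simp: fun_eq_iff algebra_simps)
qed

lemma det_columns3_orthogonal_replace:
  assumes "hprod u u = 1" "hprod a u = 0" "hprod b u = 0" "hprod a b = 0"
    and "hprod a a = of_real (\<rho>\<^sup>2)" "hprod b b = of_real (\<rho>\<^sup>2)" "\<rho> > 0"
  shows "det (columns3 x a b) = hprod x u * det (columns3 u a b)"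
    and "det (columns3 u x b) = hprod x a / of_real (\<rho>\<^sup>2) * det (columns3 u a b)"
    and "det (columns3 u a x) = hprod x b / of_real (\<rho>\<^sup>2) * det (columns3 u a b)"
proof -
  define a' b' where "a' = complex_of_real (1 / \<rho>) *s a" "b' = complex_of_real (1 / \<rho>) *s b"
  have ab: "a = complex_of_real \<rho> *s a'" "b = complex_of_real \<rho> *s b'"
    using assms(7) by (simp_all add: a'_b'_def)
  have "hprod u a = 0" "hprod u b = 0" using assms hprod_eq_0_swap by auto
  then have frame: "unitary_frame u a' b'"
    using assms by (simp add: unitary_frame_def a'_b'_def hprod_simps power2_eq_square)
  have "hprod x a' = hprod x a / complex_of_real \<rho>" "hprod x b' = hprod x b / complex_of_real \<rho>"
    by (simp_all add: a'_b'_def hprod_simps)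
  note [simp] = this
  have scale: "det (columns3 y (complex_of_real \<rho> *s a') (complex_of_real \<rho> *s b'))
        = complex_of_real \<rho> * complex_of_real \<rho> * det (columns3 y a' b')"
      "det (columns3 u y (complex_of_real \<rho> *s b')) = complex_of_real \<rho> * det (columns3 u y b')"
      "det (columns3 u (complex_of_real \<rho> *s a') y) = complex_of_real \<rho> * det (columns3 u a' y)" for y
    using det_columns3_scale[of 1 y "of_real \<rho>" a' "of_real \<rho>" b']
      det_columns3_scale[of 1 u 1 y "of_real \<rho>" b'] det_columns3_scale[of 1 u "of_real \<rho>" a' 1 y]
    by simp_all
  show "det (columns3 x a b) = hprod x u * det (columns3 u a b)"
    unfolding ab scale by (simp add: det_columns3_replace(1)[OF frame, of x])
  have "det (columns3 u a b) = complex_of_real \<rho> * complex_of_real \<rho> * det (columns3 u a' b')"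
    using scale(1)[of u] ab by simp
  moreover have "det (columns3 u x b) = complex_of_real \<rho> * (hprod x a' * det (columns3 u a' b'))"
    using scale(2)[of x] ab(2) det_columns3_replace(2)[OF frame, of x] by simp
  moreover have "det (columns3 u a x) = complex_of_real \<rho> * (hprod x b' * det (columns3 u a' b'))"
    using scale(3)[of x] ab(1) det_columns3_replace(3)[OF frame, of x] by simp
  ultimately show "det (columns3 u x b) = hprod x a / of_real (\<rho>\<^sup>2) * det (columns3 u a b)"
    "det (columns3 u a x) = hprod x b / of_real (\<rho>\<^sup>2) * det (columns3 u a b)"
    using assms(7) by (simp_all add: power2_eq_square)
qed

subsection \<open>Orthogonal projectors\<close>

text \<open>The values of two candidates differ by a vector of \<open>W\<close> that is orthogonal to \<open>W\<close>.\<close>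

lemma orth_proj_eqI:
  assumes "\<And>v. Q *v v \<in> W" "\<And>v w. w \<in> W \<Longrightarrow> hprod (v - Q *v v) w = 0"
    and "vec.subspace W"
  shows "orth_proj W = Q"
  unfolding orth_proj_def
proof (rule the_equality)
  fix R assume R: "\<forall>v. R *v v \<in> W \<and> (\<forall>w\<in>W. hprod (v - R *v v) w = 0)"
  show "R = Q"
  proof (rule matrix_eqI)
    fix x
    have W: "R *v x - Q *v x \<in> W" using assms R vec.subspace_diff by blast
    then have "hprod (x - R *v x) (R *v x - Q *v x) = 0" "hprod (x - Q *v x) (R *v x - Q *v x) = 0"
      using R assms by blast+
    then have "hprod ((x - Q *v x) - (x - R *v x)) (R *v x - Q *v x) = 0"
      unfolding hprod_diff_left[of "x - Q *v x"] by simp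
    then have "hprod (R *v x - Q *v x) (R *v x - Q *v x) = 0" by simp
    then show "R *v x = Q *v x" by (simp add: hprod_self_eq_0_iff)
  qed
qed (use assms in blast)

lemma in_span_singleton: "x \<in> vec.span {u} \<longleftrightarrow> (\<exists>c. x = c *s (u::complex^3))"
  by (auto simp: vec.span_singleton)

lemma orth_proj_line:
  assumes "norm u = 1"
  shows "orth_proj (vec.span {u}) = outer u u"
  by (rule orth_proj_eqI)
    (use assms in \<open>auto simp: in_span_singleton outer_mult_vec hprod_simps hprod_self\<close>)

lemma orth_proj_hyperplane:
  assumes "norm m = 1"
  shows "orth_proj {x. hprod x m = 0} = mat 1 - outer m m"
proof (rule orth_proj_eqI)
  show "vec.subspace {x. hprod x m = 0}" by (auto simp: vec.subspace_def hprod_simps)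
next
  fix v w assume "w \<in> {x. hprod x m = 0}"
  then show "hprod (v - (mat 1 - outer m m) *v v) w = 0"
    using hprod_eq_0_swap
    by (auto simp: matrix_vector_mult_diff_rdistrib outer_mult_vec hprod_simps)
qed (use assms in \<open>auto simp: matrix_vector_mult_diff_rdistrib outer_mult_vec hprod_simps hprod_self\<close>)

lemma Grassmannian_1_unit_vector:
  assumes "W \<in> Grassmannian 1"
  obtains u where "norm u = 1" "W = vec.span {u}"
proof -
  have W: "vec.subspace W" "vec.dim W = 1" using assms by (auto simp: Grassmannian_def)
  obtain B where B: "B \<subseteq> W" "vec.independent B" "W \<subseteq> vec.span B" "card B = 1"
    using vec.basis_exists[of W] W(2) by metis
  then obtain w where w: "B = {w}" using card_1_singletonE by blast
  have w0: "w \<noteq> 0" using B(2) w vec.dependent_zero by blast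
  have "vec.span B = W" using B(1,3) W(1) vec.span_minimal by blast
  define u where "u = complex_of_real (inverse (norm w)) *s w"
  have "norm u = 1" using w0 by (simp add: u_def norm_scale norm_inverse)
  moreover have "vec.span {u} = vec.span {w}"
  proof -
    have "w = complex_of_real (norm w) *s u"
      using w0 by (simp add: u_def of_real_mult[symmetric])
    then show ?thesis
      by (intro vec.span_eq[THEN iffD2] conjI) (auto simp: in_span_singleton u_def)
  qed
  ultimately show ?thesis using that \<open>vec.span B = W\<close> w by blast
qed

lemma span_unit_in_Grassmannian_1:
  assumes "u \<noteq> 0"
  shows "vec.span {u} \<in> Grassmannian 1"
proof -
  have "vec.independent {u}" using assms by simp
  from vec.dim_span_eq_card_independent[OF this] show ?thesis
    by (simp add: Grassmannian_def)
qed

lemma hyperplane_eq_span_sum: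
  assumes "unitary_frame u n m" "c \<noteq> 0" "d \<noteq> 0"
  shows "{x. hprod x m = 0} = {a + b | a b. a \<in> vec.span {c *s u} \<and> b \<in> vec.span {d *s n}}"
proof (intro equalityI subsetI)
  fix x assume "x \<in> {x. hprod x m = 0}"
  then have "x = hprod x u *s u + hprod x n *s n"
    using unitary_frame_expansion[OF assms(1), of x] by simp
  also have "\<dots> = (hprod x u / c) *s (c *s u) + (hprod x n / d) *s (d *s n)"
    using assms(2,3) by simp
  finally show "x \<in> {a + b | a b. a \<in> vec.span {c *s u} \<and> b \<in> vec.span {d *s n}}"
    unfolding in_span_singleton mem_Collect_eq by blast
next
  fix x assume "x \<in> {a + b | a b. a \<in> vec.span {c *s u} \<and> b \<in> vec.span {d *s n}}"
  then show "x \<in> {x. hprod x m = 0}"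
    using assms(1) by (auto simp: in_span_singleton hprod_simps unitary_frame_def)
qed

lemma hyperplane_eq_span:
  assumes "unitary_frame u n m"
  shows "{x. hprod x m = 0} = vec.span {u, n}"
proof -
  have "{x. hprod x m = 0} = {a + b | a b. a \<in> vec.span {u} \<and> b \<in> vec.span {n}}"
    using hyperplane_eq_span_sum[OF assms, of 1 1] by simp
  also have "\<dots> = vec.span {u, n}"
    using vec.span_Un[of "{u}" "{n}"] by (auto simp: insert_commute)
  finally show ?thesis .
qed

lemma hyperplane_in_Grassmannian_2:
  assumes "unitary_frame u n m"
  shows "{x. hprod x m = 0} \<in> Grassmannian 2"
proof -
  have "vec.independent {u, n}"
  proof -
    have "u \<notin> vec.span {n}"
    proof
      assume "u \<in> vec.span {n}"
      then obtain c where c: "u = c *s n" by (auto simp: in_span_singleton)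
      have "hprod u u = cnj c * hprod u n" by (subst (2) c) (simp add: hprod_simps)
      then show False using assms by (auto simp: unitary_frame_def)
    qed
    moreover have "n \<noteq> 0" using assms by (auto simp: unitary_frame_def hprod_simps)
    ultimately show ?thesis by (simp add: vec.independent_insert)
  qed
  moreover have "u \<noteq> n" using assms by (auto simp: unitary_frame_def)
  ultimately have dim: "vec.dim (vec.span {u, n}) = 2"
    using vec.dim_span_eq_card_independent by fastforce
  then show ?thesis using hyperplane_eq_span[OF assms] by (simp add: Grassmannian_def)
qed

section \<open>The matrix exponential\<close>

lemma matrix_power_bound:
  obtains K C where "\<And>n. norm ((((**) A) ^^ n) (mat 1) :: complex^3^3) \<le> C * K ^ n"
proof -
  from bounded_bilinear.pos_bounded[OF bounded_bilinear_cmatrix_mult]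
  obtain K where K: "K > 0" "\<forall>(B::complex^3^3) (C::complex^3^3). norm (B ** C) \<le> norm B * norm C * K"
    by blast
  let ?M = "\<lambda>n. (((**) A) ^^ n) (mat 1) :: complex^3^3"
  have "norm (?M n) \<le> norm (mat 1 :: complex^3^3) * (norm A * K) ^ n" for n
  proof (induction n)
    case 0
    show ?case by (simp only: funpow_0 power_0 mult_1_right order_refl)
  next
    case (Suc n)
    have "norm (?M (Suc n)) \<le> norm A * norm (?M n) * K"
      using K(2) by (simp only: funpow.simps comp_apply)
    also have "\<dots> = (norm A * K) * norm (?M n)" by (simp only: ac_simps)
    also have "\<dots> \<le> (norm A * K) * (norm (mat 1 :: complex^3^3) * (norm A * K) ^ n)"
      by (rule mult_left_mono[OF Suc.IH]) (use K(1) in simp)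
    also have "\<dots> = norm (mat 1 :: complex^3^3) * (norm A * K) ^ Suc n"
      by (simp only: power_Suc ac_simps)
    finally show ?case .
  qed
  then show ?thesis by (rule that)
qed

lemma matrix_power_scaleR:
  "(((**) (t *\<^sub>R A)) ^^ n) (mat 1) = t ^ n *\<^sub>R ((((**) A) ^^ n) (mat 1) :: complex^3^3)"
proof (induction n)
  case (Suc n)
  interpret mult: bounded_bilinear "\<lambda>(A::complex^3^3) (B::complex^3^3). A ** B"
    by (rule bounded_bilinear_cmatrix_mult)
  have "(((**) (t *\<^sub>R A)) ^^ Suc n) (mat 1) = (t *\<^sub>R A) ** (t ^ n *\<^sub>R ((((**) A) ^^ n) (mat 1)))"
    unfolding Suc.IH[symmetric] by (simp only: funpow.simps comp_apply)
  also have "\<dots> = t ^ Suc n *\<^sub>R (A ** (((**) A) ^^ n) (mat 1))"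
    unfolding mult.scaleR_left mult.scaleR_right scaleR_scaleR power_Suc
    by (simp only: mult_ac)
  also have "A ** (((**) A) ^^ n) (mat 1) = (((**) A) ^^ Suc n) (mat 1)"
    by (simp only: funpow.simps comp_apply)
  finally show ?case .
qed (simp only: funpow_0 power_0 scaleR_one)

lemma summable_mat_exp:
  "summable (\<lambda>n. t ^ n *\<^sub>R ((((**) A) ^^ n) (mat 1) :: complex^3^3) /\<^sub>R fact n)"
proof -
  obtain K C where KC: "\<And>n. norm ((((**) A) ^^ n) (mat 1) :: complex^3^3) \<le> C * K ^ n"
    using matrix_power_bound[of A] by blast
  have bound: "norm (t ^ n *\<^sub>R ((((**) A) ^^ n) (mat 1) :: complex^3^3) /\<^sub>R fact n)
      \<le> C * (inverse (fact n) * (\<bar>t\<bar> * K) ^ n)" for n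
  proof -
    have "norm (t ^ n *\<^sub>R ((((**) A) ^^ n) (mat 1) :: complex^3^3) /\<^sub>R fact n)
        = (inverse (fact n) * \<bar>t\<bar> ^ n) * norm ((((**) A) ^^ n) (mat 1) :: complex^3^3)"
      by (simp add: power_abs abs_mult)
    also have "\<dots> \<le> (inverse (fact n) * \<bar>t\<bar> ^ n) * (C * K ^ n)"
      by (intro mult_left_mono KC) auto
    also have "\<dots> = C * (inverse (fact n) * (\<bar>t\<bar> * K) ^ n)"
      unfolding power_mult_distrib by (simp only: ac_simps)
    finally show ?thesis .
  qed
  have "summable (\<lambda>n. C * (inverse (fact n) * (\<bar>t\<bar> * K) ^ n))"
    by (intro summable_mult summable_exp)
  from summable_comparison_test'[OF this, of 0, OF bound] show ?thesis .
qed

lemma mat_exp_scaleR: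
  "mat_exp (t *\<^sub>R A) = (\<Sum>n. t ^ n *\<^sub>R ((((**) A) ^^ n) (mat 1)) /\<^sub>R fact n)"
  unfolding mat_exp_def matrix_power_scaleR ..

lemma mat_exp_0: "mat_exp 0 = mat 1"
proof -
  have "mat_exp (0 *\<^sub>R 0) = (\<Sum>n\<in>{0}. 0 ^ n *\<^sub>R ((((**) 0) ^^ n) (mat 1)) /\<^sub>R fact n)"
    unfolding mat_exp_scaleR by (rule suminf_finite) (auto simp del: funpow.simps)
  then show ?thesis by simp
qed

text \<open>Every real coordinate of the exponential is an everywhere convergent power series in the
  parameter, so it may be differentiated term by term.\<close>

lemma mat_exp_has_vector_derivative:
  "((\<lambda>t. mat_exp (t *\<^sub>R A)) has_vector_derivative A ** mat_exp (t *\<^sub>R A)) (at t)"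
proof -
  define M where "M = (\<lambda>n. (((**) A) ^^ n) (mat 1) :: complex^3^3)"
  have sums: "(\<lambda>n. t ^ n *\<^sub>R M n /\<^sub>R fact n) sums mat_exp (t *\<^sub>R A)" for t
    unfolding mat_exp_scaleR M_def by (rule summable_sums[OF summable_mat_exp])
  have "((\<lambda>t. mat_exp (t *\<^sub>R A) \<bullet> b) has_real_derivative (A ** mat_exp (t *\<^sub>R A)) \<bullet> b) (at t)" for b
  proof -
    let ?c = "\<lambda>n. (M n \<bullet> b) / fact n"
    have coord: "(\<lambda>n. ?c n * t ^ n) sums (mat_exp (t *\<^sub>R A) \<bullet> b)" for t
      using bounded_linear.sums[OF bounded_linear_inner_left sums[of t], of b]
      by (simp add: field_simps)
    have "((\<lambda>t. \<Sum>n. ?c n * t ^ n) has_real_derivative (\<Sum>n. diffs ?c n * t ^ n)) (at t)"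
      using coord by (intro termdiffs_strong_converges_everywhere) (auto simp: sums_iff)
    moreover have "(\<lambda>t. \<Sum>n. ?c n * t ^ n) = (\<lambda>t. mat_exp (t *\<^sub>R A) \<bullet> b)"
      using coord by (simp add: sums_iff)
    moreover have "(\<Sum>n. diffs ?c n * t ^ n) = (A ** mat_exp (t *\<^sub>R A)) \<bullet> b"
    proof -
      interpret mult: bounded_bilinear "\<lambda>(A::complex^3^3) (B::complex^3^3). A ** B"
        by (rule bounded_bilinear_cmatrix_mult)
      have "(\<lambda>n. (A ** (t ^ n *\<^sub>R M n /\<^sub>R fact n)) \<bullet> b) sums ((A ** mat_exp (t *\<^sub>R A)) \<bullet> b)"
        by (intro bounded_linear.sums[OF bounded_linear_inner_left]
            bounded_linear.sums[OF mult.bounded_linear_right] sums)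
      moreover have "(A ** (t ^ n *\<^sub>R M n /\<^sub>R fact n)) \<bullet> b = diffs ?c n * t ^ n" for n
      proof -
        have "A ** M n = M (Suc n)" by (simp add: M_def)
        moreover have "real (Suc n) / fact (Suc n) = inverse (fact n)"
          unfolding fact_Suc using of_nat_neq_0[of n, where 'a = real]
          by (simp add: divide_simps del: of_nat_Suc)
        moreover have "diffs ?c n = (M (Suc n) \<bullet> b) * (real (Suc n) / fact (Suc n))"
          unfolding diffs_def by (simp only: times_divide_eq_right mult.commute)
        ultimately have "diffs ?c n = (M (Suc n) \<bullet> b) * inverse (fact n)" by (simp only:)
        then show ?thesis
          using \<open>A ** M n = M (Suc n)\<close> by (simp add: mult.scaleR_right)
      qed
      ultimately show ?thesis by (simp add: sums_iff)
    qed
    ultimately show ?thesis by simp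
  qed
  then have "((\<lambda>t. mat_exp (t *\<^sub>R A) \<bullet> b) has_derivative
      (\<lambda>h. (h *\<^sub>R (A ** mat_exp (t *\<^sub>R A))) \<bullet> b)) (at t)" for b
    unfolding has_field_derivative_def inner_scaleR_left mult_commute_abs by blast
  then show ?thesis
    unfolding has_vector_derivative_def by (subst has_derivative_componentwise_within) blast
qed

text \<open>For a skew-Hermitian matrix \<open>A\<close>, the derivative of \<open>E(t)\<^sup>* E(t)\<close> with
  \<open>E(t) = exp(tA)\<close> is \<open>E(t)\<^sup>* (A\<^sup>* + A) E(t) = 0\<close>.\<close>

lemma mat_exp_unitary:
  assumes "ctranspose A = - A"
  shows "ctranspose (mat_exp (t *\<^sub>R A)) ** mat_exp (t *\<^sub>R A) = mat 1"
proof -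
  define E where "E = (\<lambda>t::real. mat_exp (t *\<^sub>R A))"
  interpret mult: bounded_bilinear "\<lambda>(A::complex^3^3) (B::complex^3^3). A ** B" by (rule bounded_bilinear_cmatrix_mult)
  have E: "(E has_vector_derivative A ** E t) (at t)" for t
    unfolding E_def by (rule mat_exp_has_vector_derivative)
  have Et: "((\<lambda>t. ctranspose (E t)) has_vector_derivative ctranspose (A ** E t)) (at t)" for t
    by (rule bounded_linear.has_vector_derivative[OF bounded_linear_ctranspose E])
  have "((\<lambda>t. ctranspose (E t) ** E t) has_vector_derivative
      (ctranspose (E t) ** (A ** E t) + ctranspose (A ** E t) ** E t)) (at t)" for t
    by (rule mult.has_vector_derivative[OF Et E])
  moreover have "ctranspose (E t) ** (A ** E t) + ctranspose (A ** E t) ** E t = 0" for t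
    by (simp add: ctranspose_mult assms matrix_mul_assoc mult.minus_right mult.minus_left)
  ultimately have "((\<lambda>t. ctranspose (E t) ** E t) has_derivative (\<lambda>h. 0)) (at t)" for t
    by (simp add: has_vector_derivative_def)
  then obtain c where c: "\<And>t. ctranspose (E t) ** E t = c"
    using has_derivative_zero_constant[OF convex_UNIV, of "\<lambda>t. ctranspose (E t) ** E t"] by auto
  have "ctranspose (mat 1) = mat 1" by (simp add: ctranspose_def mat_def vec_eq_iff)
  then have "c = mat 1" using c[of 0] by (simp add: E_def mat_exp_0)
  then show ?thesis using c[of t] by (simp add: E_def)
qed

section \<open>Lattices and characters of order three\<close>

lemma independent_pair_iff:
  "a \<noteq> b \<and> independent {a, b} \<longleftrightarrow> (\<forall>x y. x *\<^sub>R a + y *\<^sub>R b = 0 \<longrightarrow> x = 0 \<and> y = 0)"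
proof
  assume ab: "a \<noteq> b \<and> independent {a, b}"
  then have a: "a \<notin> span {b}" and b: "b \<noteq> 0"
    using independent_insert[of a "{b}"] dependent_zero[of "{a,b}"] by auto
  show "\<forall>x y. x *\<^sub>R a + y *\<^sub>R b = 0 \<longrightarrow> x = 0 \<and> y = 0"
  proof (intro allI impI)
    fix x y assume xy: "x *\<^sub>R a + y *\<^sub>R b = 0"
    have "x = 0"
    proof (rule ccontr)
      assume x: "x \<noteq> 0"
      have "x *\<^sub>R a = (- y) *\<^sub>R b" using xy by (simp add: eq_neg_iff_add_eq_0)
      then have "a = (- y / x) *\<^sub>R b" using x
        by (metis (no_types) divide_inverse_commute scaleR_one scaleR_scaleR left_inverse)
      then have "a \<in> range (\<lambda>k. k *\<^sub>R b)" by (rule range_eqI)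
      then show False using a by (simp add: span_singleton)
    qed
    then show "x = 0 \<and> y = 0" using xy b by simp
  qed
next
  assume *: "\<forall>x y. x *\<^sub>R a + y *\<^sub>R b = 0 \<longrightarrow> x = 0 \<and> y = 0"
  have "b \<noteq> 0" using *[rule_format, of 0 1] by auto
  moreover have "a \<notin> span {b}"
  proof
    assume "a \<in> span {b}"
    then obtain k where "a = k *\<^sub>R b" by (auto simp: span_singleton)
    then show False using *[rule_format, of 1 "-k"] by simp
  qed
  moreover have "a \<noteq> b" using *[rule_format, of 1 "-1"] by auto
  ultimately show "a \<noteq> b \<and> independent {a, b}" by (simp add: independent_insert)
qed

definition lattice_span :: "real^2 \<Rightarrow> real^2 \<Rightarrow> (real^2) set" where
  "lattice_span a b = {of_int m *\<^sub>R a + of_int n *\<^sub>R b | m n :: int. True}"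

definition lattice_basis :: "real^2 \<Rightarrow> real^2 \<Rightarrow> bool" where
  "lattice_basis a b \<longleftrightarrow> (\<forall>x y. x *\<^sub>R a + y *\<^sub>R b = 0 \<longrightarrow> x = 0 \<and> y = 0)"

lemma plane_lattice_iff: "plane_lattice \<Lambda> \<longleftrightarrow> (\<exists>a b. lattice_basis a b \<and> \<Lambda> = lattice_span a b)"
  unfolding plane_lattice_def lattice_basis_def lattice_span_def independent_pair_iff[symmetric]
  by auto

lemma lattice_spanI: "of_int m *\<^sub>R a + of_int n *\<^sub>R b \<in> lattice_span a b"
  by (auto simp: lattice_span_def)

lemma lattice_span_swap: "lattice_span a b = lattice_span b a"
  unfolding lattice_span_def by (force simp: add.commute)

lemma lattice_span_add: "x \<in> lattice_span a b \<Longrightarrow> y \<in> lattice_span a b \<Longrightarrow> x + y \<in> lattice_span a b"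
proof -
  assume "x \<in> lattice_span a b" "y \<in> lattice_span a b"
  then obtain m n m' n' :: int where "x = of_int m *\<^sub>R a + of_int n *\<^sub>R b"
    "y = of_int m' *\<^sub>R a + of_int n' *\<^sub>R b" unfolding lattice_span_def by blast
  then have "x + y = of_int (m + m') *\<^sub>R a + of_int (n + n') *\<^sub>R b" by (simp add: algebra_simps)
  then show ?thesis using lattice_spanI by metis
qed

lemma lattice_span_minus: "x \<in> lattice_span a b \<Longrightarrow> - x \<in> lattice_span a b"
proof -
  assume "x \<in> lattice_span a b"
  then obtain m n :: int where "x = of_int m *\<^sub>R a + of_int n *\<^sub>R b"
    unfolding lattice_span_def by blast
  then have "- x = of_int (- m) *\<^sub>R a + of_int (- n) *\<^sub>R b" by simp
  then show ?thesis using lattice_spanI by metis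
qed

lemma lattice_span_shear: "lattice_span a (b + of_int k *\<^sub>R a) = lattice_span a b"
proof (intro equalityI subsetI)
  fix x assume "x \<in> lattice_span a (b + of_int k *\<^sub>R a)"
  then obtain m n :: int where "x = of_int m *\<^sub>R a + of_int n *\<^sub>R (b + of_int k *\<^sub>R a)"
    unfolding lattice_span_def by blast
  then have "x = of_int (m + n * k) *\<^sub>R a + of_int n *\<^sub>R b" by (simp add: algebra_simps)
  then show "x \<in> lattice_span a b" using lattice_spanI by metis
next
  fix x assume "x \<in> lattice_span a b"
  then obtain m n :: int where "x = of_int m *\<^sub>R a + of_int n *\<^sub>R b"
    unfolding lattice_span_def by blast
  then have "x = of_int (m - n * k) *\<^sub>R a + of_int n *\<^sub>R (b + of_int k *\<^sub>R a)"
    by (simp add: algebra_simps)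
  then show "x \<in> lattice_span a (b + of_int k *\<^sub>R a)" using lattice_spanI by metis
qed

lemma lattice_basis_shear:
  assumes "lattice_basis a b"
  shows "lattice_basis a (b + k *\<^sub>R a)"
  unfolding lattice_basis_def
proof (intro allI impI)
  fix x y assume "x *\<^sub>R a + y *\<^sub>R (b + k *\<^sub>R a) = 0"
  then have "(x + y * k) *\<^sub>R a + y *\<^sub>R b = 0" by (simp add: algebra_simps)
  then have "x + y * k = 0" "y = 0" using assms unfolding lattice_basis_def by blast+
  then show "x = 0 \<and> y = 0" by simp
qed

lemma lattice_basis_swap: "lattice_basis a b \<Longrightarrow> lattice_basis b a"
  unfolding lattice_basis_def by (metis add.commute)

lemma lattice_basis_multiple: "lattice_basis a b \<Longrightarrow> k \<noteq> 0 \<Longrightarrow> lattice_basis (k *\<^sub>R a) b"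
  unfolding lattice_basis_def by (metis mult_eq_0_iff scaleR_scaleR)

text \<open>As \<open>1 + \<zeta> + \<zeta>\<^sup>2 = 0\<close>, the polynomial \<open>z\<^sup>3 - 1\<close> splits into the three corresponding factors.\<close>

lemma cube_root_of_unity_cases:
  fixes \<zeta> z :: complex
  assumes "\<zeta> ^ 3 = 1" "\<zeta> \<noteq> 1" "z ^ 3 = 1"
  shows "z = 1 \<or> z = \<zeta> \<or> z = \<zeta>\<^sup>2"
proof -
  have "(\<zeta> - 1) * (1 + \<zeta> + \<zeta>\<^sup>2) = \<zeta> ^ 3 - 1"
    by (simp add: algebra_simps power2_eq_square power3_eq_cube)
  then have s0: "1 + \<zeta> + \<zeta>\<^sup>2 = 0" using assms(1,2) by simp
  have s: "\<zeta>\<^sup>2 = - 1 - \<zeta>"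
    using arg_cong[OF s0, of "\<lambda>y. y - 1 - \<zeta>"] by simp
  have "(z - 1) * ((z - \<zeta>) * (z - \<zeta>\<^sup>2)) = z ^ 3 - 1"
  proof -
    have "(z - \<zeta>) * (z - \<zeta>\<^sup>2) = z\<^sup>2 - (\<zeta> + \<zeta>\<^sup>2) * z + \<zeta> ^ 3"
      by (simp add: algebra_simps power2_eq_square power3_eq_cube)
    also have "\<dots> = z\<^sup>2 + z + 1" using s assms(1) by (simp add: algebra_simps)
    finally show ?thesis by (simp add: algebra_simps power2_eq_square power3_eq_cube)
  qed
  then show ?thesis using assms(3) by auto
qed

text \<open>Different cube roots of unity have distance \<open>\<surd>3\<close>.\<close>

lemma cube_roots_of_unity_apart:
  fixes c d :: complex
  assumes "c ^ 3 = 1" "d ^ 3 = 1" "cmod (c - d) < 1"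
  shows "c = d"
proof (rule ccontr)
  assume "c \<noteq> d"
  have "(c - d) * (c\<^sup>2 + c * d + d\<^sup>2) = c ^ 3 - d ^ 3"
    by (simp add: algebra_simps power2_eq_square power3_eq_cube)
  then have "c\<^sup>2 + c * d + d\<^sup>2 = 0" using assms(1,2) \<open>c \<noteq> d\<close> by simp
  then have "(c - d)\<^sup>2 = - 3 * (c * d)" by (simp add: power2_eq_square algebra_simps) algebra
  then have "cmod (c - d) ^ 2 = 3 * (cmod c * cmod d)"
    by (simp add: norm_power[symmetric] norm_mult)
  moreover have "cmod c = 1" "cmod d = 1"
    using assms(1,2) power_eq_1_iff[of c 3] power_eq_1_iff[of d 3] by auto
  moreover have "cmod (c - d) ^ 2 < 1" using assms(3) by (simp add: power_less_one_iff)
  ultimately show False by simp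
qed

text \<open>The setting of the monodromy of the lift: the kernel will be the lattice of the covering torus.\<close>

locale cubic_character =
  fixes \<Lambda> :: "(real^2) set" and \<tau> :: "real^2 \<Rightarrow> complex"
  assumes lattice: "plane_lattice \<Lambda>"
    and mult: "\<And>k l. k \<in> \<Lambda> \<Longrightarrow> l \<in> \<Lambda> \<Longrightarrow> \<tau> (k + l) = \<tau> k * \<tau> l"
    and cube: "\<And>l. l \<in> \<Lambda> \<Longrightarrow> \<tau> l ^ 3 = 1"
begin

definition ker :: "(real^2) set" where
  "ker = {l \<in> \<Lambda>. \<tau> l = 1}"

abbreviation \<Lambda>_group :: "(real^2) monoid" where
  "\<Lambda>_group \<equiv> \<lparr>carrier = \<Lambda>, monoid.mult = (+), one = 0\<rparr>"

lemma nonzero: "l \<in> \<Lambda> \<Longrightarrow> \<tau> l \<noteq> 0"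
  using cube[of l] by auto

lemma \<Lambda>_zero: "0 \<in> \<Lambda>"
proof -
  obtain a b where "\<Lambda> = lattice_span a b" using lattice plane_lattice_iff by blast
  then show ?thesis using lattice_spanI[of 0 a 0 b] by simp
qed

lemma \<Lambda>_add: "k \<in> \<Lambda> \<Longrightarrow> l \<in> \<Lambda> \<Longrightarrow> k + l \<in> \<Lambda>"
  using lattice lattice_span_add unfolding plane_lattice_iff by auto

lemma \<Lambda>_minus: "l \<in> \<Lambda> \<Longrightarrow> - l \<in> \<Lambda>"
  using lattice lattice_span_minus unfolding plane_lattice_iff by auto

lemma \<tau>_zero: "\<tau> 0 = 1"
  using mult[OF \<Lambda>_zero \<Lambda>_zero] nonzero[OF \<Lambda>_zero] by (metis add.right_neutral mult_cancel_left1)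

lemma group_\<Lambda>: "group \<Lambda>_group"
proof (rule groupI)
  fix x assume "x \<in> carrier \<Lambda>_group"
  then show "\<exists>y\<in>carrier \<Lambda>_group. y \<otimes>\<^bsub>\<Lambda>_group\<^esub> x = \<one>\<^bsub>\<Lambda>_group\<^esub>"
    using \<Lambda>_minus[of x] by (intro bexI[of _ "- x"]) auto
qed (auto simp: \<Lambda>_zero \<Lambda>_add algebra_simps)

lemma \<tau>_int_multiple: "l \<in> \<Lambda> \<Longrightarrow> of_int m *\<^sub>R l \<in> \<Lambda> \<and> \<tau> (of_int m *\<^sub>R l) = \<tau> l powi m"
proof (induction m rule: int_induct[where k = 0])
  case base
  then show ?case by (simp add: \<Lambda>_zero \<tau>_zero)
next
  case (step1 i)
  have "of_int (i + 1) *\<^sub>R l = of_int i *\<^sub>R l + l" by (simp add: algebra_simps)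
  moreover have "\<tau> (of_int i *\<^sub>R l + l) = \<tau> l powi i * \<tau> l" using step1 mult by simp
  moreover have "\<tau> l powi (i + 1) = \<tau> l powi i * \<tau> l"
    using nonzero[of l] step1.prems by (simp add: power_int_add)
  ultimately show ?case using step1 \<Lambda>_add by simp
next
  case (step2 i)
  have eq: "of_int (i - 1) *\<^sub>R l = of_int i *\<^sub>R l + - l" by (simp add: algebra_simps)
  have "\<tau> l * \<tau> (- l) = 1" using mult[OF step2.prems \<Lambda>_minus[OF step2.prems]] \<tau>_zero by simp
  then have "\<tau> (- l) = inverse (\<tau> l)" using inverse_unique by metis
  then have "\<tau> (of_int i *\<^sub>R l + - l) = \<tau> l powi i * inverse (\<tau> l)"
    using step2 mult[of "of_int i *\<^sub>R l" "- l"] \<Lambda>_minus[of l] by simp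
  moreover have "\<tau> l powi (i - 1) = \<tau> l powi i * inverse (\<tau> l)"
    using nonzero[of l] step2.prems by (simp add: power_int_diff divide_inverse)
  ultimately show ?case unfolding eq
    using step2 \<Lambda>_add[of "of_int i *\<^sub>R l" "- l"] \<Lambda>_minus[of l] by simp
qed

lemma ker_eq_span_triple:
  assumes "\<Lambda> = lattice_span a b" "\<tau> a \<noteq> 1" "\<tau> b = 1"
  shows "ker = lattice_span (3 *\<^sub>R a) b"
proof -
  have ab: "a \<in> \<Lambda>" "b \<in> \<Lambda>"
    using lattice_spanI[of 1 a 0 b] lattice_spanI[of 0 a 1 b] assms(1) by auto
  have eval: "\<tau> (of_int m *\<^sub>R a + of_int n *\<^sub>R b) = \<tau> a powi m" for m n
    using \<tau>_int_multiple ab mult assms(3) by (simp add: power_int_1_left)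
  have one: "\<tau> a powi m = 1 \<longleftrightarrow> 3 dvd m" for m :: int
  proof -
    have 3: "\<tau> a powi (3 * k) = 1" for k :: int
    proof -
      have "\<tau> a powi 3 = 1" using cube[OF ab(1)] by (simp add: power_int_numeral)
      then show ?thesis by (simp add: power_int_mult power_int_1_left)
    qed
    have "m = 3 * (m div 3) + m mod 3" by simp
    then have m: "\<tau> a powi m = \<tau> a powi (m mod 3)"
      using nonzero[OF ab(1)] 3[of "m div 3"]
      by (metis (no_types, lifting) mult_1 power_int_add)
    have "m mod 3 = 0 \<or> m mod 3 = 1 \<or> m mod 3 = 2" by presburger
    moreover have "\<tau> a powi 2 \<noteq> 1"
      using cube[OF ab(1)] assms(2) by (auto simp: power_int_numeral power2_eq_square power3_eq_cube mult.assoc)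
    ultimately show ?thesis using m assms(2) by (auto simp: dvd_eq_mod_eq_0)
  qed
  show ?thesis
  proof (intro equalityI subsetI)
    fix l assume l: "l \<in> ker"
    then obtain m n :: int where mn: "l = of_int m *\<^sub>R a + of_int n *\<^sub>R b"
      using assms(1) unfolding ker_def lattice_span_def by blast
    with l have "3 dvd m" using eval one by (simp add: ker_def)
    then obtain k where "m = 3 * k" by blast
    with mn have "l = of_int k *\<^sub>R (3 *\<^sub>R a) + of_int n *\<^sub>R b" by simp
    then show "l \<in> lattice_span (3 *\<^sub>R a) b" using lattice_spanI by metis
  next
    fix l assume "l \<in> lattice_span (3 *\<^sub>R a) b"
    then obtain k n :: int where "l = of_int k *\<^sub>R (3 *\<^sub>R a) + of_int n *\<^sub>R b"
      unfolding lattice_span_def by blast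
    then have l: "l = of_int (3 * k) *\<^sub>R a + of_int n *\<^sub>R b" by simp
    moreover have "l \<in> \<Lambda>" unfolding l assms(1) by (rule lattice_spanI)
    ultimately show "l \<in> ker" using eval one by (simp add: ker_def del: of_int_mult)
  qed
qed

lemma plane_lattice_ker: "plane_lattice ker"
proof -
  obtain a b where ab: "lattice_basis a b" "\<Lambda> = lattice_span a b"
    using lattice plane_lattice_iff by blast
  have in\<Lambda>: "a \<in> \<Lambda>" "b \<in> \<Lambda>"
    using lattice_spanI[of 1 a 0 b] lattice_spanI[of 0 a 1 b] ab(2) by auto
  show ?thesis
  proof (cases "\<tau> a = 1")
    case False
    \<comment> \<open>\<open>\<tau> a\<close> generates the cube roots of unity, so a shear moves the second basis
      vector into the kernel\<close>
    obtain k :: int where "\<tau> b * \<tau> a powi k = 1"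
    proof -
      have "\<tau> b = 1 \<or> \<tau> b = \<tau> a \<or> \<tau> b = (\<tau> a)\<^sup>2"
        using cube_root_of_unity_cases cube in\<Lambda> False by blast
      then have "\<tau> b * \<tau> a powi 0 = 1 \<or> \<tau> b * \<tau> a powi 2 = 1 \<or> \<tau> b * \<tau> a powi 1 = 1"
        using cube[OF in\<Lambda>(1)] by (auto simp: power_int_numeral power2_eq_square power3_eq_cube mult.assoc)
      then show ?thesis using that by blast
    qed
    then have "\<tau> (b + of_int k *\<^sub>R a) = 1"
      using \<tau>_int_multiple[OF in\<Lambda>(1)] mult in\<Lambda> by simp
    with ker_eq_span_triple[of a "b + of_int k *\<^sub>R a"] have
      "ker = lattice_span (3 *\<^sub>R a) (b + of_int k *\<^sub>R a)"
      using ab(2) False by (simp add: lattice_span_shear)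
    then show ?thesis
      using lattice_basis_multiple[OF lattice_basis_shear[OF ab(1)], of 3] plane_lattice_iff by auto
  next
    case a: True
    show ?thesis
    proof (cases "\<tau> b = 1")
      case True
      have "\<tau> (of_int m *\<^sub>R a + of_int n *\<^sub>R b) = 1" for m n
        using \<tau>_int_multiple in\<Lambda> mult True a by (simp add: power_int_1_left)
      then have "\<tau> l = 1" if "l \<in> \<Lambda>" for l
        using that unfolding ab(2) lattice_span_def by auto
      then have "ker = \<Lambda>" unfolding ker_def by auto
      then show ?thesis using lattice by simp
    next
      case False
      have "ker = lattice_span (3 *\<^sub>R b) a"
        by (rule ker_eq_span_triple) (use ab(2) a False lattice_span_swap in auto)
      then show ?thesis
        using lattice_basis_multiple[OF lattice_basis_swap[OF ab(1)], of 3] plane_lattice_iff by auto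
    qed
  qed
qed

text \<open>If the character is not trivial, the logarithm to the base of a nontrivial value \<open>\<zeta>\<close> is a
  homomorphism onto the integers modulo three with the same kernel.\<close>

lemma covering_group_ker:
  "covering_group ker \<Lambda> \<cong> integer_mod_group 1 \<or> covering_group ker \<Lambda> \<cong> integer_mod_group 3"
proof (cases "\<forall>l\<in>\<Lambda>. \<tau> l = 1")
  case True
  let ?h = "\<lambda>l::real^2. 0::int"
  have "group_hom \<Lambda>_group (integer_mod_group 1) ?h"
    using group_\<Lambda> by (auto simp: group_hom_def group_hom_axioms_def hom_def carrier_integer_mod_group)
  moreover have "kernel \<Lambda>_group (integer_mod_group 1) ?h = ker"
    using True by (auto simp: kernel_def ker_def)
  moreover have "?h ` carrier \<Lambda>_group = carrier (integer_mod_group 1)"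
    using \<Lambda>_zero by (auto simp: carrier_integer_mod_group)
  ultimately show ?thesis
    unfolding covering_group_def using group_hom.FactGroup_iso by metis
next
  case False
  then obtain l0 where l0: "l0 \<in> \<Lambda>" "\<tau> l0 \<noteq> 1" by blast
  define \<zeta> where "\<zeta> = \<tau> l0"
  have \<zeta>: "\<zeta> ^ 3 = 1" "\<zeta> \<noteq> 1" using l0 cube by (auto simp: \<zeta>_def)
  then have \<zeta>3: "\<zeta> * \<zeta>\<^sup>2 = 1" "\<zeta>\<^sup>2 * \<zeta> = 1" by (simp_all add: power2_eq_square power3_eq_cube mult.assoc)
  then have \<zeta>4: "\<zeta>\<^sup>2 * \<zeta>\<^sup>2 = \<zeta>" by (metis mult.assoc mult_1 power2_eq_square)
  have \<zeta>2: "\<zeta>\<^sup>2 \<noteq> 1" "\<zeta>\<^sup>2 \<noteq> \<zeta>" using \<zeta> \<zeta>3 by (auto simp: power2_eq_square)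
  have cases: "\<tau> l = 1 \<or> \<tau> l = \<zeta> \<or> \<tau> l = \<zeta>\<^sup>2" if "l \<in> \<Lambda>" for l
    using cube_root_of_unity_cases \<zeta> cube[OF that] by blast
  define h :: "real^2 \<Rightarrow> int" where "h = (\<lambda>l. if \<tau> l = 1 then 0 else if \<tau> l = \<zeta> then 1 else 2)"
  have "h (k + l) = (h k + h l) mod 3" if "k \<in> \<Lambda>" "l \<in> \<Lambda>" for k l
    using cases[OF that(1)] cases[OF that(2)] mult[OF that] \<zeta>(2) \<zeta>2 \<zeta>3 \<zeta>4
    unfolding h_def by (elim disjE) (simp_all add: power2_eq_square[symmetric])
  then have "group_hom \<Lambda>_group (integer_mod_group 3) h"
    using group_\<Lambda> by (auto simp: group_hom_def group_hom_axioms_def hom_def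
        carrier_integer_mod_group h_def)
  moreover have "kernel \<Lambda>_group (integer_mod_group 3) h = ker"
    by (auto simp: kernel_def ker_def h_def)
  moreover have "h ` carrier \<Lambda>_group = carrier (integer_mod_group 3)"
  proof -
    have "h 0 = 0" "h l0 = 1" "h (l0 + l0) = 2"
      using \<tau>_zero \<zeta> \<zeta>2 mult[OF l0(1) l0(1)]
      by (auto simp: h_def \<zeta>_def[symmetric] power2_eq_square)
    then have "{0, 1, 2} \<subseteq> h ` \<Lambda>"
      using \<Lambda>_zero l0(1) \<Lambda>_add[OF l0(1) l0(1)] by (metis empty_subsetI imageI insert_subset)
    moreover have "h ` \<Lambda> \<subseteq> {0, 1, 2}" by (auto simp: h_def)
    moreover have "{0..<3::int} = {0, 1, 2}" by auto
    ultimately have "h ` \<Lambda> = {0..<3}" by blast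
    then show ?thesis by (simp add: carrier_integer_mod_group)
  qed
  ultimately show ?thesis
    unfolding covering_group_def using group_hom.FactGroup_iso by metis
qed

end

section \<open>The projector field of a minimal Lagrangian torus\<close>

text \<open>The velocity of the curve of the lines spanned by \<open>u + t k\<close>, where \<open>1 + t\<^sup>2|k|\<^sup>2\<close> is the squared
  length of the spanning vector.\<close>

lemma tangent_space_projective:
  assumes "norm u = 1" "hprod k u = 0"
  shows "outer k u + outer u k \<in> tangent_space (orth_proj ` Grassmannian 1) (outer u u)"
proof -
  define c where "c = (norm k)\<^sup>2"
  define \<gamma> where "\<gamma> = (\<lambda>t::real. (1 / (1 + t\<^sup>2 * c)) *\<^sub>R
    (outer u u + t *\<^sub>R (outer k u + outer u k) + t\<^sup>2 *\<^sub>R outer k k))"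
  have c: "1 + t\<^sup>2 * c > 0" for t
    unfolding c_def by (smt (verit) mult_nonneg_nonneg zero_le_power2)
  have "\<gamma> t \<in> orth_proj ` Grassmannian 1" for t
  proof -
    define y where "y = u + t *\<^sub>R k"
    define s where "s = 1 + t\<^sup>2 * c"
    have "hprod u k = 0" using assms(2) hprod_eq_0_swap by blast
    then have "hprod y y = of_real s"
      unfolding y_def hprod_simps
      by (simp add: assms hprod_self s_def c_def power2_eq_square)
    then have ny: "(norm y)\<^sup>2 = s" by (simp add: hprod_self flip: of_real_power)
    have s: "s > 0" using c s_def by simp
    then have y0: "y \<noteq> 0" using ny by auto
    define z where "z = (1 / norm y) *\<^sub>R y"
    have z: "norm z = 1" using y0 by (simp add: z_def)
    have "outer z z = (1 / s) *\<^sub>R outer y y"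
      using ny unfolding z_def
      by (simp add: bounded_bilinear.scaleR_left[OF bounded_bilinear_outer]
          bounded_bilinear.scaleR_right[OF bounded_bilinear_outer] power2_eq_square)
    also have "\<dots> = \<gamma> t"
      unfolding \<gamma>_def y_def s_def
      by (simp add: bounded_bilinear.scaleR_left[OF bounded_bilinear_outer]
          bounded_bilinear.scaleR_right[OF bounded_bilinear_outer]
          bounded_bilinear.add_left[OF bounded_bilinear_outer]
          bounded_bilinear.add_right[OF bounded_bilinear_outer] algebra_simps power2_eq_square)
    finally have "\<gamma> t = orth_proj (vec.span {z})" using orth_proj_line[OF z] by simp
    moreover have "vec.span {z} \<in> Grassmannian 1"
      using z by (intro span_unit_in_Grassmannian_1) auto
    ultimately show ?thesis by blast
  qed
  moreover have "\<gamma> 0 = outer u u" by (simp add: \<gamma>_def)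
  moreover have "(\<gamma> has_vector_derivative (outer k u + outer u k)) (at 0)"
    unfolding \<gamma>_def using c[of 0] by (auto intro!: derivative_eq_intros)
  ultimately show ?thesis unfolding tangent_space_def by blast
qed

locale minimal_lagrangian =
  fixes \<Lambda> :: "(real^2) set" and \<phi> :: "real^2 \<Rightarrow> (complex^3) set"
  assumes torus: "minimal_lagrangian_torus \<Lambda> \<phi>"
begin

definition P :: "real^2 \<Rightarrow> complex^3^3" where "P = orth_proj \<circ> \<phi>"

definition unit_at :: "real^2 \<Rightarrow> complex^3 \<Rightarrow> bool" where
  "unit_at q u \<longleftrightarrow> norm u = 1 \<and> \<phi> q = vec.span {u}"

abbreviation dP :: "real^2 \<Rightarrow> real^2 \<Rightarrow> complex^3^3" where
  "dP q x \<equiv> dirderiv P q x"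

abbreviation ddP :: "real^2 \<Rightarrow> real^2 \<Rightarrow> real^2 \<Rightarrow> complex^3^3" where
  "ddP q x y \<equiv> dirderiv (\<lambda>r. dP r x) q y"

text \<open>Half of the metric induced by \<open>P\<close>, so that the differential of a horizontal lift
  is isometric for it.\<close>

definition G :: "real^2 \<Rightarrow> real^2 \<Rightarrow> real^2 \<Rightarrow> real" where
  "G q x y = (dP q x \<bullet> dP q y) / 2"

lemma P_immersion: "immersion_on UNIV P"
  and P_periodic: "l \<in> \<Lambda> \<Longrightarrow> P (p + l) = P p"
  and \<phi>_periodic: "l \<in> \<Lambda> \<Longrightarrow> \<phi> (p + l) = \<phi> p"
  and lattice: "plane_lattice \<Lambda>"
  and P_minimal: "minimal_immersion (orth_proj ` Grassmannian 1) P"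
  and P_lagrangian: "fubini_study_form (P p) (dP p v) (dP p w) = 0"
  using torus unfolding minimal_lagrangian_torus_def minimal_immersion_def periodic_def P_def
  by auto

lemma smooth_P: "smooth_on UNIV P"
  using P_immersion by (simp add: immersion_on_def)

lemma unit_at_ex: "\<exists>u. unit_at q u"
proof -
  have "\<phi> q \<in> Grassmannian 1" using torus by (auto simp: minimal_lagrangian_torus_def)
  then show ?thesis using Grassmannian_1_unit_vector unfolding unit_at_def by metis
qed

lemma unit_at_norm: "unit_at q u \<Longrightarrow> norm u = 1"
  and unit_at_hprod: "unit_at q u \<Longrightarrow> hprod u u = 1"
  by (auto simp: unit_at_def hprod_self)

lemma P_eq_outer: "unit_at q u \<Longrightarrow> P q = outer u u"
  by (simp add: unit_at_def P_def orth_proj_line)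

lemma P_fixes: "unit_at q u \<Longrightarrow> P q *v u = u"
  by (simp add: P_eq_outer outer_mult_vec unit_at_hprod)

lemma unit_atI:
  assumes "norm u = 1" "P q *v u = u"
  shows "unit_at q u"
proof -
  obtain w where w: "unit_at q w" using unit_at_ex by blast
  have u: "u = hprod u w *s w" using assms(2) P_eq_outer[OF w] by (simp add: outer_mult_vec)
  then have "hprod u w \<noteq> 0" using assms(1) by (metis norm_zero vector_smult_lzero zero_neq_one)
  moreover have "(1 / c) *s (c *s w) = w" if "c \<noteq> 0" for c using that by simp
  ultimately have "w = (1 / hprod u w) *s u" using u by metis
  then have "vec.span {u} = vec.span {w}"
    using u by (intro vec.span_eq[THEN iffD2] conjI) (auto simp: in_span_singleton)
  then show ?thesis using w assms(1) by (simp add: unit_at_def)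
qed

lemma unit_at_scale:
  assumes "unit_at q u" "cmod c = 1"
  shows "unit_at q (c *s u)"
  using assms P_fixes[OF assms(1)]
  by (intro unit_atI) (auto simp: norm_scale unit_at_norm vector_scalar_commute)

lemma P_hermitian: "ctranspose (P q) = P q"
  using unit_at_ex P_eq_outer ctranspose_outer by metis

lemma P_idempotent: "P q ** P q = P q"
proof -
  obtain u where "unit_at q u" using unit_at_ex by blast
  then show ?thesis by (simp add: P_eq_outer matrix_mult_outer outer_mult_vec unit_at_hprod)
qed

lemma P_has_derivative: "(P has_derivative dP q) (at q)"
  using smooth_on_has_derivative[OF smooth_P] by simp

lemma dP_has_derivative: "((\<lambda>r. dP r x) has_derivative ddP q x) (at q)"
  using smooth_on_has_derivative[OF smooth_on_dirderiv[OF smooth_P]] by simp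

lemma linear_dP: "linear (dP q)"
  using smooth_on_linear_dirderiv[OF smooth_P] by simp

lemma linear_ddP: "linear (ddP q x)"
  using smooth_on_linear_dirderiv[OF smooth_on_dirderiv[OF smooth_P]] by simp

lemma ddP_symmetric: "ddP q x y = ddP q y x"
  by (rule second_dirderiv_commute[OF smooth_P])

lemma ddP_scale: "ddP q (a *\<^sub>R x) (b *\<^sub>R y) = (a * b) *\<^sub>R ddP q x y"
proof -
  have "ddP q (a *\<^sub>R x) (b *\<^sub>R y) = b *\<^sub>R ddP q (a *\<^sub>R x) y"
    using linear_cmul[OF linear_ddP] by simp
  also have "ddP q (a *\<^sub>R x) y = ddP q y (a *\<^sub>R x)" by (rule ddP_symmetric)
  also have "\<dots> = a *\<^sub>R ddP q y x" using linear_cmul[OF linear_ddP] by simp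
  also have "ddP q y x = ddP q x y" by (rule ddP_symmetric)
  finally show ?thesis by simp
qed

lemma dP_hermitian: "ctranspose (dP q x) = dP q x"
proof -
  have "((\<lambda>r. ctranspose (P r)) has_derivative (\<lambda>x. ctranspose (dP q x))) (at q)"
    by (rule bounded_linear.has_derivative[OF bounded_linear_ctranspose P_has_derivative])
  then have "dirderiv P q x = ctranspose (dP q x)"
    unfolding P_hermitian by (rule dirderiv_eqI)
  then show ?thesis by simp
qed

lemma ddP_hermitian: "ctranspose (ddP q x y) = ddP q x y"
proof -
  have "((\<lambda>r. ctranspose (dP r x)) has_derivative (\<lambda>y. ctranspose (ddP q x y))) (at q)"
    by (rule bounded_linear.has_derivative[OF bounded_linear_ctranspose dP_has_derivative])
  then have "ddP q x y = ctranspose (ddP q x y)"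
    unfolding dP_hermitian by (rule dirderiv_eqI)
  then show ?thesis by simp
qed

lemma dP_product: "dP q x = P q ** dP q x + dP q x ** P q"
proof -
  have "((\<lambda>r. P r ** P r) has_derivative (\<lambda>x. P q ** dP q x + dP q x ** P q)) (at q)"
    by (rule bounded_bilinear.FDERIV[OF bounded_bilinear_cmatrix_mult P_has_derivative P_has_derivative])
  then show ?thesis unfolding P_idempotent by (rule dirderiv_eqI)
qed

lemma
  assumes "unit_at q u"
  shows dP_orthogonal: "hprod (dP q x *v u) u = 0"
    and dP_eq_outer: "dP q x = outer (dP q x *v u) u + outer u (dP q x *v u)"
  using rank_one_projector_variation[OF unit_at_hprod[OF assms] dP_hermitian
      dP_product[where q = q and x = x, unfolded P_eq_outer[OF assms]]] .

lemma dP_mult_vec: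
  assumes "unit_at q u"
  shows "dP q x *v y = hprod y u *s (dP q x *v u) + hprod y (dP q x *v u) *s u"
  by (subst dP_eq_outer[OF assms]) (simp add: matrix_vector_mult_add_rdistrib outer_mult_vec)

lemma inner_dP:
  assumes "unit_at q u"
  shows "outer k u \<bullet> dP q y = Re (hprod k (dP q y *v u))"
    and "hprod k u = 0 \<Longrightarrow> outer u k \<bullet> dP q y = Re (hprod k (dP q y *v u))"
proof -
  show "outer k u \<bullet> dP q y = Re (hprod k (dP q y *v u))" by (rule inner_outer)
  show "outer u k \<bullet> dP q y = Re (hprod k (dP q y *v u))" if "hprod k u = 0"
    unfolding inner_outer
    by (subst dP_mult_vec[OF assms])
      (simp add: hprod_simps that unit_at_hprod[OF assms] cnj_hprod Re_hprod_swap)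
qed

lemma G_eq_Re:
  assumes "unit_at q u"
  shows "G q x y = Re (hprod (dP q x *v u) (dP q y *v u))"
proof -
  have "dP q x \<bullet> dP q y = (outer (dP q x *v u) u + outer u (dP q x *v u)) \<bullet> dP q y"
    using dP_eq_outer[OF assms] by metis
  then show ?thesis
    using inner_dP[OF assms] dP_orthogonal[OF assms] by (simp add: G_def inner_add_left)
qed

text \<open>The Kaehler form in terms of horizontal vectors.\<close>

lemma lagrangian:
  assumes "unit_at q u"
  shows "Im (hprod (dP q x *v u) (dP q y *v u)) = 0"
proof -
  let ?h = "dP q x *v u"
  have "dP q x ** P q - P q ** dP q x = outer ?h u - outer u ?h"
    by (simp add: P_eq_outer[OF assms] matrix_mult_outer outer_matrix_mult dP_hermitian)
  then have "mat \<i> ** (dP q x ** P q - P q ** dP q x) = outer (\<i> *s ?h) u - outer (\<i> *s u) ?h"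
    by (simp add: bounded_bilinear.diff_right[OF bounded_bilinear_cmatrix_mult] matrix_mult_outer mat_scale)
  then have "(outer (\<i> *s ?h) u - outer (\<i> *s u) ?h) \<bullet> dP q y = 0"
    using P_lagrangian[of q x y] by (simp add: fubini_study_form_def)
  then have "Re (hprod (\<i> *s ?h) (dP q y *v u)) = Re (hprod (\<i> *s u) (dP q y *v ?h))"
    by (simp add: inner_diff_left inner_outer)
  also have "hprod (\<i> *s u) (dP q y *v ?h) = \<i> * hprod (dP q y *v u) ?h"
    by (subst dP_mult_vec[OF assms])
      (simp add: hprod_simps dP_orthogonal[OF assms] unit_at_hprod[OF assms] cnj_hprod)
  finally show ?thesis using Im_hprod_swap[of ?h "dP q y *v u"] by (simp add: hprod_simps)
qed

lemma hprod_dP: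
  assumes "unit_at q u"
  shows "hprod (dP q x *v u) (dP q y *v u) = of_real (G q x y)"
  using G_eq_Re[OF assms] lagrangian[OF assms] by (simp add: complex_eq_iff)

lemma G_symmetric: "G q x y = G q y x"
  by (simp add: G_def inner_commute)

lemma G_add_left: "G q (x + y) z = G q x z + G q y z"
  and G_scale_left: "G q (a *\<^sub>R x) z = a * G q x z"
  by (simp_all add: G_def linear_add[OF linear_dP] linear_cmul[OF linear_dP] inner_add_left
      add_divide_distrib)

lemma G_add_right: "G q z (x + y) = G q z x + G q z y"
  and G_scale_right: "G q z (a *\<^sub>R x) = a * G q z x"
  by (simp_all add: G_symmetric[of q z] G_add_left G_scale_left)

lemma dP_eq_0_iff: "dP q x = 0 \<longleftrightarrow> x = 0"
proof
  assume "dP q x = 0"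
  then have "dP q x = dP q 0" by (simp add: linear_0[OF linear_dP])
  then show "x = 0" using P_immersion by (auto simp: immersion_on_def inj_def)
qed (simp add: linear_0[OF linear_dP])

lemma G_positive: "x \<noteq> 0 \<Longrightarrow> G q x x > 0"
  by (simp add: G_def dP_eq_0_iff)

lemma smooth_G: "smooth_on UNIV (\<lambda>q. G q x y)"
proof -
  have "smooth_on UNIV (\<lambda>q. (dP q x \<bullet> dP q y))"
    by (intro smooth_on_bounded_bilinear[OF open_UNIV bounded_bilinear_inner]
        smooth_on_dirderiv smooth_P)
  then show ?thesis unfolding G_def
    by (intro smooth_on_bounded_linear[OF open_UNIV bounded_linear_divide])
qed

text \<open>The squared area of the parallelogram spanned by the standard basis, in the metric \<open>G\<close>.\<close>

definition gram :: "real^2 \<Rightarrow> real" where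
  "gram q = G q (axis 1 1) (axis 1 1) * G q (axis 2 1) (axis 2 1) - (G q (axis 1 1) (axis 2 1))\<^sup>2"

definition area :: "real^2 \<Rightarrow> real" where
  "area q = gram q powr (1/2)"

text \<open>Up to the factor \<open>G(e\<^sub>1, e\<^sub>1)\<close>, this is the squared length of the vector that Gram-Schmidt
  orthogonalization makes of \<open>e\<^sub>2\<close>.\<close>

lemma gram_positive: "gram q > 0"
proof -
  let ?e = "axis 1 1 :: real^2" and ?f = "axis 2 1 :: real^2"
  let ?x = "G q ?e ?e *\<^sub>R ?f + (- G q ?e ?f) *\<^sub>R ?e"
  have e: "G q ?e ?e > 0" by (rule G_positive) (simp add: axis_eq_0_iff)
  have "?x $ 2 \<noteq> 0" using e by (simp add: axis_def)
  then have "?x \<noteq> 0" by (metis zero_index)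
  then have "G q ?x ?x > 0" by (rule G_positive)
  moreover have "G q ?x ?x = G q ?e ?e * gram q"
    unfolding gram_def G_add_left G_add_right G_scale_left G_scale_right
    using G_symmetric[of q ?e ?f] by (simp add: algebra_simps power2_eq_square)
  ultimately show ?thesis using e by (simp add: zero_less_mult_iff)
qed

lemma area_positive: "area q > 0"
  using gram_positive[of q] by (simp add: area_def)

lemma area_squared: "(area q)\<^sup>2 = gram q"
  using gram_positive[of q] by (simp add: area_def powr_half_sqrt)

lemma smooth_gram: "smooth_on UNIV gram"
  unfolding gram_def[abs_def] power2_eq_square
  by (intro smooth_on_diff smooth_on_bounded_bilinear[OF open_UNIV bounded_bilinear_mult] smooth_G open_UNIV)

lemma smooth_inverse_area: "smooth_on UNIV (\<lambda>q. inverse (area q))"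
proof -
  have "inverse (area q) = gram q powr (- 1/2)" for q
    by (simp add: area_def powr_minus[symmetric])
  then show ?thesis
    by (simp only:) (intro smooth_on_powr smooth_gram gram_positive open_UNIV)
qed

subsection \<open>Conformal frames\<close>

definition orient :: "real^2 \<Rightarrow> real^2 \<Rightarrow> real" where
  "orient v w = v$1 * w$2 - v$2 * w$1"

lemma conformal_frame_G:
  "conformal_frame P q v w \<longleftrightarrow> G q v v = G q w w \<and> G q v w = 0 \<and> orient v w > 0"
  by (auto simp: conformal_frame_def G_def orient_def norm_eq_sqrt_inner)

lemma conformal_frame_ex: "\<exists>v w. conformal_frame P q v w"
proof -
  let ?e = "axis 1 1 :: real^2" and ?f = "axis 2 1 :: real^2"
  let ?w = "(- G q ?e ?f / area q) *\<^sub>R ?e + (G q ?e ?e / area q) *\<^sub>R ?f"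
  have e: "G q ?e ?e > 0" by (rule G_positive) (simp add: axis_eq_0_iff)
  have A: "area q \<noteq> 0" using area_positive[of q] by simp
  have "G q ?w ?w = G q ?e ?e * gram q / (area q)\<^sup>2"
    unfolding gram_def G_add_left G_add_right G_scale_left G_scale_right
    using G_symmetric[of q ?e ?f] A by (simp add: field_simps power2_eq_square)
  then have "G q ?e ?e = G q ?w ?w" unfolding area_squared using gram_positive[of q] by simp
  moreover have "G q ?e ?w = 0"
    unfolding G_add_right G_scale_right by simp
  moreover have "orient ?e ?w > 0"
    using e area_positive[of q] by (simp add: orient_def axis_def)
  ultimately show ?thesis unfolding conformal_frame_G by blast
qed

lemma conformal_frame_nonzero:
  assumes "conformal_frame P q v w"
  shows "v \<noteq> 0" "w \<noteq> 0" "G q v v > 0"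
proof -
  show "v \<noteq> 0" "w \<noteq> 0" using assms unfolding conformal_frame_G orient_def by auto
  then show "G q v v > 0" using G_positive by blast
qed

text \<open>Cramer's rule.\<close>

lemma plane_expansion:
  assumes "orient v w \<noteq> 0"
  shows "x = (orient x w / orient v w) *\<^sub>R v + (orient v x / orient v w) *\<^sub>R w"
proof -
  have "orient x w * v$i + orient v x * w$i = orient v w * x$i" for i
    using exhaust_2[of i] by (auto simp: orient_def algebra_simps)
  then show ?thesis using assms by (simp add: vec_eq_iff add_divide_distrib[symmetric] field_simps)
qed

text \<open>Minimality, tested against the normal vector that corresponds to \<open>\<i> dP(z) u\<close>. It
  is normal to the surface because the surface is Lagrangian.\<close>

lemma minimality:
  assumes "conformal_frame P q v w" "unit_at q u"
  shows "Im (hprod ((ddP q v v + ddP q w w) *v u) (dP q z *v u)) = 0"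
proof -
  define k where "k = \<i> *s (dP q z *v u)"
  define \<xi> where "\<xi> = outer k u + outer u k"
  define r where "r = norm (dP q v)"
  have r: "r > 0" using conformal_frame_nonzero[OF assms(1)] by (simp add: r_def dP_eq_0_iff)
  have rw: "norm (dP q w) = r" and vw: "dP q v \<bullet> dP q w = 0"
    using assms(1) by (auto simp: conformal_frame_def r_def)
  have k: "hprod k u = 0" by (simp add: k_def hprod_simps dP_orthogonal[OF assms(2)])
  have tangent: "\<xi> \<in> tangent_space (orth_proj ` Grassmannian 1) (P q)"
    unfolding \<xi>_def P_eq_outer[OF assms(2)]
    by (rule tangent_space_projective[OF unit_at_norm[OF assms(2)] k])
  have normal: "\<xi> \<bullet> dP q x = 0" for x
    unfolding \<xi>_def inner_add_left inner_dP[OF assms(2)] inner_dP(2)[OF assms(2) k]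
    using lagrangian[OF assms(2)] by (simp add: k_def hprod_simps)
  let ?v = "(1/r) *\<^sub>R v" and ?w = "(1/r) *\<^sub>R w"
  have "norm (dP q ?v) = 1" "norm (dP q ?w) = 1" "dP q ?v \<bullet> dP q ?w = 0"
    using r rw vw by (simp_all add: linear_cmul[OF linear_dP] r_def[symmetric])
  then have "\<xi> \<bullet> (ddP q ?v ?v + ddP q ?w ?w) = 0"
    using P_minimal tangent normal unfolding minimal_immersion_def by blast
  then have "\<xi> \<bullet> (ddP q v v + ddP q w w) = 0"
    using r by (simp add: ddP_scale scaleR_add_right[symmetric])
  then have "Re (hprod k ((ddP q v v + ddP q w w) *v u)) + Re (hprod u ((ddP q v v + ddP q w w) *v k)) = 0"
    by (simp add: \<xi>_def inner_add_left inner_outer)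
  moreover have "ctranspose (ddP q v v + ddP q w w) = ddP q v v + ddP q w w"
    using ddP_hermitian linear_add[OF bounded_linear.linear[OF bounded_linear_ctranspose]] by simp
  then have "hprod u ((ddP q v v + ddP q w w) *v k) = hprod ((ddP q v v + ddP q w w) *v u) k"
    by (simp add: hprod_mult_vec_left)
  ultimately have "Re (hprod ((ddP q v v + ddP q w w) *v u) k) = 0"
    using Re_hprod_swap[of k] by simp
  then show ?thesis by (simp add: k_def hprod_simps)
qed

end

section \<open>The threefold covering by lifts with normalized determinant\<close>

context minimal_lagrangian
begin

definition frame_det :: "real^2 \<Rightarrow> complex^3 \<Rightarrow> complex" where
  "frame_det q u = det (columns3 u (dP q (axis 1 1) *v u) (dP q (axis 2 1) *v u))"

lemma frame_det_scale: "frame_det q (c *s u) = c ^ 3 * frame_det q u"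
  by (simp add: frame_det_def vector_scalar_commute det_columns3_scale power3_eq_cube)

lemma dP_mult_vec_add: "dP q (x + y) *v u = dP q x *v u + dP q y *v u"
  and dP_mult_vec_scale: "dP q (r *\<^sub>R x) *v u = of_real r *s (dP q x *v u)"
  by (simp_all add: linear_add[OF linear_dP] linear_cmul[OF linear_dP] matrix_vector_mult_add_rdistrib
      bounded_bilinear.scaleR_left[OF bounded_bilinear_cmatrix_vec] scaleR_eq_scale)

lemma det_frame:
  "det (columns3 u (dP q v *v u) (dP q w *v u)) = of_real (orient v w) * frame_det q u"
proof -
  have basis: "x = x$1 *\<^sub>R axis 1 1 + x$2 *\<^sub>R axis 2 1" for x :: "real^2"
    by (simp add: vec_eq_iff forall_2 axis_def)
  define a b where "a = dP q (axis 1 1) *v u" "b = dP q (axis 2 1) *v u"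
  have h: "dP q x *v u = of_real (x$1) *s a + of_real (x$2) *s b" for x
    by (subst basis) (simp add: dP_mult_vec_add dP_mult_vec_scale a_b_def)
  show ?thesis
    unfolding h[of v] h[of w] frame_det_def a_b_def[symmetric]
    by (simp add: det_columns3 orient_def algebra_simps)
qed

text \<open>By the Lagrangian condition, the Gram matrix of the horizontal vectors is the real matrix of
  \<open>G\<close>.\<close>

lemma norm_frame_det:
  assumes "P q *v u = u"
  shows "cmod (frame_det q u) = (norm u) ^ 3 * area q"
proof (cases "u = 0")
  case True
  then show ?thesis by (simp add: frame_det_def det_columns3)
next
  case False
  define z where "z = of_real (1 / norm u) *s u"
  have u: "u = of_real (norm u) *s z" using False by (simp add: z_def)
  have z: "unit_at q z"
    using assms False by (intro unit_atI) (auto simp: z_def norm_scale vector_scalar_commute norm_divide)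
  have "complex_of_real ((cmod (frame_det q z))\<^sup>2) = of_real (gram q)"
    unfolding frame_det_def
    by (subst norm_det_columns3)
      (simp_all add: unit_at_hprod[OF z] dP_orthogonal[OF z] hprod_dP[OF z] gram_def
        G_symmetric[of q "axis 2 1" "axis 1 1"] power2_eq_square)
  then have "(cmod (frame_det q z))\<^sup>2 = (area q)\<^sup>2"
    unfolding area_squared by (simp only: of_real_eq_iff)
  then have "cmod (frame_det q z) = area q"
    using area_positive[of q] by (simp add: power2_eq_iff_nonneg less_imp_le)
  then show ?thesis
    by (subst u) (simp add: frame_det_scale norm_mult norm_power)
qed

text \<open>The unit vectors of the line \<open>\<phi> q\<close> whose horizontal frame has determinant
  \<open>\<i>\<close> times its area. They form an orbit of the cube roots of unity. The factor \<open>\<i>\<close> is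
  the phase for which the flag lift becomes primitive.\<close>

definition lifts :: "real^2 \<Rightarrow> complex^3 \<Rightarrow> bool" where
  "lifts q u \<longleftrightarrow> unit_at q u \<and> frame_det q u = \<i> * of_real (area q)"

text \<open>The length is determined by the modulus of the determinant.\<close>

lemma liftsI:
  assumes "P q *v u = u" "frame_det q u = \<i> * of_real (area q)"
  shows "lifts q u"
proof -
  have "(norm u) ^ 3 * area q = 1 ^ 3 * area q"
    using norm_frame_det[OF assms(1)] area_positive[of q] by (simp add: assms(2) norm_mult)
  then have "(norm u) ^ 3 = 1 ^ 3" using area_positive[of q] by simp
  then have "norm u = 1" by (rule power_eq_imp_eq_base) auto
  then show ?thesis using assms unit_atI by (simp add: lifts_def)
qed

lemma lifts_scale: "lifts q u \<Longrightarrow> c ^ 3 = 1 \<Longrightarrow> lifts q (c *s u)"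
  unfolding lifts_def
  using unit_at_scale[of q u c] power_eq_1_iff[of c 3] by (auto simp: frame_det_scale)

lemma lifts_eq_scale:
  assumes "lifts q u" "lifts q u'"
  shows "u' = hprod u' u *s u" "(hprod u' u) ^ 3 = 1"
proof -
  show u': "u' = hprod u' u *s u"
    using P_fixes[of q u'] P_eq_outer[of q u] assms by (simp add: lifts_def outer_mult_vec)
  have "\<i> * of_real (area q) = frame_det q (hprod u' u *s u)"
    using assms(2) u' by (simp add: lifts_def)
  then have "\<i> * of_real (area q) = (hprod u' u) ^ 3 * (\<i> * of_real (area q))"
    using assms(1) unfolding frame_det_scale lifts_def by simp
  then show "(hprod u' u) ^ 3 = 1" using area_positive[of q] by simp
qed

lemma lifts_ex: "\<exists>u. lifts q u"
proof -
  obtain u where u: "unit_at q u" using unit_at_ex by blast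
  define z where "z = \<i> * of_real (area q) / frame_det q u"
  have "cmod (frame_det q u) = area q"
    using norm_frame_det[OF P_fixes[OF u]] unit_at_norm[OF u] by simp
  then have fd: "frame_det q u \<noteq> 0" and z: "z \<noteq> 0"
    using area_positive[of q] by (auto simp: z_def)
  define c where "c = exp (Ln z / 3)"
  have "c ^ 3 = z" using z unfolding c_def by (subst exp_of_nat_mult[symmetric]) simp
  then have "frame_det q (c *s u) = \<i> * of_real (area q)"
    using fd by (simp add: frame_det_scale z_def)
  moreover have "P q *v (c *s u) = c *s u" by (simp add: vector_scalar_commute P_fixes[OF u])
  ultimately show ?thesis using liftsI by blast
qed

text \<open>Project the given vector to the nearby lines and correct the phase by the branch of the
  cube root near \<open>1\<close>.\<close>

lemma local_lift:
  assumes "lifts q0 u0"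
  obtains T \<sigma> where "open T" "q0 \<in> T" "\<sigma> q0 = u0" "\<And>q. q \<in> T \<Longrightarrow> lifts q (\<sigma> q)"
    "\<And>q. q \<in> T \<Longrightarrow> \<sigma> differentiable (at q)"
proof -
  have fixed: "P q0 *v u0 = u0" using assms P_fixes by (simp add: lifts_def)
  define s where "s = (\<lambda>q. P q *v u0)"
  \<comment> \<open>the quotient of the determinant of \<open>s\<close> by the prescribed value; it is \<open>1\<close> at \<open>q0\<close>\<close>
  define r where "r = (\<lambda>q. frame_det q (s q) * (- \<i> * of_real (inverse (area q))))"
  define T where "T = {q. Re (r q) > 0}"
  define \<sigma> where "\<sigma> = (\<lambda>q. exp (- Ln (r q) / 3) *s s q)"
  have smooth_vec: "smooth_on UNIV (\<lambda>q. A q *v b q)" if "smooth_on UNIV A" "smooth_on UNIV b"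
    for A :: "real^2 \<Rightarrow> complex^3^3" and b
    using smooth_on_bounded_bilinear[OF open_UNIV bounded_bilinear_cmatrix_vec that] .
  have smooth_s: "smooth_on UNIV s"
    unfolding s_def by (intro smooth_vec smooth_P smooth_on_const open_UNIV)
  have s_diff: "s differentiable (at q)" for q
    using smooth_on_has_derivative[OF smooth_s] differentiableI by blast
  have r_diff: "r differentiable (at q)" for q
  proof -
    have "(\<lambda>q. frame_det q (s q)) differentiable (at q)"
      unfolding frame_det_def
      by (rule differentiableI, rule has_derivative_det_columns3)
        (rule smooth_on_has_derivative[OF _ UNIV_I],
          intro smooth_s smooth_vec smooth_on_dirderiv smooth_P)+
    moreover have "(\<lambda>q. - \<i> * complex_of_real (inverse (area q))) differentiable (at q)"
      by (rule differentiableI, rule smooth_on_has_derivative[OF _ UNIV_I],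
          intro smooth_on_bounded_linear[OF open_UNIV bounded_linear_mult_right]
            smooth_on_bounded_linear[OF open_UNIV bounded_linear_of_real] smooth_inverse_area)
    ultimately show ?thesis unfolding r_def by (rule differentiable_mult)
  qed
  have r0: "r q0 = 1"
    using assms area_positive[of q0] by (simp add: r_def s_def fixed lifts_def field_simps)
  have "continuous_on UNIV r"
    using r_diff differentiable_imp_continuous_within continuous_at_imp_continuous_on by blast
  then have "open T"
    unfolding T_def by (intro open_Collect_less continuous_intros)
  moreover have "q0 \<in> T" by (simp add: T_def r0)
  moreover have "\<sigma> q0 = u0" by (simp add: \<sigma>_def r0 s_def fixed)
  moreover have "lifts q (\<sigma> q)" if "q \<in> T" for q
  proof (rule liftsI)
    have "P q *v s q = s q" by (simp add: s_def matrix_vector_mul_assoc P_idempotent)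
    then show "P q *v \<sigma> q = \<sigma> q" by (simp add: \<sigma>_def vector_scalar_commute)
    have "r q \<noteq> 0" using that by (auto simp: T_def)
    then have "exp (- Ln (r q) / 3) ^ 3 = inverse (r q)"
      by (subst exp_of_nat_mult[symmetric]) (simp add: exp_minus)
    moreover have "frame_det q (s q) = r q * (\<i> * of_real (area q))"
      using area_positive[of q] by (simp add: r_def field_simps)
    ultimately show "frame_det q (\<sigma> q) = \<i> * of_real (area q)"
      using \<open>r q \<noteq> 0\<close> by (simp add: \<sigma>_def frame_det_scale)
  qed
  moreover have "\<sigma> differentiable (at q)" if "q \<in> T" for q
  proof -
    have "r q \<notin> \<real>\<^sub>\<le>\<^sub>0" using that by (auto simp: T_def complex_nonpos_Reals_iff)
    then have "((\<lambda>z. exp (- Ln z / 3)) has_field_derivative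
        (exp (- Ln (r q) / 3) * (- inverse (r q) / 3))) (at (r q))"
      by (auto intro!: derivative_eq_intros)
    moreover have "(r has_derivative dirderiv r q) (at q)"
      by (rule has_derivative_dirderiv[OF r_diff])
    ultimately have "((\<lambda>q. exp (- Ln (r q) / 3)) has_derivative
        (\<lambda>x. (exp (- Ln (r q) / 3) * (- inverse (r q) / 3)) * dirderiv r q x)) (at q)"
      unfolding has_field_derivative_def by (rule has_derivative_compose[rotated])
    from bounded_bilinear.FDERIV[OF bounded_bilinear_scale this has_derivative_dirderiv[OF s_diff]]
    show ?thesis unfolding \<sigma>_def by (rule differentiableI)
  qed
  ultimately show ?thesis using that by blast
qed

definition lift_space :: "((real^2) \<times> (complex^3)) set" where
  "lift_space = {(q, u). lifts q u}"

text \<open>Over the domain of a local lift \<open>\<sigma>\<close>, the sheets are the graphs of \<open>c \<sigma>\<close> for the cube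
  roots of unity \<open>c\<close>. They are open because they are separated by more than a unit distance.\<close>

lemma covering_lift_space: "covering_space lift_space fst (UNIV :: (real^2) set)"
  unfolding covering_space_def
proof (intro conjI ballI)
  show "continuous_on lift_space fst" by (intro continuous_intros)
  show "fst ` lift_space = UNIV" using lifts_ex by (force simp: lift_space_def)
next
  fix q0 :: "real^2"
  obtain u0 where "lifts q0 u0" using lifts_ex by blast
  then obtain T \<sigma> where T: "open T" "q0 \<in> T" "\<And>q. q \<in> T \<Longrightarrow> lifts q (\<sigma> q)"
    and diff: "\<And>q. q \<in> T \<Longrightarrow> \<sigma> differentiable (at q)" using local_lift by metis
  have \<sigma>_cont: "continuous_on T \<sigma>"
    using diff by (intro continuous_at_imp_continuous_on ballI differentiable_imp_continuous_within)
  have \<sigma>_norm: "norm (\<sigma> q) = 1" if "q \<in> T" for q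
    using unit_at_norm[of q "\<sigma> q"] T(3)[OF that] by (simp add: lifts_def)
  define S where "S = (\<lambda>c. (\<lambda>q. (q, c *s \<sigma> q)) ` T)"
  let ?V = "S ` {c. c ^ 3 = 1}"
  have inj: "c = d" if "c *s \<sigma> q = d *s \<sigma> q" "q \<in> T" for c d q
  proof -
    have "(c - d) *s \<sigma> q = 0" using that(1) by (simp add: vector_sub_rdistrib)
    then show ?thesis using \<sigma>_norm[OF that(2)] by auto
  qed
  have union: "\<Union>?V = lift_space \<inter> fst -` T"
  proof (intro equalityI subsetI)
    fix x assume "x \<in> lift_space \<inter> fst -` T"
    then obtain q u where x: "x = (q, u)" "lifts q u" "q \<in> T"
      by (cases x) (auto simp: lift_space_def)
    have "u = hprod u (\<sigma> q) *s \<sigma> q" "hprod u (\<sigma> q) ^ 3 = 1"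
      using lifts_eq_scale[OF T(3)[OF x(3)] x(2)] by auto
    then show "x \<in> \<Union>?V" using x unfolding S_def by blast
  qed (use T(3) lifts_scale in \<open>auto simp: S_def lift_space_def\<close>)
  have "openin (top_of_set lift_space) (S c)" if "c ^ 3 = 1" for c
  proof -
    let ?O = "{x \<in> T \<times> UNIV. norm (snd x - c *s \<sigma> (fst x)) < 1}"
    have "continuous_on (T \<times> UNIV) (\<lambda>x. \<sigma> (fst x))"
      by (rule continuous_on_compose2[OF \<sigma>_cont]) (auto intro: continuous_intros)
    then have "continuous_on (T \<times> UNIV) (\<lambda>x. norm (snd x - c *s \<sigma> (fst x)))"
      by (intro continuous_intros bounded_bilinear.continuous_on[OF bounded_bilinear_scale])
    from continuous_open_preimage[OF this, of "{..<1}"] T(1)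
    have "open ?O" by (simp add: open_Times vimage_def Int_def)
    moreover have "S c = lift_space \<inter> ?O"
    proof (intro equalityI subsetI)
      fix x assume "x \<in> lift_space \<inter> ?O"
      then have x: "fst x \<in> T" "x \<in> lift_space" "norm (snd x - c *s \<sigma> (fst x)) < 1" by auto
      then have "x \<in> \<Union>?V" using union by auto
      then obtain d q where d: "d ^ 3 = 1" "q \<in> T" "x = (q, d *s \<sigma> q)" unfolding S_def by auto
      then have "norm ((d - c) *s \<sigma> q) < 1" using x(3) by (simp add: vector_sub_rdistrib)
      then have "cmod (d - c) < 1"
        unfolding norm_scale \<sigma>_norm[OF d(2)] by (simp only: mult_1_right)
      then have "d = c" using cube_roots_of_unity_apart d(1) that by blast
      then show "x \<in> S c" using d by (auto simp: S_def)
    qed (use T(3) lifts_scale that in \<open>auto simp: S_def lift_space_def\<close>)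
    ultimately show ?thesis by (auto simp: openin_open)
  qed
  moreover have "pairwise disjnt ?V"
    unfolding pairwise_def disjnt_def S_def using inj by fastforce
  moreover have "\<exists>g. homeomorphism (S c) T fst g" for c
  proof
    show "homeomorphism (S c) T fst (\<lambda>q. (q, c *s \<sigma> q))"
      by (rule homeomorphismI)
        (auto simp: S_def intro!: continuous_intros \<sigma>_cont
          bounded_bilinear.continuous_on[OF bounded_bilinear_scale])
  qed
  ultimately show "\<exists>T. q0 \<in> T \<and> openin (top_of_set UNIV) T \<and> (\<exists>v. \<Union>v = lift_space \<inter> fst -` T \<and>
      (\<forall>u\<in>v. openin (top_of_set lift_space) u) \<and> pairwise disjnt v \<and>
      (\<forall>u\<in>v. \<exists>g. homeomorphism u T fst g))"
    using T(1,2) union by (intro exI[of _ T] conjI exI[of _ ?V]) auto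
qed

lemma continuous_lift_ex: "\<exists>f. continuous_on UNIV f \<and> (\<forall>q. lifts q (f q))"
proof -
  have "simply_connected (UNIV :: (real^2) set)" "locally path_connected (UNIV :: (real^2) set)"
    by (auto intro: convex_imp_simply_connected convex_imp_locally_path_connected)
  from covering_space_lift[OF covering_lift_space this, of "\<lambda>q. q"]
  obtain g where g: "continuous_on UNIV g" "g \<in> UNIV \<rightarrow> lift_space" "\<And>q. fst (g q) = q" by auto
  have "lifts q (snd (g q))" for q
  proof -
    have "g q \<in> lift_space" using g(2) by blast
    then show ?thesis using g(3)[of q] by (cases "g q") (simp add: lift_space_def)
  qed
  then show ?thesis using g(1) by (intro exI[of _ "\<lambda>q. snd (g q)"]) (auto intro: continuous_intros)
qed

end

section \<open>The normalized lift is horizontal\<close>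

locale normalized_lift = minimal_lagrangian +
  fixes f :: "real^2 \<Rightarrow> complex^3"
  assumes f_continuous: "continuous_on UNIV f" and f_lifts: "lifts q (f q)"
begin

lemma f_unit_at: "unit_at q (f q)"
  using f_lifts by (simp add: lifts_def)

abbreviation hor :: "real^2 \<Rightarrow> real^2 \<Rightarrow> complex^3" where
  "hor q x \<equiv> dP q x *v f q"

lemmas f_hprod = unit_at_hprod[OF f_unit_at]
  and f_norm = unit_at_norm[OF f_unit_at]
  and P_f = P_eq_outer[OF f_unit_at]
  and P_fixes_f = P_fixes[OF f_unit_at]
  and hor_orthogonal = dP_orthogonal[OF f_unit_at]
  and hprod_hor = hprod_dP[OF f_unit_at]

text \<open>By continuity, \<open>f\<close> agrees near \<open>q0\<close> with the differentiable local lift through the same point.\<close>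

lemma f_differentiable: "f differentiable (at q0)"
proof -
  obtain T \<sigma> where T: "open T" "q0 \<in> T" "\<sigma> q0 = f q0" "\<And>q. q \<in> T \<Longrightarrow> lifts q (\<sigma> q)"
    and diff: "\<And>q. q \<in> T \<Longrightarrow> \<sigma> differentiable (at q)" using local_lift[OF f_lifts] by metis
  have "continuous_on T (\<lambda>q. norm (f q - \<sigma> q))"
    using diff by (intro continuous_intros continuous_on_subset[OF f_continuous]
        continuous_at_imp_continuous_on ballI differentiable_imp_continuous_within) auto
  from continuous_open_preimage[OF this T(1), of "{..<1}"]
  have O: "open {q \<in> T. norm (f q - \<sigma> q) < 1}" by (simp add: vimage_def Int_def)
  have eq: "\<sigma> q = f q" if "q \<in> {q \<in> T. norm (f q - \<sigma> q) < 1}" for q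
  proof -
    let ?c = "hprod (f q) (\<sigma> q)"
    have c: "f q = ?c *s \<sigma> q" "?c ^ 3 = 1"
      using lifts_eq_scale[OF T(4) f_lifts] that by auto
    then have "norm ((?c - 1) *s \<sigma> q) < 1" using that by (simp add: vector_sub_rdistrib)
    moreover have "norm (\<sigma> q) = 1"
      using unit_at_norm[of q "\<sigma> q"] T(4)[of q] that by (simp add: lifts_def)
    ultimately have "cmod (?c - 1) < 1" unfolding norm_scale by (simp only: mult_1_right)
    then have "?c = 1" using c(2) cube_roots_of_unity_apart[of ?c 1] by simp
    then show ?thesis using c(1) by simp
  qed
  have "q0 \<in> {q \<in> T. norm (f q - \<sigma> q) < 1}" using T(2,3) by simp
  from has_derivative_transform_within_open[OF has_derivative_dirderiv[OF diff[OF T(2)]] O this eq]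
  have "(f has_derivative dirderiv \<sigma> q0) (at q0)" .
  then show ?thesis by (rule differentiableI)
qed

lemma f_has_derivative: "(f has_derivative dirderiv f q) (at q)"
  by (rule has_derivative_dirderiv[OF f_differentiable])

lemma hor_has_derivative:
  "((\<lambda>q. hor q y) has_derivative (\<lambda>x. dP p y *v dirderiv f p x + ddP p y x *v f p)) (at p)"
  using bounded_bilinear.FDERIV[OF bounded_bilinear_cmatrix_vec
      dP_has_derivative[where q = p and x = y] f_has_derivative[where q = p]] .

text \<open>As \<open>f\<close> has unit length, its connection form is purely imaginary, and \<open>conn\<close> is its imaginary part.\<close>

definition conn :: "real^2 \<Rightarrow> real^2 \<Rightarrow> real" where
  "conn q x = Im (hprod (dirderiv f q x) (f q))"

text \<open>For a horizontal lift, this is the second fundamental form \<open>D\<^sub>xD\<^sub>yf \<bullet> \<i> D\<^sub>zf\<close>. Defined by \<open>P\<close>,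
  it is available before \<open>f\<close> is known to be horizontal.\<close>

definition cubic :: "real^2 \<Rightarrow> real^2 \<Rightarrow> real^2 \<Rightarrow> real^2 \<Rightarrow> real" where
  "cubic q x y z = Im (hprod (ddP q x y *v f q) (hor q z))"

lemma hprod_df: "hprod (dirderiv f q x) (f q) = \<i> * of_real (conn q x)"
proof -
  have "((\<lambda>q. hprod (f q) (f q)) has_derivative
      (\<lambda>x. hprod (f q) (dirderiv f q x) + hprod (dirderiv f q x) (f q))) (at q)"
    by (rule bounded_bilinear.FDERIV[OF bounded_bilinear_hprod f_has_derivative f_has_derivative])
  then have "((\<lambda>q. 1) has_derivative
      (\<lambda>x. hprod (f q) (dirderiv f q x) + hprod (dirderiv f q x) (f q))) (at q)"
    unfolding f_hprod .
  from has_derivative_unique[OF this has_derivative_const]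
  have "hprod (f q) (dirderiv f q x) + hprod (dirderiv f q x) (f q) = 0" by meson
  then have "Re (hprod (f q) (dirderiv f q x)) + Re (hprod (dirderiv f q x) (f q)) = 0"
    by (metis plus_complex.sel(1) zero_complex.sel(1))
  then have "Re (hprod (dirderiv f q x) (f q)) = 0"
    using Re_hprod_swap[of "f q" "dirderiv f q x"] by linarith
  then show ?thesis by (simp add: complex_eq_iff conn_def)
qed

lemma df_eq: "dirderiv f q x = hor q x + (\<i> * of_real (conn q x)) *s f q"
proof -
  have "((\<lambda>q. P q *v f q) has_derivative (\<lambda>x. P q *v dirderiv f q x + dP q x *v f q)) (at q)"
    by (rule bounded_bilinear.FDERIV[OF bounded_bilinear_cmatrix_vec P_has_derivative f_has_derivative])
  then have "(f has_derivative (\<lambda>x. P q *v dirderiv f q x + dP q x *v f q)) (at q)"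
    unfolding P_fixes_f .
  then have "dirderiv f q x = P q *v dirderiv f q x + dP q x *v f q"
    by (rule dirderiv_eqI)
  also have "P q *v dirderiv f q x = (\<i> * of_real (conn q x)) *s f q"
    by (simp add: P_f outer_mult_vec hprod_df)
  finally show ?thesis by (simp add: add.commute)
qed

lemma hprod_derivative_hor:
  "hprod (dP q y *v dirderiv f q x + ddP q y x *v f q) (hor q z)
    = hprod (ddP q x y *v f q) (hor q z) + \<i> * of_real (conn q x * G q y z)"
proof -
  have "dP q y *v hor q x = of_real (G q x y) *s f q"
    by (subst dP_mult_vec[OF f_unit_at]) (simp add: hor_orthogonal hprod_hor)
  moreover have "hprod (f q) (hor q z) = 0" using hor_orthogonal hprod_eq_0_swap by blast
  ultimately show ?thesis
    unfolding df_eq ddP_symmetric[where q = q and x = y and y = x]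
    by (simp add: matrix_vector_right_distrib vector_scalar_commute hprod_simps hprod_hor)
qed

text \<open>The second symmetry is the derivative of the Lagrangian condition; the contributions of the
  connection form cancel.\<close>

lemma cubic_symmetric: "cubic q x y z = cubic q y x z" "cubic q x y z = cubic q x z y"
proof -
  show "cubic q x y z = cubic q y x z" by (simp add: cubic_def ddP_symmetric[where q = q and x = x and y = y])
  let ?D = "\<lambda>y. dP q y *v dirderiv f q x + ddP q y x *v f q"
  have "((\<lambda>q. hprod (hor q y) (hor q z)) has_derivative
      (\<lambda>x. hprod (hor q y) (dP q z *v dirderiv f q x + ddP q z x *v f q)
        + hprod (dP q y *v dirderiv f q x + ddP q y x *v f q) (hor q z))) (at q)"
    by (rule bounded_bilinear.FDERIV[OF bounded_bilinear_hprod hor_has_derivative hor_has_derivative])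
  from bounded_linear.has_derivative[OF bounded_linear_Im this]
  have "((\<lambda>q. 0) has_derivative
      (\<lambda>x. Im (hprod (hor q y) (dP q z *v dirderiv f q x + ddP q z x *v f q)
        + hprod (dP q y *v dirderiv f q x + ddP q y x *v f q) (hor q z)))) (at q)"
    by (simp add: lagrangian[OF f_unit_at])
  from has_derivative_unique[OF this has_derivative_const]
  have "Im (hprod (hor q y) (?D z) + hprod (?D y) (hor q z)) = 0" by meson
  then have "Im (hprod (?D y) (hor q z)) = Im (hprod (?D z) (hor q y))"
    using Im_hprod_swap[of "hor q y" "?D z"] by simp
  then show "cubic q x y z = cubic q x z y"
    unfolding hprod_derivative_hor using G_symmetric[of q y z] by (simp add: cubic_def)
qed

lemma cubic_trace:
  assumes "conformal_frame P q v w"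
  shows "cubic q v v x + cubic q w w x = 0"
  using minimality[OF assms f_unit_at, of x]
  by (simp add: cubic_def matrix_vector_mult_add_rdistrib hprod_simps)

text \<open>The determinant of the frame \<open>f, dP(v) f, dP(w) f\<close> has constant phase. The imaginary part
  of its logarithmic derivative is three times the connection form plus the trace of the cubic form,
  which vanishes by minimality.\<close>

lemma conn_zero: "conn p x = 0"
proof -
  obtain v w where vw: "conformal_frame P p v w" using conformal_frame_ex by blast
  define \<rho> where "\<rho> = sqrt (G p v v)"
  have \<rho>: "\<rho> > 0" "\<rho>\<^sup>2 = G p v v" using conformal_frame_nonzero[OF vw] by (simp_all add: \<rho>_def)
  let ?a = "hor p v" and ?b = "hor p w"
  let ?D = "\<lambda>y x. dP p y *v dirderiv f p x + ddP p y x *v f p"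
  let ?K = "orient v w * area p"
  have K: "?K > 0" using vw area_positive[of p] by (simp add: conformal_frame_G)
  have det: "det (columns3 (f q) (hor q v) (hor q w)) = \<i> * of_real (orient v w * area q)" for q
    using f_lifts[of q] by (simp add: det_frame lifts_def)
  have norms: "hprod ?a ?a = of_real (\<rho>\<^sup>2)" "hprod ?b ?b = of_real (\<rho>\<^sup>2)" "hprod ?a ?b = 0"
    using vw by (simp_all add: hprod_hor \<rho>(2) conformal_frame_G)
  note replace = det_columns3_orthogonal_replace[OF f_hprod hor_orthogonal hor_orthogonal norms(3,1,2) \<rho>(1)]
  have "((\<lambda>q. det (columns3 (f q) (hor q v) (hor q w))) has_derivative
      (\<lambda>x. det (columns3 (dirderiv f p x) ?a ?b) + det (columns3 (f p) (?D v x) ?b)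
         + det (columns3 (f p) ?a (?D w x)))) (at p)"
    by (rule has_derivative_det_columns3[OF f_has_derivative hor_has_derivative hor_has_derivative])
  from bounded_linear.has_derivative[OF bounded_linear_Re this]
  have "((\<lambda>q. 0) has_derivative
      (\<lambda>x. Re (det (columns3 (dirderiv f p x) ?a ?b) + det (columns3 (f p) (?D v x) ?b)
         + det (columns3 (f p) ?a (?D w x))))) (at p)"
    by (simp add: det)
  from has_derivative_unique[OF this has_derivative_const]
  have "Re (det (columns3 (dirderiv f p x) ?a ?b) + det (columns3 (f p) (?D v x) ?b)
         + det (columns3 (f p) ?a (?D w x))) = 0" by meson
  then have "?K * Im (hprod (dirderiv f p x) (f p) + hprod (?D v x) ?a / of_real (\<rho>\<^sup>2)
      + hprod (?D w x) ?b / of_real (\<rho>\<^sup>2)) = 0"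
    unfolding replace(1)[of "dirderiv f p x"] replace(2)[of "?D v x"] replace(3)[of "?D w x"] det
    by (simp add: algebra_simps)
  then have "Im (hprod (dirderiv f p x) (f p) + hprod (?D v x) ?a / of_real (\<rho>\<^sup>2)
      + hprod (?D w x) ?b / of_real (\<rho>\<^sup>2)) = 0"
    using K mult_eq_0_iff less_irrefl by metis
  moreover have "Im (z / of_real (\<rho>\<^sup>2)) = Im z / \<rho>\<^sup>2" for z by (rule Im_divide_of_real)
  ultimately have "conn p x + Im (hprod (?D v x) ?a) / \<rho>\<^sup>2 + Im (hprod (?D w x) ?b) / \<rho>\<^sup>2 = 0"
    by (simp add: conn_def)
  then have "conn p x + (cubic p x v v + conn p x * \<rho>\<^sup>2) / \<rho>\<^sup>2 + (cubic p x w w + conn p x * \<rho>\<^sup>2) / \<rho>\<^sup>2 = 0"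
    unfolding hprod_derivative_hor using vw by (simp add: cubic_def[symmetric] \<rho>(2) conformal_frame_G)
  moreover have "cubic p x v v + cubic p x w w = 0"
    using cubic_trace[OF vw, of x] cubic_symmetric by metis
  then have "cubic p x v v / \<rho>\<^sup>2 + cubic p x w w / \<rho>\<^sup>2 = 0"
    by (simp add: add_divide_distrib[symmetric])
  ultimately show ?thesis using \<rho>(1) by (simp add: add_divide_distrib)
qed

lemma df: "dirderiv f q x = hor q x"
  using df_eq[of q x] conn_zero by simp

text \<open>The equation \<open>df = dP f\<close> improves the regularity of \<open>f\<close> step by step.\<close>

lemma smooth_f: "smooth_on UNIV f"
proof -
  have "Ck_on k UNIV f" for k
  proof (induction k)
    case 0
    then show ?case using f_continuous by simp
  next
    case (Suc k)
    show ?case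
    proof (rule Ck_on_SucI[OF open_UNIV f_has_derivative])
      fix v
      have "Ck_on k UNIV (\<lambda>p. dP p v)"
        using smooth_on_dirderiv[OF smooth_P] by (simp add: smooth_on_def)
      from Ck_on_bounded_bilinear[OF open_UNIV bounded_bilinear_cmatrix_vec this Suc]
      show "Ck_on k UNIV (\<lambda>p. dirderiv f p v)" by (simp add: df)
    qed
  qed
  then show ?thesis by (simp add: smooth_on_def)
qed

end

lemma (in minimal_lagrangian) normalized_lift_ex: "\<exists>f. normalized_lift \<Lambda> \<phi> f"
  using continuous_lift_ex minimal_lagrangian_axioms
  by (auto simp: normalized_lift_def normalized_lift_axioms_def)

section \<open>The Legendrian lift and the special Lagrangian cone\<close>

lemma tangent_space_sphere:
  assumes "\<xi> \<in> tangent_space (sphere 0 1) (x :: 'b::real_inner)"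
  shows "\<xi> \<bullet> x = 0"
proof -
  obtain \<gamma> where \<gamma>: "\<And>t::real. \<gamma> t \<in> sphere 0 1" "\<gamma> 0 = x" "(\<gamma> has_vector_derivative \<xi>) (at 0)"
    using assms by (auto simp: tangent_space_def)
  have "((\<lambda>t. \<gamma> t \<bullet> \<gamma> t) has_vector_derivative (\<gamma> 0 \<bullet> \<xi> + \<xi> \<bullet> \<gamma> 0)) (at 0)"
    by (rule bounded_bilinear.has_vector_derivative[OF bounded_bilinear_inner \<gamma>(3) \<gamma>(3)])
  moreover have "\<gamma> t \<bullet> \<gamma> t = 1" for t using \<gamma>(1)[of t] by (simp add: dot_square_norm)
  ultimately have "((\<lambda>t. 1::real) has_vector_derivative (\<gamma> 0 \<bullet> \<xi> + \<xi> \<bullet> \<gamma> 0)) (at 0)" by simp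
  from vector_derivative_unique_at[OF this has_vector_derivative_const]
  show ?thesis using \<gamma>(2) by (simp add: inner_commute)
qed

context normalized_lift
begin

lemma hor_eq_0_iff: "hor q x = 0 \<longleftrightarrow> x = 0"
proof
  assume "hor q x = 0"
  then have "G q x x = 0" using hprod_hor[of q x x] by (simp add: hprod_simps)
  then show "x = 0" using G_positive[of x q] by force
qed (simp add: linear_0[OF linear_dP])

lemma hor_inj: "hor q x = hor q y \<Longrightarrow> x = y"
  using hor_eq_0_iff[of q "x - y"]
  by (simp add: linear_diff[OF linear_dP] matrix_vector_mult_diff_rdistrib)

lemma f_immersion: "immersion_on UNIV f"
  unfolding immersion_on_def using smooth_f hor_inj by (auto simp: df inj_def)

lemma f_horizontal_lift: "horizontal_lift \<phi> f"
  unfolding horizontal_lift_def contact_distribution_def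
  using smooth_f f_norm f_unit_at by (auto simp: df hor_orthogonal unit_at_def)

lemma ddf: "dirderiv (\<lambda>q. dirderiv f q y) p x = of_real (G p x y) *s f p + ddP p y x *v f p"
proof -
  have "dirderiv (\<lambda>q. dirderiv f q y) p x = dP p y *v dirderiv f p x + ddP p y x *v f p"
    unfolding df using dirderiv_eqI[OF hor_has_derivative[of y p], of x] by (simp add: df)
  also have "dP p y *v dirderiv f p x = of_real (G p x y) *s f p"
    unfolding df by (subst dP_mult_vec[OF f_unit_at]) (simp add: hor_orthogonal hprod_hor)
  finally show ?thesis .
qed

lemma hprod_f_hor: "hprod (f q) (hor q x) = 0"
  using hor_orthogonal hprod_eq_0_swap by blast

text \<open>Both sides are the area of the parallelogram of \<open>v\<close> and \<open>w\<close>.\<close>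

lemma orient_area:
  assumes "G p v v = r" "G p w w = r" "G p v w = 0" "r > 0"
  shows "\<bar>orient v w\<bar> * area p = r"
proof -
  have "of_real ((cmod (det (columns3 (f p) (hor p v) (hor p w))))\<^sup>2) = complex_of_real (r\<^sup>2)"
    by (subst norm_det_columns3)
      (simp_all add: f_hprod hor_orthogonal hprod_hor assms G_symmetric[of p w v] power2_eq_square)
  moreover have "cmod (det (columns3 (f p) (hor p v) (hor p w))) = \<bar>orient v w\<bar> * area p"
    using f_lifts[of p] area_positive[of p] by (simp add: det_frame lifts_def norm_mult)
  ultimately have "(\<bar>orient v w\<bar> * area p)\<^sup>2 = r\<^sup>2" by (simp only: of_real_eq_iff)
  then show ?thesis
    using assms(4) area_positive[of p] by (simp add: power2_eq_iff_nonneg)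
qed

text \<open>A normal vector of \<open>f\<close> in the sphere is a real combination of \<open>\<i> df(v)\<close>,
  \<open>\<i> df(w)\<close> and \<open>\<i> f\<close>; the first two components of the mean curvature are traces of the
  cubic form, and the third one vanishes because \<open>f\<close> is horizontal.\<close>

lemma f_minimal_legendrian: "minimal_legendrian f"
  unfolding minimal_legendrian_def minimal_immersion_def contact_distribution_def
proof (intro conjI allI ballI impI)
  show "immersion_on UNIV f" by (rule f_immersion)
  show "range f \<subseteq> sphere 0 1" using f_norm by auto
  show "dirderiv f p v \<in> {h. hprod h (f p) = 0}" for p v by (simp add: df hor_orthogonal)
  fix p \<xi> v w
  assume \<xi>: "\<xi> \<in> tangent_space (sphere 0 1) (f p)" "\<forall>u. \<xi> \<bullet> dirderiv f p u = 0"
    and vw: "norm (dirderiv f p v) = 1 \<and> norm (dirderiv f p w) = 1 \<and> dirderiv f p v \<bullet> dirderiv f p w = 0"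
  let ?a = "hor p v" and ?b = "hor p w"
  have G: "G p v v = 1" "G p w w = 1" "G p v w = 0"
    using vw by (auto simp: df G_eq_Re[OF f_unit_at] Re_hprod dot_square_norm)
  then have "\<bar>orient v w\<bar> * area p = 1" by (intro orient_area) auto
  then have "orient v w \<noteq> 0" by auto
  moreover have "orient w v = - orient v w" by (simp add: orient_def)
  ultimately have "conformal_frame P p v w \<or> conformal_frame P p w v"
    using G G_symmetric[of p v w] unfolding conformal_frame_G by auto
  then have trace: "cubic p v v x + cubic p w w x = 0" for x
    using cubic_trace[of p v w x] cubic_trace[of p w v x] by auto
  define T where "T = dirderiv (\<lambda>q. dirderiv f q v) p v + dirderiv (\<lambda>q. dirderiv f q w) p w"
  have T: "T = 2 *s f p + (ddP p v v *v f p + ddP p w w *v f p)"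
  proof -
    have "2 *s f p = f p + f p" by (simp add: vec_eq_iff)
    then show ?thesis unfolding T_def ddf G by (simp add: algebra_simps)
  qed
  have "Im (hprod T (hor p x)) = 0" for x
    unfolding T using trace[of x] by (simp add: hprod_simps hprod_f_hor cubic_def)
  moreover have "Im (hprod T (f p)) = 0"
  proof -
    have "Im (hprod (ddP p x x *v f p) (f p)) = 0" for x
      using hprod_mult_vec_left[of "ddP p x x" "f p" "f p"] Im_hprod_swap[of "f p" "ddP p x x *v f p"]
      by (simp add: ddP_hermitian)
    then show ?thesis unfolding T by (simp add: hprod_simps f_hprod)
  qed
  ultimately have real: "hprod T (hor p x) = of_real (Re (hprod T (hor p x)))"
      "hprod T (f p) = of_real (Re (hprod T (f p)))" for x
    by (simp_all add: complex_eq_iff)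
  have "unitary_frame (f p) ?a ?b"
    by (simp add: unitary_frame_def f_hprod hprod_f_hor hprod_hor G)
  then have "T = hprod T (f p) *s f p + hprod T ?a *s ?a + hprod T ?b *s ?b"
    by (rule unitary_frame_expansion)
  then have "T = of_real (Re (hprod T (f p))) *s f p + of_real (Re (hprod T ?a)) *s ?a
      + of_real (Re (hprod T ?b)) *s ?b"
    using real(1)[of v] real(1)[of w] real(2) by (simp only:)
  then obtain r s t where "T = r *\<^sub>R f p + s *\<^sub>R ?a + t *\<^sub>R ?b"
    unfolding scaleR_eq_scale by blast
  moreover have "\<xi> \<bullet> f p = 0" by (rule tangent_space_sphere[OF \<xi>(1)])
  moreover have "\<xi> \<bullet> hor p x = 0" for x using \<xi>(2) by (simp add: df)
  ultimately have "\<xi> \<bullet> T = 0" by (simp add: inner_add_right)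
  then show "\<xi> \<bullet> (dirderiv (\<lambda>q. dirderiv f q v) p v + dirderiv (\<lambda>q. dirderiv f q w) p w) = 0"
    by (simp add: T_def)
qed

text \<open>Two horizontal lifts differ by a function with values in the unit circle whose derivative
  vanishes.\<close>

lemma horizontal_lift_unique:
  assumes diff: "\<And>p. k differentiable (at p)" and k: "\<And>p. unit_at p (k p)"
    and hor: "\<And>p v. hprod (dirderiv k p v) (k p) = 0"
  shows "\<exists>c. cmod c = 1 \<and> (\<forall>p. k p = c *s f p)"
proof -
  define \<mu> where "\<mu> = (\<lambda>p. hprod (k p) (f p))"
  have k_eq: "k p = \<mu> p *s f p" for p
    using P_fixes[OF k[of p]] by (simp add: P_f outer_mult_vec \<mu>_def)
  have norm: "cmod (\<mu> p) = 1" for p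
    using unit_at_norm[OF k[of p]] f_norm[of p] k_eq[of p] norm_scale[of "\<mu> p" "f p"] by simp
  have "(\<mu> has_derivative (\<lambda>x. 0)) (at p)" for p
  proof -
    have "(\<mu> has_derivative (\<lambda>x. hprod (k p) (dirderiv f p x) + hprod (dirderiv k p x) (f p))) (at p)"
      unfolding \<mu>_def
      by (rule bounded_bilinear.FDERIV[OF bounded_bilinear_hprod has_derivative_dirderiv[OF diff]
            f_has_derivative])
    moreover have "hprod (k p) (dirderiv f p x) = 0" for x
      unfolding df by (subst k_eq) (simp add: hprod_simps hprod_f_hor)
    moreover have "hprod (dirderiv k p x) (f p) = 0" for x
    proof -
      have "cnj (\<mu> p) * hprod (dirderiv k p x) (f p) = hprod (dirderiv k p x) (k p)"
        unfolding k_eq[of p] hprod_simps ..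
      then show ?thesis using hor norm[of p] by auto
    qed
    ultimately show ?thesis by simp
  qed
  then obtain c where "\<And>p. \<mu> p = c"
    using has_derivative_zero_constant[OF convex_UNIV, of \<mu>] by auto
  then show ?thesis using k_eq norm by metis
qed

subsection \<open>Periods\<close>

lemma dP_periodic:
  assumes "l \<in> \<Lambda>"
  shows "dP (p + l) x = dP p x"
proof -
  have "((\<lambda>p. p + l) has_derivative (\<lambda>x. x)) (at p)"
    by (auto intro!: derivative_eq_intros)
  from has_derivative_compose[OF this P_has_derivative]
  have "(P has_derivative dP (p + l)) (at p)" by (simp add: P_periodic[OF assms])
  then show ?thesis by (metis dirderiv_eqI)
qed

lemma area_periodic: "l \<in> \<Lambda> \<Longrightarrow> area (p + l) = area p"
  by (simp add: area_def gram_def G_def dP_periodic)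

lemma translate_normalized_lift:
  assumes "l \<in> \<Lambda>"
  shows "normalized_lift \<Lambda> \<phi> (\<lambda>p. f (p + l))"
proof
  show "continuous_on UNIV (\<lambda>p. f (p + l))"
    by (rule continuous_on_compose2[OF f_continuous]) (auto intro: continuous_intros)
  show "lifts q (f (q + l))" for q
    using f_lifts[of "q + l"] assms
    by (simp add: lifts_def unit_at_def frame_det_def dP_periodic area_periodic \<phi>_periodic)
qed

text \<open>The constant factor by which translation by \<open>l\<close> changes \<open>f\<close>, read off at the origin.\<close>

definition period :: "real^2 \<Rightarrow> complex" where
  "period l = hprod (f l) (f 0)"

lemma f_translate:
  assumes "l \<in> \<Lambda>"
  shows "f (p + l) = period l *s f p"
proof -
  interpret t: normalized_lift \<Lambda> \<phi> "\<lambda>p. f (p + l)" by (rule translate_normalized_lift[OF assms])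
  obtain c where c: "\<And>p. f (p + l) = c *s f p"
    using horizontal_lift_unique[OF t.f_differentiable t.f_unit_at] t.hor_orthogonal t.df by metis
  from c[of 0] have "period l = c" by (simp add: period_def hprod_simps f_hprod)
  then show ?thesis using c by simp
qed

lemma cubic_character_period: "cubic_character \<Lambda> period"
proof
  show "plane_lattice \<Lambda>" by (rule lattice)
  show "period (k + l) = period k * period l" if "k \<in> \<Lambda>" "l \<in> \<Lambda>" for k l
    using f_translate[OF that(2), of k] f_translate[OF that(1), of 0]
    by (simp add: period_def hprod_simps mult.commute)
  show "period l ^ 3 = 1" if "l \<in> \<Lambda>" for l
  proof -
    have "lifts 0 (f (0 + l))"
      using translate_normalized_lift[OF that] normalized_lift.f_lifts by blast
    then show ?thesis using lifts_eq_scale(2)[OF f_lifts] by (simp add: period_def)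
  qed
qed

subsection \<open>The cone\<close>

lemma conformal_frame_norms:
  assumes "conformal_frame P p v w"
  obtains \<rho> where "\<rho> > 0" "G p v v = \<rho>\<^sup>2" "G p w w = \<rho>\<^sup>2" "G p v w = 0" "orient v w * area p = \<rho>\<^sup>2"
    "det (columns3 (f p) (hor p v) (hor p w)) = \<i> * of_real (\<rho>\<^sup>2)"
proof -
  define \<rho> where "\<rho> = sqrt (G p v v)"
  have \<rho>: "\<rho> > 0" "\<rho>\<^sup>2 = G p v v" using conformal_frame_nonzero[OF assms] by (simp_all add: \<rho>_def)
  moreover have G: "G p w w = \<rho>\<^sup>2" "G p v w = 0" "orient v w > 0"
    using assms \<rho>(2) by (simp_all add: conformal_frame_G)
  moreover have "orient v w * area p = \<rho>\<^sup>2"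
    using orient_area[of p v "\<rho>\<^sup>2" w] conformal_frame_nonzero[OF assms] \<rho> G by simp
  moreover from this have "det (columns3 (f p) (hor p v) (hor p w)) = \<i> * of_real (\<rho>\<^sup>2)"
    using f_lifts[of p] by (simp add: det_frame lifts_def flip: of_real_mult)
  ultimately show ?thesis using that by simp
qed

text \<open>The cone over \<open>\<i> f\<close> has unit phase because \<open>\<i>\<^sup>3\<close> cancels the phase \<open>\<i>\<close> of the
  determinant. In the frame \<open>\<i> f, \<i> df(v)/\<rho>, \<i> df(w)/\<rho>\<close> its differential is real; the matrix
  \<open>A\<close> is the coordinate change from the basis of the plane to \<open>v, w\<close>.\<close>

lemma special_lagrangian_cone_f: "special_lagrangian_cone (\<lambda>p. \<i> *s f p)"
proof -
  define F where "F = (\<lambda>p. \<i> *s f p)"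
  have blin: "bounded_linear (\<lambda>x::complex^3. \<i> *s x)"
    by (rule bounded_bilinear.bounded_linear_right[OF bounded_bilinear_scale])
  have F_deriv: "(F has_derivative (\<lambda>x. \<i> *s hor p x)) (at p)" for p
    unfolding F_def using bounded_linear.has_derivative[OF blin f_has_derivative[of p]]
    by (simp add: df)
  have dF: "dirderiv F p x = \<i> *s hor p x" for p x by (rule dirderiv_eqI[OF F_deriv])
  have F_smooth: "smooth_on UNIV F"
    unfolding F_def by (rule smooth_on_bounded_linear[OF open_UNIV blin smooth_f])
  have scale_inj: "x = y" if "\<i> *s x = \<i> *s y" for x y :: "complex^3"
    using that by simp
  have F_imm: "immersion_on UNIV F"
    unfolding immersion_on_def inj_def dF using F_smooth hor_inj scale_inj by blast
  have F_norm: "norm (F p) = 1" for p by (simp add: F_def norm_scale f_norm)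
  define L :: "real^3 \<Rightarrow> real^2" where "L = (\<lambda>q. vector [q$2, q$3])"
  have L: "bounded_linear L"
    by (auto simp: linear_conv_bounded_linear[symmetric] L_def vec_eq_iff forall_2 vector_2 intro!: linearI)
  let ?U = "{q::real^3. q$1 > 0}"
  have U: "open ?U" by (intro open_Collect_less continuous_intros)
  have cone: "cone_map F = (\<lambda>q. (q$1) *\<^sub>R F (L q))" by (simp add: cone_map_def L_def fun_eq_iff)
  have smooth_fst: "smooth_on ?U (\<lambda>q. q$1)"
    by (rule smooth_on_bounded_linear[OF U bounded_linear_vec_nth smooth_on_ident[OF U]])
  have cone_smooth: "smooth_on ?U (cone_map F)"
    unfolding cone
    by (intro smooth_on_bounded_bilinear[OF U bounded_bilinear_scaleR] smooth_fst
        smooth_on_compose_linear[OF U L subset_UNIV F_smooth])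
  have cone_deriv: "dirderiv (cone_map F) q x = (q$1) *\<^sub>R (\<i> *s hor (L q) (L x)) + (x$1) *\<^sub>R F (L q)" for q x
  proof (rule dirderiv_eqI)
    show "(cone_map F has_derivative
        (\<lambda>x. (q$1) *\<^sub>R (\<i> *s hor (L q) (L x)) + (x$1) *\<^sub>R F (L q))) (at q)"
      unfolding cone
      by (rule bounded_bilinear.FDERIV[OF bounded_bilinear_scaleR
            bounded_linear_imp_has_derivative[OF bounded_linear_vec_nth]
            has_derivative_compose[OF bounded_linear_imp_has_derivative[OF L] F_deriv]])
  qed
  have frame: "\<exists>g\<in>SU3. \<exists>A::real^3^3. det A > 0 \<and>
      (\<forall>x. dirderiv (cone_map F) q x = g *v (\<chi> i. complex_of_real ((A *v x)$i)))"
    if "q \<in> ?U" for q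
  proof -
    let ?p = "L q"
    obtain v w where vw: "conformal_frame P ?p v w" using conformal_frame_ex by blast
    obtain \<rho> where \<rho>: "\<rho> > 0" "G ?p v v = \<rho>\<^sup>2" "G ?p w w = \<rho>\<^sup>2" "G ?p v w = 0"
      "orient v w * area ?p = \<rho>\<^sup>2"
      and det: "det (columns3 (f ?p) (hor ?p v) (hor ?p w)) = \<i> * of_real (\<rho>\<^sup>2)"
      using conformal_frame_norms[OF vw] by blast
    have FL: "F (L q) = \<i> *s f (L q)" by (simp add: F_def)
    have o: "orient v w > 0" using vw by (simp add: conformal_frame_G)
    let ?c = "\<i> * complex_of_real (1 / \<rho>)"
    define g where "g = columns3 (\<i> *s f ?p) (?c *s hor ?p v) (?c *s hor ?p w)"
    have "unitary_frame (\<i> *s f ?p) (?c *s hor ?p v) (?c *s hor ?p w)"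
      using \<rho> by (simp add: unitary_frame_def hprod_simps f_hprod hprod_f_hor hprod_hor power2_eq_square)
    then have "ctranspose g ** g = mat 1" unfolding g_def by (rule unitary_frame_unitary)
    moreover have "det g = 1"
      unfolding g_def det_columns3_scale det using \<rho>(1) by (simp add: power2_eq_square)
    ultimately have "g \<in> SU3" by (simp add: SU3_def)
    define k where "k = q$1 * \<rho> / orient v w"
    have k: "k > 0" using that \<rho>(1) o by (simp add: k_def)
    define A :: "real^3^3" where "A = vector [vector [1, 0, 0],
      vector [0, k * w$2, - (k * w$1)], vector [0, - (k * v$2), k * v$1]]"
    have "det A = k\<^sup>2 * orient v w"
      by (simp add: A_def det_3 vector_3 orient_def power2_eq_square algebra_simps)
    then have "det A > 0" using k o by simp
    moreover have "dirderiv (cone_map F) q x = g *v (\<chi> i. complex_of_real ((A *v x)$i))" for x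
    proof -
      let ?s = "orient (L x) w / orient v w" and ?t = "orient v (L x) / orient v w"
      have "hor ?p (L x) = of_real ?s *s hor ?p v + of_real ?t *s hor ?p w"
        by (subst plane_expansion[of v w "L x"]) (use o in \<open>simp_all add: dP_mult_vec_add dP_mult_vec_scale\<close>)
      then have "dirderiv (cone_map F) q x = of_real (q$1) *s (\<i> *s (of_real ?s *s hor ?p v + of_real ?t *s hor ?p w))
          + of_real (x$1) *s (\<i> *s f ?p)"
        unfolding cone_deriv FL scaleR_eq_scale by (simp only:)
      moreover have "(A *v x)$1 = x$1" "(A *v x)$2 = k * orient (L x) w" "(A *v x)$3 = k * orient v (L x)"
        by (simp_all add: A_def matrix_vector_mult_def sum_3 vector_3 L_def orient_def vector_2
            algebra_simps)
      moreover have "complex_of_real (k * r) * ?c = of_real (q$1) * (\<i> * of_real (r / orient v w))" for r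
        using \<rho>(1) by (simp add: k_def)
      ultimately show ?thesis
        unfolding g_def columns3_mult_vec vec_lambda_beta
        by (simp only: vector_add_ldistrib vector_smult_assoc mult.assoc[symmetric] add_ac)
    qed
    ultimately show ?thesis using \<open>g \<in> SU3\<close> by blast
  qed
  have "inj (dirderiv (cone_map F) q)" if q: "q \<in> ?U" for q
  proof (rule injI)
    fix x y assume xy: "dirderiv (cone_map F) q x = dirderiv (cone_map F) q y"
    obtain g and A :: "real^3^3" where g: "g \<in> SU3" "det A > 0"
      "\<And>x. dirderiv (cone_map F) q x = g *v (\<chi> i. complex_of_real ((A *v x)$i))"
      using frame[OF q] by blast
    have "ctranspose g *v (g *v z) = z" for z
      using g(1) by (simp add: SU3_def matrix_vector_mul_assoc)
    then have "(\<chi> i. complex_of_real ((A *v x)$i)) = (\<chi> i. complex_of_real ((A *v y)$i))"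
      using xy g(3) by metis
    then have "A *v x = A *v y" by (simp add: vec_eq_iff)
    moreover have "invertible A" using g(2) by (simp add: invertible_det_nz)
    ultimately show "x = y" by (metis invertible_def matrix_vector_mul_assoc matrix_vector_mul_lid)
  qed
  then show ?thesis
    unfolding special_lagrangian_cone_def special_lagrangian_on_def F_def[symmetric]
    using F_imm F_norm cone_smooth frame by (auto simp: immersion_on_def[of ?U])
qed

end

section \<open>Curves in the flag manifold\<close>

lemma standard_unitary_frame: "unitary_frame (axis 1 1) (axis 2 1) (axis 3 1)"
  by (simp add: unitary_frame_def hprod_3 axis_def)

lemma unitary_hprod:
  assumes "ctranspose U ** U = mat 1"
  shows "hprod (U *v x) (U *v y) = hprod x y"
  by (simp add: hprod_mult_vec_left matrix_vector_mul_assoc assms)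

lemma unitary_image_base_plane:
  assumes "ctranspose U ** U = mat 1"
  shows "(*v) U ` vec.span {axis 1 1, axis 2 1} = {x. hprod x (U *v axis 3 1) = 0}"
  unfolding hyperplane_eq_span[OF standard_unitary_frame, symmetric]
proof (intro equalityI subsetI)
  fix x assume x: "x \<in> {x. hprod x (U *v axis 3 1) = 0}"
  have "U ** ctranspose U = mat 1" using assms matrix_left_right_inverse by blast
  then have "x = U *v (ctranspose U *v x)" by (simp add: matrix_vector_mul_assoc)
  moreover from this have "hprod (ctranspose U *v x) (axis 3 1) = 0"
    using x unitary_hprod[OF assms, of "ctranspose U *v x"] by simp
  ultimately show "x \<in> (*v) U ` {x. hprod x (axis 3 1) = 0}" by blast
qed (auto simp: unitary_hprod[OF assms])

text \<open>The image of the base plane is the orthogonal complement of \<open>U e\<^sub>3\<close>, so its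
  projector depends on \<open>U\<close> through the third column only.\<close>

lemma FL2_embed_act_base:
  assumes "ctranspose U ** U = mat 1"
  shows "FL2_embed (FL2_act U FL2_base) =
    (U *v axis 1 1, mat 1 - outer (U *v axis 3 1) (U *v axis 3 1))"
proof -
  have "hprod (U *v axis 3 1) (U *v axis 3 1) = 1"
    unfolding unitary_hprod[OF assms] using standard_unitary_frame by (simp add: unitary_frame_def)
  then have "(norm (U *v axis 3 1))\<^sup>2 = 1" unfolding hprod_self by (simp only: of_real_eq_1_iff)
  then have "norm (U *v axis 3 1) = 1"
    using norm_ge_zero[of "U *v axis 3 1"] by (auto simp: power2_eq_1_iff)
  from orth_proj_hyperplane[OF this] show ?thesis
    by (simp add: FL2_embed_def FL2_act_def FL2_base_def unitary_image_base_plane[OF assms])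
qed

lemma flag_curve_has_vector_derivative:
  assumes g: "ctranspose g ** g = mat 1" and A: "ctranspose A = - A"
  shows "((\<lambda>t. FL2_embed (FL2_act (g ** mat_exp (t *\<^sub>R A)) FL2_base)) has_vector_derivative
    (g *v (A *v axis 1 1), - (outer (g *v axis 3 1) (g *v (A *v axis 3 1))
      + outer (g *v (A *v axis 3 1)) (g *v axis 3 1)))) (at 0)"
proof -
  define E where "E = (\<lambda>t::real. g ** mat_exp (t *\<^sub>R A))"
  have unitary: "ctranspose (E t) ** E t = mat 1" for t
  proof -
    have "ctranspose (E t) ** E t = ctranspose (mat_exp (t *\<^sub>R A)) ** ((ctranspose g ** g) ** mat_exp (t *\<^sub>R A))"
      by (simp add: E_def ctranspose_mult matrix_mul_assoc)
    then show ?thesis by (simp add: g mat_exp_unitary[OF A])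
  qed
  have E0: "E 0 = g" by (simp add: E_def mat_exp_0)
  have "(E has_vector_derivative g ** A) (at 0)"
    using bounded_linear.has_vector_derivative[OF
        bounded_bilinear.bounded_linear_right[OF bounded_bilinear_cmatrix_mult]
        mat_exp_has_vector_derivative[of A 0], of g]
    by (simp add: E_def mat_exp_0)
  then have Ex: "((\<lambda>t. E t *v x) has_vector_derivative g *v (A *v x)) (at 0)" for x
    using bounded_linear.has_vector_derivative[OF
        bounded_bilinear.bounded_linear_left[OF bounded_bilinear_cmatrix_vec], of E _ _ x]
    by (simp add: matrix_vector_mul_assoc)
  have "((\<lambda>t. outer (E t *v axis 3 1) (E t *v axis 3 1)) has_vector_derivative
      outer (g *v axis 3 1) (g *v (A *v axis 3 1)) + outer (g *v (A *v axis 3 1)) (g *v axis 3 1)) (at 0)"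
    using bounded_bilinear.has_vector_derivative[OF bounded_bilinear_outer Ex[of "axis 3 1"] Ex[of "axis 3 1"]]
    by (simp add: E0)
  then have "((\<lambda>t. mat 1 - outer (E t *v axis 3 1) (E t *v axis 3 1)) has_vector_derivative
      - (outer (g *v axis 3 1) (g *v (A *v axis 3 1)) + outer (g *v (A *v axis 3 1)) (g *v axis 3 1))) (at 0)"
    using has_vector_derivative_diff[OF has_vector_derivative_const[of "mat 1 :: complex^3^3"]] by fastforce
  from has_vector_derivative_Pair[OF Ex[of "axis 1 1"] this] show ?thesis
    unfolding FL2_embed_act_base[OF unitary, symmetric] by (simp add: E_def)
qed

text \<open>The decomposition of an element of \<open>g1\<close> along the real form \<open>su3\<close>: if
  \<open>C = A + \<i> B\<close> with skew-Hermitian \<open>A\<close>, \<open>B\<close>, then \<open>2A = C - C\<^sup>*\<close> and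
  \<open>2\<i>B = C + C\<^sup>*\<close>.\<close>

lemma g1_bundleI:
  fixes \<alpha> :: real and \<beta> :: complex
  assumes frame: "unitary_frame u n m" and det: "det (columns3 u n m) = 1"
    and q: "q = (u, {x. hprod x m = 0})"
    and \<xi>: "\<xi> = (of_real (\<alpha> / 2) *s (n - m),
      - (outer m ((1/2) *s (of_real \<alpha> *s u - cnj \<beta> *s n)) + outer ((1/2) *s (of_real \<alpha> *s u - cnj \<beta> *s n)) m))"
    and \<eta>: "\<eta> = ((- \<i> * of_real (\<alpha> / 2)) *s (n + m),
      - (outer m ((- \<i> / 2) *s (of_real \<alpha> *s u + cnj \<beta> *s n)) + outer ((- \<i> / 2) *s (of_real \<alpha> *s u + cnj \<beta> *s n)) m))"
  shows "(\<xi>, \<eta>) \<in> g1_bundle q"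
proof -
  define a where "a = complex_of_real \<alpha>"
  define g where "g = columns3 u n m"
  define A :: "complex^3^3" where "A = vector [vector [0, - a / 2, a / 2],
    vector [a / 2, 0, - cnj \<beta> / 2], vector [- a / 2, \<beta> / 2, 0]]"
  define B :: "complex^3^3" where "B = vector [vector [0, - \<i> * a / 2, - \<i> * a / 2],
    vector [- \<i> * a / 2, 0, - \<i> * cnj \<beta> / 2], vector [- \<i> * a / 2, - \<i> * \<beta> / 2, 0]]"
  have g: "ctranspose g ** g = mat 1" unfolding g_def by (rule unitary_frame_unitary[OF frame])
  then have "g \<in> SU3" using det by (simp add: SU3_def g_def)
  have [simp]: "cnj a = a" by (simp add: a_def)
  have A: "A \<in> su3" and B: "B \<in> su3"
    by (simp_all add: A_def B_def su3_def ctranspose_def trace_def vec_eq_iff forall_3 vector_3 sum_3)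
  have "A + mat \<i> ** B = vector [vector [0, 0, a], vector [a, 0, 0], vector [0, \<beta>, 0]]"
    by (simp add: A_def B_def vec_eq_iff forall_3 vector_3 sum_3 matrix_matrix_mult_def mat_def)
  then have "A + mat \<i> ** B \<in> g1" unfolding g1_def by blast
  have g_axis: "g *v axis 1 1 = u" "g *v axis 2 1 = n" "g *v axis 3 1 = m"
    by (simp_all add: g_def columns3_mult_vec axis_def)
  have "FL2_act g FL2_base = q"
    by (simp add: FL2_act_def FL2_base_def unitary_image_base_plane[OF g] g_axis q)
  moreover have "A *v axis 1 1 = vector [0, a / 2, - a / 2]"
    "A *v axis 3 1 = vector [a / 2, - cnj \<beta> / 2, 0]"
    "B *v axis 1 1 = vector [0, - \<i> * a / 2, - \<i> * a / 2]"
    "B *v axis 3 1 = vector [- \<i> * a / 2, - \<i> * cnj \<beta> / 2, 0]"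
    by (simp_all add: A_def B_def matrix_vector_mult_def axis_def sum_3 vector_3 vec_eq_iff forall_3)
  then have "g *v (A *v axis 1 1) = of_real (\<alpha> / 2) *s (n - m)"
    "g *v (A *v axis 3 1) = (1/2) *s (of_real \<alpha> *s u - cnj \<beta> *s n)"
    "g *v (B *v axis 1 1) = (- \<i> * of_real (\<alpha> / 2)) *s (n + m)"
    "g *v (B *v axis 3 1) = (- \<i> / 2) *s (of_real \<alpha> *s u + cnj \<beta> *s n)"
    by (simp_all add: g_def columns3_mult_vec a_def vector_3 vec_eq_iff algebra_simps)
  ultimately show ?thesis
    using flag_curve_has_vector_derivative[OF g, of A] flag_curve_has_vector_derivative[OF g, of B]
      \<open>g \<in> SU3\<close> A B \<open>A + mat \<i> ** B \<in> g1\<close>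
    unfolding g1_bundle_def \<xi> \<eta> g_axis by (auto simp: su3_def)
qed

section \<open>The primitive lift\<close>

lemma outer_conjugate_pair:
  "outer (of_real (- c) *s (a + \<i> *s b)) (of_real (- c) *s (a + \<i> *s b))
    - outer (of_real c *s (a - \<i> *s b)) (of_real c *s (a - \<i> *s b))
    = (2 * c\<^sup>2) *\<^sub>R (outer (\<i> *s b) a - outer (\<i> *s a) b)"
  by (simp add: outer_def vec_eq_iff power2_eq_square algebra_simps scaleR_conv_of_real[where 'a = complex])

context normalized_lift
begin

definition skew :: "real^2 \<Rightarrow> real^2 \<Rightarrow> real^2 \<Rightarrow> complex^3^3" where
  "skew v w q = outer (\<i> *s hor q w) (hor q v) - outer (\<i> *s hor q v) (hor q w)"

text \<open>The projector onto the line of the derivative of \<open>f\<close> by the conjugate of \<open>z\<close>, which is the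
  orthogonal complement of \<open>\<ell>\<^sub>0 \<oplus> \<ell>\<^sub>1\<close>. Half of the projector onto the complement of \<open>f\<close> is corrected
  by half of \<open>\<i>(b a\<^sup>* - a b\<^sup>*)/area\<close>, which has the eigenvalues \<open>1\<close> and \<open>-1\<close> there. In this
  form no conformal frame is needed, and smoothness is evident.\<close>

definition conj_proj :: "real^2 \<Rightarrow> complex^3^3" where
  "conj_proj q = (1/2) *\<^sub>R (mat 1 - P q) + (inverse (area q) / 2) *\<^sub>R skew (axis 1 1) (axis 2 1) q"

definition plane :: "real^2 \<Rightarrow> (complex^3) set" where
  "plane q = {x. conj_proj q *v x = 0}"

definition flag :: "real^2 \<Rightarrow> (complex^3) \<times> (complex^3) set" where
  "flag q = (f q, plane q)"

text \<open>As an alternating form in the frame, \<open>skew\<close> changes by the determinant.\<close>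

lemma skew_orient: "skew v w q = orient v w *\<^sub>R skew (axis 1 1) (axis 2 1) q"
proof -
  have basis: "x = x$1 *\<^sub>R axis 1 1 + x$2 *\<^sub>R axis 2 1" for x :: "real^2"
    by (simp add: vec_eq_iff forall_2 axis_def)
  define a b where "a = hor q (axis 1 1)" "b = hor q (axis 2 1)"
  have h: "hor q x = of_real (x$1) *s a + of_real (x$2) *s b" for x
    by (subst basis) (simp add: dP_mult_vec_add dP_mult_vec_scale a_b_def)
  show ?thesis
    unfolding skew_def h[of v] h[of w] a_b_def[symmetric]
    by (simp add: vec_eq_iff outer_def orient_def algebra_simps scaleR_conv_of_real[where 'a = complex])
qed

lemma conj_proj_eq:
  assumes "orient v w \<noteq> 0"
  shows "conj_proj q = (1/2) *\<^sub>R (mat 1 - P q) + (inverse (orient v w * area q) / 2) *\<^sub>R skew v w q"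
  using assms by (subst skew_orient) (simp add: conj_proj_def)

lemma smooth_hor: "smooth_on UNIV (\<lambda>q. hor q x)"
  by (intro smooth_on_bounded_bilinear[OF open_UNIV bounded_bilinear_cmatrix_vec] smooth_f
      smooth_on_dirderiv smooth_P)

lemma smooth_conj_proj: "smooth_on UNIV conj_proj"
proof -
  have blin: "bounded_linear (\<lambda>x::complex^3. \<i> *s x)"
    by (rule bounded_bilinear.bounded_linear_right[OF bounded_bilinear_scale])
  show ?thesis
    unfolding conj_proj_def[abs_def] skew_def
    by (intro smooth_on_add smooth_on_diff smooth_on_const open_UNIV smooth_P
        smooth_on_bounded_linear[OF open_UNIV bounded_linear_scaleR_right]
        smooth_on_bounded_bilinear[OF open_UNIV bounded_bilinear_scaleR]
        smooth_on_bounded_bilinear[OF open_UNIV bounded_bilinear_outer]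
        smooth_on_bounded_linear[OF open_UNIV bounded_linear_divide]
        smooth_on_bounded_linear[OF open_UNIV blin] smooth_hor smooth_inverse_area)
qed

text \<open>The frame of a local complex coordinate: \<open>n\<close> and \<open>-m\<close> are the normalized
  derivatives of \<open>f\<close> by \<open>z\<close> and by its conjugate. The sign of \<open>m\<close> and the phase \<open>\<i>\<close> in the
  choice of \<open>f\<close> give it the determinant \<open>1\<close>.\<close>

lemma adapted_frame:
  assumes "conformal_frame P p v w"
  obtains \<rho> c n m where "\<rho> > 0" "c > 0" "2 * c\<^sup>2 * \<rho>\<^sup>2 = 1"
    "G p v v = \<rho>\<^sup>2" "G p w w = \<rho>\<^sup>2" "G p v w = 0" "orient v w * area p = \<rho>\<^sup>2"
    "n = of_real c *s (hor p v - \<i> *s hor p w)" "m = of_real (- c) *s (hor p v + \<i> *s hor p w)"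
    "unitary_frame (f p) n m" "det (columns3 (f p) n m) = 1" "conj_proj p = outer m m"
proof -
  obtain \<rho> where \<rho>: "\<rho> > 0" "G p v v = \<rho>\<^sup>2" "G p w w = \<rho>\<^sup>2" "G p v w = 0" "orient v w * area p = \<rho>\<^sup>2"
    and det: "det (columns3 (f p) (hor p v) (hor p w)) = \<i> * of_real (\<rho>\<^sup>2)"
    using conformal_frame_norms[OF assms] by blast
  \<comment> \<open>the vectors \<open>df(v) \<plusminus> \<i> df(w)\<close> have the squared length \<open>2\<rho>\<^sup>2\<close>\<close>
  define c where "c = 1 / (sqrt 2 * \<rho>)"
  define n where "n = of_real c *s (hor p v - \<i> *s hor p w)"
  define m where "m = of_real (- c) *s (hor p v + \<i> *s hor p w)"
  have c: "c > 0" "2 * c\<^sup>2 * \<rho>\<^sup>2 = 1"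
    using \<rho>(1) by (simp_all add: c_def power_mult_distrib power_divide)
  have norm: "complex_of_real c * (complex_of_real c * (complex_of_real (\<rho>\<^sup>2) + complex_of_real (\<rho>\<^sup>2))) = 1"
  proof -
    have "complex_of_real c * (complex_of_real c * (complex_of_real (\<rho>\<^sup>2) + complex_of_real (\<rho>\<^sup>2)))
        = complex_of_real (2 * c\<^sup>2 * \<rho>\<^sup>2)" by (simp add: power2_eq_square algebra_simps)
    then show ?thesis using c(2) by simp
  qed
  have frame: "unitary_frame (f p) n m"
    using norm \<rho>(2-4) G_symmetric[of p w v]
    by (simp add: unitary_frame_def n_def m_def hprod_simps f_hprod hprod_f_hor hprod_hor algebra_simps)
  have "det (columns3 (f p) n m) = - 2 * \<i> * of_real (c\<^sup>2) * det (columns3 (f p) (hor p v) (hor p w))"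
    by (simp add: n_def m_def det_columns3 power2_eq_square algebra_simps)
  also have "\<dots> = of_real (2 * c\<^sup>2 * \<rho>\<^sup>2)"
    unfolding det by (auto simp: complex_eq_iff)
  finally have "det (columns3 (f p) n m) = 1" using c(2) by simp
  moreover have "conj_proj p = outer m m"
  proof -
    have c2: "2 * c\<^sup>2 = 1 / \<rho>\<^sup>2" using c(2) \<rho>(1) by (simp add: field_simps)
    have skew: "(1 / \<rho>\<^sup>2) *\<^sub>R skew v w p = outer m m - outer n n"
      unfolding n_def m_def outer_conjugate_pair skew_def c2 ..
    have orth: "mat 1 - P p = outer n n + outer m m"
      using unitary_frame_identity[OF frame] by (simp add: P_f algebra_simps)
    have o: "orient v w \<noteq> 0" using \<rho>(1,5) by auto
    have "conj_proj p = (1/2) *\<^sub>R (mat 1 - P p) + (1/2) *\<^sub>R ((1 / \<rho>\<^sup>2) *\<^sub>R skew v w p)"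
      unfolding conj_proj_eq[OF o] \<rho>(5) scaleR_scaleR by (simp add: inverse_eq_divide)
    also have "\<dots> = (1/2) *\<^sub>R (outer n n + outer m m) + (1/2) *\<^sub>R (outer m m - outer n n)"
      unfolding skew orth ..
    also have "\<dots> = (1/2) *\<^sub>R (outer m m + outer m m)" by (simp add: scaleR_add_right[symmetric])
    finally show ?thesis by (simp only: scaleR_half_double)
  qed
  ultimately show ?thesis using that[OF \<rho>(1) c \<rho>(2-5) n_def m_def frame] by blast
qed

lemma plane_eq:
  assumes "unitary_frame (f p) n m" "conj_proj p = outer m m"
  shows "plane p = {x. hprod x m = 0}"
proof -
  have "m \<noteq> 0" using assms(1) by (auto simp: unitary_frame_def hprod_simps)
  then show ?thesis by (auto simp: plane_def assms(2) outer_mult_vec)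
qed

lemma conj_proj_ex: "\<exists>n m. unitary_frame (f p) n m \<and> conj_proj p = outer m m"
proof -
  obtain v w where "conformal_frame P p v w" using conformal_frame_ex by blast
  from adapted_frame[OF this] show ?thesis by blast
qed

lemma FL2_embed_flag: "FL2_embed \<circ> flag = (\<lambda>q. (f q, mat 1 - conj_proj q))"
proof
  fix q
  obtain n m where nm: "unitary_frame (f q) n m" "conj_proj q = outer m m"
    using conj_proj_ex by blast
  have "norm m = 1"
  proof -
    have "complex_of_real ((norm m)\<^sup>2) = 1"
      using nm(1) unfolding unitary_frame_def hprod_self by blast
    then have "(norm m)\<^sup>2 = 1" by (simp only: of_real_eq_1_iff)
    then show ?thesis using norm_ge_zero[of m] by (auto simp: power2_eq_1_iff)
  qed
  from orth_proj_hyperplane[OF this]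
  show "(FL2_embed \<circ> flag) q = (f q, mat 1 - conj_proj q)"
    by (simp add: FL2_embed_def flag_def plane_eq[OF nm] nm(2))
qed

lemma flag_in_FL2: "flag q \<in> FL2"
proof -
  obtain n m where nm: "unitary_frame (f q) n m" "conj_proj q = outer m m"
    using conj_proj_ex by blast
  then show ?thesis
    using hyperplane_in_Grassmannian_2[OF nm(1)]
    by (simp add: FL2_def flag_def plane_eq[OF nm] f_norm unitary_frame_def)
qed

lemma conj_proj_hermitian: "ctranspose (conj_proj q) = conj_proj q"
  using conj_proj_ex[of q] ctranspose_outer by metis

lemma conj_proj_idempotent: "conj_proj q ** conj_proj q = conj_proj q"
  and conj_proj_f: "conj_proj q *v f q = 0"
proof -
  obtain n m where "unitary_frame (f q) n m" "conj_proj q = outer m m"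
    using conj_proj_ex by blast
  then show "conj_proj q ** conj_proj q = conj_proj q" "conj_proj q *v f q = 0"
    by (simp_all add: matrix_mult_outer outer_mult_vec unitary_frame_def)
qed

abbreviation dN :: "real^2 \<Rightarrow> real^2 \<Rightarrow> complex^3^3" where
  "dN q x \<equiv> dirderiv conj_proj q x"

lemma conj_proj_has_derivative: "(conj_proj has_derivative dN q) (at q)"
  using smooth_on_has_derivative[OF smooth_conj_proj] by simp

lemma dN_hermitian: "ctranspose (dN q x) = dN q x"
proof -
  have "((\<lambda>r. ctranspose (conj_proj r)) has_derivative (\<lambda>x. ctranspose (dN q x))) (at q)"
    by (rule bounded_linear.has_derivative[OF bounded_linear_ctranspose conj_proj_has_derivative])
  then have "dirderiv conj_proj q x = ctranspose (dN q x)"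
    unfolding conj_proj_hermitian by (rule dirderiv_eqI)
  then show ?thesis by simp
qed

lemma dN_product: "dN q x = conj_proj q ** dN q x + dN q x ** conj_proj q"
proof -
  have "((\<lambda>r. conj_proj r ** conj_proj r) has_derivative
      (\<lambda>x. conj_proj q ** dN q x + dN q x ** conj_proj q)) (at q)"
    by (rule bounded_bilinear.FDERIV[OF bounded_bilinear_cmatrix_mult conj_proj_has_derivative
          conj_proj_has_derivative])
  then show ?thesis unfolding conj_proj_idempotent by (rule dirderiv_eqI)
qed

lemma dN_f: "dN q x *v f q = - (conj_proj q *v hor q x)"
proof -
  have "((\<lambda>q. conj_proj q *v f q) has_derivative
      (\<lambda>x. conj_proj q *v dirderiv f q x + dN q x *v f q)) (at q)"
    by (rule bounded_bilinear.FDERIV[OF bounded_bilinear_cmatrix_vec conj_proj_has_derivative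
          f_has_derivative])
  then have "((\<lambda>q. 0) has_derivative (\<lambda>x. conj_proj q *v hor q x + dN q x *v f q)) (at q)"
    unfolding conj_proj_f df .
  from has_derivative_unique[OF this has_derivative_const]
  have "conj_proj q *v hor q x + dN q x *v f q = 0" by meson
  then show ?thesis by (simp add: eq_neg_iff_add_eq_0 add.commute)
qed

lemma dirderiv_flag: "dirderiv (FL2_embed \<circ> flag) q x = (hor q x, - dN q x)"
proof (rule dirderiv_eqI)
  have "((\<lambda>q. (f q, mat 1 - conj_proj q)) has_derivative (\<lambda>x. (hor q x, 0 - dN q x))) (at q)"
    using f_has_derivative[of q] conj_proj_has_derivative[of q] unfolding df
    by (intro has_derivative_Pair has_derivative_diff has_derivative_const)
  then show "((FL2_embed \<circ> flag) has_derivative (\<lambda>x. (hor q x, - dN q x))) (at q)"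
    unfolding FL2_embed_flag by simp
qed

text \<open>Up to a constant factor, the right-hand side is the cubic form with \<open>x\<close> in one slot and the
  conjugate of \<open>z\<close> in the two others. Differentiating the explicit formula for the projector, the
  terms with the derivatives of \<open>P\<close> and of the area drop out, because they map \<open>m\<close> to
  vectors orthogonal to \<open>n\<close>.\<close>

lemma dN_component:
  assumes vw: "conformal_frame P p v w"
    and c: "2 * c\<^sup>2 * \<rho>\<^sup>2 = 1" "\<rho> > 0"
    and G: "G p v v = \<rho>\<^sup>2" "G p w w = \<rho>\<^sup>2" "G p v w = 0" "orient v w * area p = \<rho>\<^sup>2"
    and n: "n = of_real c *s (hor p v - \<i> *s hor p w)" and m: "m = of_real (- c) *s (hor p v + \<i> *s hor p w)"
    and frame: "unitary_frame (f p) n m"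
  shows "hprod (dN p x *v m) n
    = of_real (1 / \<rho>\<^sup>2) * (of_real (cubic p x v w) - \<i> * of_real (cubic p x v v))"
proof -
  let ?a = "hor p v" and ?b = "hor p w"
  define D where "D = (\<lambda>y x. dP p y *v dirderiv f p x + ddP p y x *v f p)"
  have o: "orient v w \<noteq> 0" using G(4) c(2) by auto
  define \<kappa> where "\<kappa> = (\<lambda>q. inverse (orient v w * area q) / 2)"
  have "smooth_on UNIV (\<lambda>q. inverse (area q) * (inverse (orient v w) / 2))"
    by (rule smooth_on_bounded_linear[OF open_UNIV bounded_linear_mult_left smooth_inverse_area])
  moreover have "(\<lambda>q. inverse (area q) * (inverse (orient v w) / 2)) = \<kappa>"
    by (simp add: \<kappa>_def fun_eq_iff mult.commute)
  ultimately have "smooth_on UNIV \<kappa>" by simp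
  then have \<kappa>: "(\<kappa> has_derivative dirderiv \<kappa> p) (at p)" using smooth_on_has_derivative by blast
  have hor: "((\<lambda>q. hor q y) has_derivative D y) (at p)" for y
    unfolding D_def by (rule hor_has_derivative)
  have ihor: "((\<lambda>q. \<i> *s hor q y) has_derivative (\<lambda>x. \<i> *s D y x)) (at p)" for y
    by (rule bounded_linear.has_derivative[OF
          bounded_bilinear.bounded_linear_right[OF bounded_bilinear_scale] hor])
  define S where "S = (\<lambda>x. (outer (\<i> *s ?b) (D v x) + outer (\<i> *s D w x) ?a)
    - (outer (\<i> *s ?a) (D w x) + outer (\<i> *s D v x) ?b))"
  have skew: "(skew v w has_derivative S) (at p)"
    unfolding skew_def[abs_def] S_def
    by (intro has_derivative_diff bounded_bilinear.FDERIV[OF bounded_bilinear_outer ihor hor])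
  have "((\<lambda>q. (1/2) *\<^sub>R (mat 1 - P q) + \<kappa> q *\<^sub>R skew v w q) has_derivative
      (\<lambda>x. (1/2) *\<^sub>R (0 - dP p x) + (\<kappa> p *\<^sub>R S x + dirderiv \<kappa> p x *\<^sub>R skew v w p))) (at p)"
    by (intro has_derivative_add has_derivative_scaleR_right has_derivative_diff has_derivative_const
        P_has_derivative bounded_bilinear.FDERIV[OF bounded_bilinear_scaleR \<kappa> skew])
  moreover have "conj_proj = (\<lambda>q. (1/2) *\<^sub>R (mat 1 - P q) + \<kappa> q *\<^sub>R skew v w q)"
    using conj_proj_eq[OF o] by (simp add: \<kappa>_def fun_eq_iff)
  ultimately have dN: "dN p x = (1/2) *\<^sub>R (0 - dP p x) + (\<kappa> p *\<^sub>R S x + dirderiv \<kappa> p x *\<^sub>R skew v w p)"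
    by (simp add: dirderiv_eqI)
  have ortho: "hprod m (f p) = 0" "hprod (f p) n = 0" "hprod m n = 0" "hprod n m = 0"
    using frame unitary_frame_swapped[OF frame] by (auto simp: unitary_frame_def)
  have "hprod (dP p x *v m) n = 0"
    by (subst dP_mult_vec[OF f_unit_at]) (simp add: hprod_simps ortho)
  moreover have "hprod (skew v w p *v m) n = 0"
  proof -
    have "skew v w p = \<rho>\<^sup>2 *\<^sub>R ((2 * c\<^sup>2) *\<^sub>R skew v w p)" using c(1) by (simp add: mult_ac)
    also have "(2 * c\<^sup>2) *\<^sub>R skew v w p = outer m m - outer n n"
      unfolding m n outer_conjugate_pair skew_def ..
    finally show ?thesis
      by (simp add: bounded_bilinear.scaleR_left[OF bounded_bilinear_cmatrix_vec]
          matrix_vector_mult_diff_rdistrib outer_mult_vec hprod_simps ortho)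
  qed
  ultimately have dN_S: "hprod (dN p x *v m) n = of_real (\<kappa> p) * hprod (S x *v m) n"
    unfolding dN
    by (simp add: matrix_vector_mult_add_rdistrib matrix_vector_mult_diff_rdistrib hprod_simps
        bounded_bilinear.scaleR_left[OF bounded_bilinear_cmatrix_vec]
        bounded_bilinear.minus_left[OF bounded_bilinear_cmatrix_vec])
  define X Y Z W where "X = hprod (D v x) ?a" "Y = hprod (D v x) ?b"
    "Z = hprod (D w x) ?a" "W = hprod (D w x) ?b"
  have conj: "hprod ?a (D v x) = cnj X" "hprod ?b (D v x) = cnj Y"
      "hprod ?a (D w x) = cnj Z" "hprod ?b (D w x) = cnj W"
    by (simp_all add: X_Y_Z_W_def cnj_hprod)
  have hprods: "hprod ?a ?a = of_real (\<rho>\<^sup>2)" "hprod ?b ?b = of_real (\<rho>\<^sup>2)" "hprod ?a ?b = 0" "hprod ?b ?a = 0"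
    using G G_symmetric[of p w v] by (simp_all add: hprod_hor)
  have "hprod (S x *v m) n = \<i> * of_real (c\<^sup>2 * \<rho>\<^sup>2) *
      (\<i> * (X - cnj X) - (Z - cnj Z) - (Y - cnj Y) - \<i> * (W - cnj W))"
    unfolding S_def m n
    by (simp add: matrix_vector_mult_add_rdistrib matrix_vector_mult_diff_rdistrib outer_mult_vec
        hprod_simps hprods conj X_Y_Z_W_def[symmetric] power2_eq_square algebra_simps)
  also have "c\<^sup>2 * \<rho>\<^sup>2 = 1 / 2" using c(1) by simp
  finally have "hprod (S x *v m) n
      = of_real (Im Z + Im Y) + \<i> * of_real (Im W - Im X)"
    by (simp add: complex_eq_iff)
  moreover have Im: "Im (hprod (D y x) (hor p z)) = cubic p x y z" for y z
    unfolding D_def hprod_derivative_hor conn_zero by (simp add: cubic_def)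
  moreover have "cubic p x w w = - cubic p x v v"
    using cubic_trace[OF vw, of x] cubic_symmetric by (metis add.commute eq_neg_iff_add_eq_0)
  moreover have "cubic p x w v = cubic p x v w" by (rule cubic_symmetric(2))
  ultimately have "hprod (S x *v m) n = 2 * (of_real (cubic p x v w) - \<i> * of_real (cubic p x v v))"
    by (simp add: X_Y_Z_W_def complex_eq_iff)
  moreover have "complex_of_real (\<kappa> p) * (2 * z) = of_real (1 / \<rho>\<^sup>2) * z" for z
    unfolding \<kappa>_def G(4) by (simp add: inverse_eq_divide)
  ultimately show ?thesis unfolding dN_S by (simp only:)
qed

text \<open>Two of the three conditions on the derivative of the frame hold because \<open>df\<close> is given by the
  frame itself. The remaining one, the relation between the \<open>n\<close>-components in the directions \<open>w\<close> and
  \<open>v\<close>, holds because the cubic form is trace free.\<close>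

lemma flag_derivative_in_g1_bundle:
  assumes vw: "conformal_frame P p v w"
  shows "((1/2) *\<^sub>R dirderiv (FL2_embed \<circ> flag) p v, - (1/2) *\<^sub>R dirderiv (FL2_embed \<circ> flag) p w)
    \<in> g1_bundle (flag p)"
proof -
  obtain \<rho> c n m where \<rho>: "\<rho> > 0" and c: "c > 0" "2 * c\<^sup>2 * \<rho>\<^sup>2 = 1"
    and G: "G p v v = \<rho>\<^sup>2" "G p w w = \<rho>\<^sup>2" "G p v w = 0" "orient v w * area p = \<rho>\<^sup>2"
    and n: "n = of_real c *s (hor p v - \<i> *s hor p w)" and m: "m = of_real (- c) *s (hor p v + \<i> *s hor p w)"
    and frame: "unitary_frame (f p) n m" and det: "det (columns3 (f p) n m) = 1"
    and N: "conj_proj p = outer m m"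
    using adapted_frame[OF vw] by blast
  note component = dN_component[OF vw c(2) \<rho> G n m frame]
  \<comment> \<open>the entries of the element of \<open>g1\<close>: \<open>\<alpha> n\<close> is \<open>f\<^sub>z\<close>, and \<open>\<beta>\<close> is read off from the
    derivative of the projector\<close>
  define \<alpha> where "\<alpha> = c * \<rho>\<^sup>2"
  define \<beta> where "\<beta> = - cnj (hprod (dN p v *v m) n)"
  have mm: "hprod m m = 1" using frame by (simp add: unitary_frame_def)
  have variation: "hprod (dN p x *v m) m = 0" "dN p x = outer (dN p x *v m) m + outer m (dN p x *v m)" for x
    using rank_one_projector_variation[OF mm dN_hermitian dN_product[of p x, unfolded N]] by auto
  have comp_f: "hprod (dN p x *v m) (f p) = - hprod m (hor p x)" for x
    unfolding hprod_mult_vec_left dN_hermitian dN_f N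
    by (simp add: outer_mult_vec hprod_simps cnj_hprod mm)
  have "hprod m (hor p v) = - of_real \<alpha>" "hprod m (hor p w) = - \<i> * of_real \<alpha>"
    using G G_symmetric[of p w v] by (simp_all add: m hprod_simps hprod_hor \<alpha>_def)
  moreover have "hprod (dN p w *v m) n = - \<i> * hprod (dN p v *v m) n"
  proof -
    have "cubic p w v w = - cubic p v v v" "cubic p w v v = cubic p v v w"
      using cubic_trace[OF vw, of v] cubic_symmetric by (metis add.commute eq_neg_iff_add_eq_0)+
    then show ?thesis unfolding component by (simp add: algebra_simps)
  qed
  ultimately have dN_m: "dN p v *v m = of_real \<alpha> *s f p - cnj \<beta> *s n"
      "dN p w *v m = \<i> *s (of_real \<alpha> *s f p + cnj \<beta> *s n)"
    using unitary_frame_expansion[OF frame, of "dN p v *v m"]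
      unitary_frame_expansion[OF frame, of "dN p w *v m"] variation(1) comp_f
    by (simp_all add: \<beta>_def vector_add_ldistrib vector_smult_assoc)
  have "complex_of_real \<alpha> * complex_of_real c * 2 = of_real (2 * c\<^sup>2 * \<rho>\<^sup>2)"
    by (simp add: \<alpha>_def power2_eq_square)
  then have \<alpha>c: "complex_of_real \<alpha> * complex_of_real c = 1 / 2" using c(2) by simp
  have "\<i> * (complex_of_real \<alpha> * (\<i> * complex_of_real c)) = (\<i> * \<i>) * (complex_of_real \<alpha> * complex_of_real c)"
    by (simp only: mult_ac)
  then have i\<alpha>ic: "\<i> * (complex_of_real \<alpha> * (\<i> * complex_of_real c)) = - (1 / 2)"
    unfolding \<alpha>c by simp
  have hor: "(1/2) *\<^sub>R hor p v = of_real (\<alpha> / 2) *s (n - m)"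
      "- (1/2) *\<^sub>R hor p w = (- \<i> * of_real (\<alpha> / 2)) *s (n + m)"
  proof -
    have "n - m = (2 * of_real c) *s hor p v" "n + m = (- 2 * \<i> * of_real c) *s hor p w"
      by (simp_all add: n m vec_eq_iff algebra_simps)
    then show "(1/2) *\<^sub>R hor p v = of_real (\<alpha> / 2) *s (n - m)"
      "- (1/2) *\<^sub>R hor p w = (- \<i> * of_real (\<alpha> / 2)) *s (n + m)"
      using \<alpha>c i\<alpha>ic by (simp_all add: scaleR_eq_scale vector_smult_assoc)
  qed
  have half: "(1/2) *\<^sub>R dN p x = outer ((1/2) *s (dN p x *v m)) m + outer m ((1/2) *s (dN p x *v m))" for x
  proof -
    have "(1/2) *s (dN p x *v m) = (1/2) *\<^sub>R (dN p x *v m)" by (simp add: scaleR_eq_scale)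
    then show ?thesis
      by (subst variation(2)) (simp add: scaleR_add_right bounded_bilinear.scaleR_left[OF bounded_bilinear_outer]
          bounded_bilinear.scaleR_right[OF bounded_bilinear_outer])
  qed
  have dNv: "(1/2) *\<^sub>R (- dN p v) = - (outer m ((1/2) *s (of_real \<alpha> *s f p - cnj \<beta> *s n))
      + outer ((1/2) *s (of_real \<alpha> *s f p - cnj \<beta> *s n)) m)"
    using half[of v] unfolding dN_m by (simp add: add.commute)
  have dNw: "- (1/2) *\<^sub>R (- dN p w) = - (outer m ((- \<i> / 2) *s (of_real \<alpha> *s f p + cnj \<beta> *s n))
      + outer ((- \<i> / 2) *s (of_real \<alpha> *s f p + cnj \<beta> *s n)) m)"
  proof -
    have eq: "(- \<i> / 2) *s (of_real \<alpha> *s f p + cnj \<beta> *s n) = - ((1/2) *s (dN p w *v m))"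
      unfolding dN_m by (simp add: vec_eq_iff)
    show ?thesis unfolding eq using half[of w]
      by (simp add: bounded_bilinear.minus_left[OF bounded_bilinear_outer]
          bounded_bilinear.minus_right[OF bounded_bilinear_outer] add.commute)
  qed
  show ?thesis
    unfolding dirderiv_flag scaleR_Pair
    by (rule g1_bundleI[OF frame det, of _ _ \<alpha> \<beta>])
      (simp_all only: flag_def plane_eq[OF frame N] hor dNv dNw)
qed

lemma flag_immersion: "immersion_on UNIV (FL2_embed \<circ> flag)"
  unfolding immersion_on_def
proof (intro conjI ballI)
  show "smooth_on UNIV (FL2_embed \<circ> flag)"
    unfolding FL2_embed_flag
    by (intro smooth_on_Pair smooth_f smooth_on_diff smooth_on_const smooth_conj_proj open_UNIV)
  show "inj (\<lambda>x. dirderiv (FL2_embed \<circ> flag) p x)" for p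
    unfolding dirderiv_flag using hor_inj by (auto simp: inj_def)
qed

lemma flag_primitive_lift: "primitive_lift \<phi> flag"
proof -
  have P: "orth_proj \<circ> \<phi> = P" by (simp add: P_def)
  have fst: "fst \<circ> flag = f" by (simp add: flag_def fun_eq_iff)
  have "snd (flag p) = {a + b | a b. a \<in> vec.span {f p} \<and>
      b \<in> vec.span {(1/2) *s (dirderiv f p v - \<i> *s dirderiv f p w)}}"
    if vw: "conformal_frame P p v w" for p v w
  proof -
    obtain \<rho> c n m where c: "c > 0" and n: "n = of_real c *s (hor p v - \<i> *s hor p w)"
      and frame: "unitary_frame (f p) n m" and N: "conj_proj p = outer m m"
      using adapted_frame[OF vw] by metis
    have "(1/2) *s (hor p v - \<i> *s hor p w) = (of_real (1 / (2 * c))) *s n"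
      using c by (simp add: n vector_smult_assoc)
    then show ?thesis
      using hyperplane_eq_span_sum[OF frame, of 1 "of_real (1 / (2 * c))"] c
      by (simp add: flag_def plane_eq[OF frame N] df)
  qed
  then show ?thesis
    unfolding primitive_lift_def primitive_def P fst Let_def
    using flag_in_FL2 flag_immersion flag_derivative_in_g1_bundle f_horizontal_lift by blast
qed

lemma flag_periodic:
  assumes "l \<in> \<Lambda>" "period l = 1"
  shows "flag (p + l) = flag p"
proof -
  have "f (p + l) = f p" using f_translate[OF assms(1)] assms(2) by simp
  then show ?thesis
    by (simp add: flag_def plane_def conj_proj_def skew_def P_periodic[OF assms(1)]
        dP_periodic[OF assms(1)] area_periodic[OF assms(1)])
qed

end

section \<open>Minimal Lagrangian tori\<close>

theorem proposition4:
  fixes \<Lambda> :: "(real^2) set" and \<phi> :: "real^2 \<Rightarrow> (complex^3) set"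
  assumes "minimal_lagrangian_torus \<Lambda> \<phi>"
  shows "\<exists>\<Lambda>' \<psi>.
    plane_lattice \<Lambda>' \<and> \<Lambda>' \<subseteq> \<Lambda> \<and>
    (covering_group \<Lambda>' \<Lambda> \<cong> integer_mod_group 1 \<or> covering_group \<Lambda>' \<Lambda> \<cong> integer_mod_group 3) \<and>
    primitive_lift \<phi> \<psi> \<and> periodic \<Lambda>' \<psi> \<and>
    minimal_legendrian (fst \<circ> \<psi>) \<and>
    (\<forall>f. horizontal_lift \<phi> f \<longrightarrow> (\<exists>c. norm c = 1 \<and> (\<forall>p. f p = c *s fst (\<psi> p)))) \<and>
    (\<exists>c. norm c = 1 \<and> special_lagrangian_cone (\<lambda>p. c *s fst (\<psi> p)))"
proof -
  interpret minimal_lagrangian \<Lambda> \<phi> using assms by (rule minimal_lagrangian.intro)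
  obtain f where "normalized_lift \<Lambda> \<phi> f" using normalized_lift_ex by blast
  then interpret normalized_lift \<Lambda> \<phi> f .
  interpret cubic_character \<Lambda> period by (rule cubic_character_period)
  have fst: "fst \<circ> flag = f" "fst (flag p) = f p" for p by (simp_all add: flag_def fun_eq_iff)
  have "periodic ker flag"
    unfolding periodic_def ker_def using flag_periodic by blast
  moreover have "\<exists>c. norm c = 1 \<and> (\<forall>p. k p = c *s f p)" if "horizontal_lift \<phi> k" for k
  proof (rule horizontal_lift_unique)
    show "k differentiable (at p)" for p
      using that smooth_on_has_derivative differentiableI unfolding horizontal_lift_def by blast
    show "unit_at p (k p)" "hprod (dirderiv k p v) (k p) = 0" for p v
      using that by (auto simp: horizontal_lift_def unit_at_def contact_distribution_def)
  qed
  moreover have "ker \<subseteq> \<Lambda>" by (auto simp: ker_def)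
  ultimately show ?thesis
    using plane_lattice_ker covering_group_ker flag_primitive_lift f_minimal_legendrian
      special_lagrangian_cone_f
    by (intro exI[of _ ker] exI[of _ flag] conjI allI impI) (auto simp: fst intro: exI[of _ \<i>])
qed

end
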